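(* Let $r\in\{4,5,6,7\}$. There exists $(\varepsilon_F)_{F\in\boldsymbol{\mathcal K}_r}\in\{\pm1\}^{\boldsymbol{\mathcal K}_r}$, unique up to a global sign, such that the following differential relation is satisfied: $$\sum_{F\in\boldsymbol{\mathcal K}_r}\varepsilon_F\,U_F^*(\Omega_r)=0 .$$ Consequently, the tuple $\big(\varepsilon_FU_F^*(\Omega_r)\big)_{F\in\boldsymbol{\mathcal K}_r}$ is an $(r-3)$-abelian relation of the Gelfand-MacPherson web $\boldsymbol W^{GM}_{\boldsymbol Y_r}$ (denoted $\mathbf{HLOG}_{\boldsymbol Y_r}$).
   Context: **Spaces.** For $r=4,5,6,7$ let $G_r$ be the simple complex Lie group of type $A_4,D_5,E_6,E_7$ and $\boldsymbol{\mathcal G}_r=G_r/P_r\subset\mathbf P(V_r)$ the minuscule homogeneous space $G_2(\mathbf C^5)\subset\mathbf P^9$, the spinor tenfold $\mathbb S_5\subset\mathbf P^{15}$, the Cayley plane $\mathbb O\mathbf P^2\subset\mathbf P^{26}$, the 27-dimensional Freudenthal variety $E_7/P\subset\mathbf P^{55}$, in its minuscule embedding; $H_r$ is the Cartan torus. The weights of $V_r$ (all of multiplicity 1) are in natural bijection with the set $\boldsymbol{\mathcal L}_r$ of lines of a smooth del Pezzo surface of degree $9-r$; $x_\ell$ is the weight coordinate corresponding to $\ell\in\boldsymbol{\mathcal L}_r$. $\boldsymbol{\mathcal Y}_r$ is the quotient by $H_r$ of the open set of stable points with minimal stabilizer of $\boldsymbol{\mathcal G}_r$; it is rational of dimension $2,5,10,20$,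 and $\boldsymbol Y_r$ is an affine space birational to it. **Web.** $\boldsymbol{\mathcal K}_r$ is the set of conic classes $\mathfrak c$ ($\mathfrak c^2=0$, $-K\cdot\mathfrak c=2$) of the del Pezzo surface, identified with the cross-polytope facets $F$ of the weight polytope: the vertices of $F$ are the $2r-2$ lines $\ell$ with $\ell'=\mathfrak c-\ell\in\boldsymbol{\mathcal L}_r$, forming $r-1$ pairs $\{\ell,\ell'\}$. The projection of $\boldsymbol{\mathcal G}_r$ to the coordinates indexed by $F$ is a smooth quadric $\sum_{\{\ell,\ell'\}}\pm x_\ell x_{\ell'}=0$ in $\mathbf P^{2r-3}$ (weight coordinates suitably scaled). The face map $\pi_F:\boldsymbol{\mathcal Y}_r\dashrightarrow\mathbf P^{r-3}$ is $[u_0:\dots:u_{r-3}]$ with $u_j=\pm x_{\ell_j}x_{\ell_j'}$ for $r-2$ of the pairs, signs chosen so that the product for the remaining pair is $\pm(u_0+\dots+u_{r-3})$. $U_F:\boldsymbol Y_r\dashrightarrow\mathbf P^{r-3}$ is $\pi_F$ composed with the birational map $\boldsymbol Y_r\simeq\boldsymbol{\mathcal Y}_r$, and $\boldsymbol W^{GM}_{\boldsymbol Y_r}$ is the web with first integrals $U_F$, $F\in\boldsymbol{\mathcal K}_r$. An $(r-3)$-abelian relation is a tuple $(\eta_F)_F$ of pull-backs $\eta_F=U_F^*(\omega_F)$ of $(r-3)$-forms with $\sum_F\eta_F=0$. **Form.** In the chart $u_0=1$, with $L_i=u_i$ for $1\le i\le r-3$ and $L_{r-2}=1+\sum_{i=1}^{r-3}u_i$,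 put $$\Omega_r=\sum_{i=1}^{r-2}(-1)^{i-1}\ln(L_i)\;d\ln L_1\wedge\dots\wedge\widehat{d\ln L_i}\wedge\dots\wedge d\ln L_{r-2}.$$ $\Omega_r$ is multivalued: the identity is understood locally, for suitable compatible determinations of the logarithms (equivalently, globally with each $\ln(L_i)$ in coefficient position replaced by $\ln|L_i|$). *)

theory Defs
  imports "HOL-Analysis.Analysis"
begin

section \<open>Lines and conics on a del Pezzo surface of degree 9 - r\<close>

text \<open>
  The Picard lattice is \<open>\<int>H \<oplus> \<int>E\<^sub>1 \<oplus> \<dots> \<oplus> \<int>E\<^sub>r\<close> with \<open>H\<^sup>2 = 1\<close>, \<open>E\<^sub>i\<^sup>2 = -1\<close>; a class is the
  function giving its coefficients, \<open>0\<close> being the index of \<open>H\<close>.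
\<close>

type_synonym pic = "nat \<Rightarrow> int"

definition pic_lattice :: "nat \<Rightarrow> pic set" where
  "pic_lattice r = {a. \<forall>i>r. a i = 0}"

definition intersection_form :: "nat \<Rightarrow> pic \<Rightarrow> pic \<Rightarrow> int" where
  "intersection_form r a b = a 0 * b 0 - (\<Sum>i=1..r. a i * b i)"

definition canonical_class :: "nat \<Rightarrow> pic" where
  "canonical_class r = (\<lambda>i. if i = 0 then - 3 else if i \<le> r then 1 else 0)"

definition exceptional_class :: "nat \<Rightarrow> pic" where
  "exceptional_class k = (\<lambda>i. if i = k then 1 else 0)"

text \<open>For \<open>r \<le> 7\<close> a line is determined by its class, and the classes of the lines are exactly the
  \<open>(-1)\<close>-classes.\<close>

definition lines :: "nat \<Rightarrow> pic set" where
  "lines r = {l \<in> pic_lattice r. intersection_form r l l = - 1 \<and>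
     intersection_form r (canonical_class r) l = - 1}"

definition conics :: "nat \<Rightarrow> pic set" where
  "conics r = {c \<in> pic_lattice r. intersection_form r c c = 0 \<and>
     - intersection_form r (canonical_class r) c = 2}"

section \<open>The minuscule homogeneous space\<close>

text \<open>
  The simple roots \<open>H - E\<^sub>1 - E\<^sub>2 - E\<^sub>3\<close> and \<open>E\<^sub>i - E\<^sub>i\<^sub>+\<^sub>1\<close> form a basis of a root system of type
  \<open>A\<^sub>4, D\<^sub>5, E\<^sub>6, E\<^sub>7\<close> for \<open>r = 4, 5, 6, 7\<close>.  The lattice is negative definite on the roots, so the
  pairing of the weight of a line \<open>l\<close> with the coroot of \<open>\<alpha>\<close> is \<open>- l \<cdot> \<alpha>\<close>.
\<close>

definition simple_root :: "nat \<Rightarrow> pic" where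
  "simple_root i =
     (if i = 0 then (\<lambda>j. if j = 0 then 1 else if j \<le> 3 then - 1 else 0)
      else (\<lambda>j. exceptional_class i j - exceptional_class (Suc i) j))"

text \<open>Vectors of \<open>V\<^sub>r\<close> are given by their weight coordinates, extended by 0 outside \<open>lines r\<close>.\<close>

type_synonym weight_vec = "pic \<Rightarrow> complex"

definition weight_space :: "nat \<Rightarrow> weight_vec set" where
  "weight_space r = {x. \<forall>l. l \<notin> lines r \<longrightarrow> x l = 0}"

definition weight_vector :: "pic \<Rightarrow> weight_vec" where
  "weight_vector l = (\<lambda>m. if m = l then 1 else 0)"

definition scale :: "complex \<Rightarrow> weight_vec \<Rightarrow> weight_vec" where
  "scale c x = (\<lambda>l. c * x l)"

text \<open>
  In a minuscule representation the weight basis can be scaled so that the Chevalley generators of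
  the simple roots send each weight vector to a weight vector or to 0; on coordinates,
  \<open>e\<^sub>\<alpha>\<close> sends the basis vector of \<open>l\<close> to that of \<open>l + \<alpha>\<close> if \<open>l + \<alpha>\<close> is a line, and to 0 otherwise.
\<close>

definition root_operator :: "nat \<Rightarrow> pic \<Rightarrow> weight_vec \<Rightarrow> weight_vec" where
  "root_operator r \<alpha> x = (\<lambda>l. if l \<in> lines r \<and> (\<lambda>j. l j - \<alpha> j) \<in> lines r
     then x (\<lambda>j. l j - \<alpha> j) else 0)"

text \<open>These operators have square zero, so this is \<open>exp (t e\<^sub>\<alpha>)\<close>.\<close>

definition root_group_element :: "nat \<Rightarrow> pic \<Rightarrow> complex \<Rightarrow> weight_vec \<Rightarrow> weight_vec" where
  "root_group_element r \<alpha> t x = (\<lambda>l. x l + t * root_operator r \<alpha> x l)"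

text \<open>The image of the simply connected group \<open>G\<^sub>r\<close> in \<open>GL(V\<^sub>r)\<close>, which is generated by the root
  subgroups of the simple roots and of their opposites.\<close>

inductive_set G_group :: "nat \<Rightarrow> (weight_vec \<Rightarrow> weight_vec) set" for r :: nat where
  G_id: "id \<in> G_group r"
| G_pos: "g \<in> G_group r \<Longrightarrow> i < r \<Longrightarrow>
    root_group_element r (simple_root i) t \<circ> g \<in> G_group r"
| G_neg: "g \<in> G_group r \<Longrightarrow> i < r \<Longrightarrow>
    root_group_element r (\<lambda>j. - simple_root i j) t \<circ> g \<in> G_group r"

text \<open>The affine cone (without its vertex) over \<open>G\<^sub>r/P\<^sub>r\<close>, the orbit of the line spanned by an
  extremal weight vector.  With the above simple roots, \<open>E\<^sub>r\<close> is the lowest weight.\<close>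

definition minuscule_cone :: "nat \<Rightarrow> weight_vec set" where
  "minuscule_cone r =
     {scale c (g (weight_vector (exceptional_class r))) | c g. c \<noteq> 0 \<and> g \<in> G_group r}"

section \<open>The torus quotient and its birational charts\<close>

text \<open>The element of the Cartan torus that is the product of the \<open>\<alpha>\<^sub>i\<^sup>\<or>(t\<^sub>i)\<close>, \<open>i < r\<close>.\<close>

definition torus_element :: "nat \<Rightarrow> (nat \<Rightarrow> complex) \<Rightarrow> weight_vec \<Rightarrow> weight_vec" where
  "torus_element r t x = (\<lambda>l. if l \<in> lines r
     then (\<Prod>i<r. t i powi (- intersection_form r l (simple_root i))) * x l else 0)"

definition cartan_torus :: "nat \<Rightarrow> (weight_vec \<Rightarrow> weight_vec) set" where
  "cartan_torus r = {torus_element r t | t. \<forall>i<r. t i \<noteq> 0}"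

text \<open>Stability of the point \<open>[x]\<close> in the sense of geometric invariant theory, for the linearisation
  given by \<open>V\<^sub>r\<close>.\<close>

definition stable :: "nat \<Rightarrow> weight_vec \<Rightarrow> bool" where
  "stable r x \<longleftrightarrow> closed {h x | h. h \<in> cartan_torus r} \<and> finite {h \<in> cartan_torus r. h x = x}"

text \<open>The stabilizer of \<open>[x]\<close> always contains the kernel of the action on \<open>P(V\<^sub>r)\<close>, which is the
  image of the centre of \<open>G\<^sub>r\<close>.\<close>

definition minimal_stabilizer :: "nat \<Rightarrow> weight_vec \<Rightarrow> bool" where
  "minimal_stabilizer r x \<longleftrightarrow>
     {h \<in> cartan_torus r. \<exists>c. c \<noteq> 0 \<and> h x = scale c x} =
     {h \<in> cartan_torus r. \<exists>c. c \<noteq> 0 \<and> (\<forall>y\<in>weight_space r. h y = scale c y)}"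

definition stable_cone :: "nat \<Rightarrow> weight_vec set" where
  "stable_cone r = {x \<in> minuscule_cone r. stable r x \<and> minimal_stabilizer r x}"

text \<open>The points of \<open>\<Y>\<^sub>r\<close> are the sets \<open>torus_orbit r x\<close> for \<open>x \<in> stable_cone r\<close>.\<close>

definition torus_orbit :: "nat \<Rightarrow> weight_vec \<Rightarrow> weight_vec set" where
  "torus_orbit r x = {scale c (h x) | c h. c \<noteq> 0 \<and> h \<in> cartan_torus r}"

definition GM_quotient :: "nat \<Rightarrow> weight_vec set set" where
  "GM_quotient r = torus_orbit r ` stable_cone r"

definition GM_dim :: "nat \<Rightarrow> nat" where
  "GM_dim r = (if r = 4 then 2 else if r = 5 then 5 else if r = 6 then 10 else 20)"

inductive_set polynomial_algebra :: "('a \<Rightarrow> complex) set \<Rightarrow> ('a \<Rightarrow> complex) set"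
  for X :: "('a \<Rightarrow> complex) set" where
  generator: "f \<in> X \<Longrightarrow> f \<in> polynomial_algebra X"
| const: "(\<lambda>_. c) \<in> polynomial_algebra X"
| add: "f \<in> polynomial_algebra X \<Longrightarrow> g \<in> polynomial_algebra X \<Longrightarrow>
    (\<lambda>x. f x + g x) \<in> polynomial_algebra X"
| mult: "f \<in> polynomial_algebra X \<Longrightarrow> g \<in> polynomial_algebra X \<Longrightarrow>
    (\<lambda>x. f x * g x) \<in> polynomial_algebra X"

abbreviation affine_polynomials :: "((complex^'n) \<Rightarrow> complex) set" where
  "affine_polynomials \<equiv> polynomial_algebra (range (\<lambda>k y. y $ k))"

abbreviation weight_polynomials :: "nat \<Rightarrow> (weight_vec \<Rightarrow> complex) set" where
  "weight_polynomials r \<equiv> polynomial_algebra ((\<lambda>l x. x l) ` lines r)"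

text \<open>\<open>P\<close> holds on a non-empty principal Zariski open subset of the irreducible set \<open>X\<close>.\<close>

definition generically :: "('a \<Rightarrow> complex) set \<Rightarrow> 'a set \<Rightarrow> ('a \<Rightarrow> bool) \<Rightarrow> bool" where
  "generically R X P \<longleftrightarrow>
     (\<exists>q\<in>R. (\<exists>x\<in>X. q x \<noteq> 0) \<and> (\<forall>x\<in>X. q x \<noteq> 0 \<longrightarrow> P x))"

text \<open>
  \<open>birational_chart r \<phi>\<close>: the map \<open>y \<mapsto> torus_orbit r (\<phi> y)\<close> is a birational map from the affine space
  \<open>complex^'n\<close> to \<open>GM_quotient r\<close>.  The map is given by a lift \<open>\<phi>\<close> to the cone with polynomial
  coordinates.  There is no loss of generality: the stable points form a torsor over the quotient
  under a split torus, so a rational map to the quotient lifts by Hilbert 90, and denominators can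
  be cleared in the cone.  The inverse \<open>x \<mapsto> (p k x / q x)\<^sub>k\<close> is a rational map on the cone that is
  constant on torus orbits.
\<close>

definition birational_chart :: "nat \<Rightarrow> (complex^'n \<Rightarrow> weight_vec) \<Rightarrow> bool" where
  "birational_chart r \<phi> \<longleftrightarrow>
     (\<forall>l\<in>lines r. (\<lambda>y. \<phi> y l) \<in> affine_polynomials) \<and>
     (\<forall>l. l \<notin> lines r \<longrightarrow> (\<forall>y. \<phi> y l = 0)) \<and>
     generically affine_polynomials UNIV (\<lambda>y. torus_orbit r (\<phi> y) \<in> GM_quotient r) \<and>
     (\<exists>p q. (\<forall>k. p k \<in> weight_polynomials r) \<and> q \<in> weight_polynomials r \<and>
        (\<exists>x\<in>minuscule_cone r. q x \<noteq> 0) \<and>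
        (\<forall>x\<in>minuscule_cone r. \<forall>x'\<in>torus_orbit r x. q x \<noteq> 0 \<and> q x' \<noteq> 0 \<longrightarrow>
           (\<forall>k. p k x / q x = p k x' / q x')) \<and>
        generically affine_polynomials UNIV
          (\<lambda>y. q (\<phi> y) \<noteq> 0 \<and> (\<chi> k. p k (\<phi> y) / q (\<phi> y)) = y) \<and>
        generically (weight_polynomials r) (minuscule_cone r)
          (\<lambda>x. q x \<noteq> 0 \<and> torus_orbit r (\<phi> (\<chi> k. p k x / q x)) = torus_orbit r x))"

section \<open>Face maps\<close>

text \<open>
  An admissible choice of homogeneous coordinates for the face of the conic class \<open>c\<close>:
  the pairs \<open>{a j, c - a j}\<close>, \<open>j \<le> r - 2\<close>, are the pairs of lines of that face, without repetition,
  and \<open>s\<close> gives the signs in the equation of the quadric.  The last pair is the remaining one.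
\<close>

definition partner :: "pic \<Rightarrow> pic \<Rightarrow> pic" where
  "partner c l = (\<lambda>i. c i - l i)"

definition face_frame :: "nat \<Rightarrow> pic \<Rightarrow> (nat \<Rightarrow> pic) \<Rightarrow> (nat \<Rightarrow> complex) \<Rightarrow> bool" where
  "face_frame r c a s \<longleftrightarrow>
     bij_betw (\<lambda>j. {a j, partner c (a j)}) {0..r - 2}
       {{l, partner c l} | l. l \<in> lines r \<and> partner c l \<in> lines r} \<and>
     (\<forall>j\<in>{0..r - 2}. s j = 1 \<or> s j = - 1) \<and>
     (\<forall>x\<in>minuscule_cone r. (\<Sum>j=0..r - 2. s j * x (a j) * x (partner c (a j))) = 0)"

definition face_coord :: "pic \<Rightarrow> (nat \<Rightarrow> pic) \<Rightarrow> (nat \<Rightarrow> complex) \<Rightarrow> nat \<Rightarrow> weight_vec \<Rightarrow> complex" where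
  "face_coord c a s j x = s j * x (a j) * x (partner c (a j))"

text \<open>
  The coordinates of the chart \<open>u\<^sub>0 = 1\<close> of projective space are indexed by the finite type \<open>'m\<close>;
  \<open>lab\<close>, a bijection onto \<open>{1..r - 3}\<close>, gives their numbers.  \<open>face_map\<close> is \<open>U\<^sub>F\<close> in this chart:
  each \<open>u\<^sub>j\<close> is multiplied by the same factor along a torus orbit, so \<open>u\<^sub>j/u\<^sub>0\<close> may be computed on the
  lift \<open>\<phi>\<close>.
\<close>

definition face_map :: "('m::finite \<Rightarrow> nat) \<Rightarrow> (complex^'n \<Rightarrow> weight_vec) \<Rightarrow>
    pic \<Rightarrow> (nat \<Rightarrow> pic) \<Rightarrow> (nat \<Rightarrow> complex) \<Rightarrow> complex^'n \<Rightarrow> complex^'m" where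
  "face_map lab \<phi> c a s y =
     (\<chi> k. face_coord c a s (lab k) (\<phi> y) / face_coord c a s 0 (\<phi> y))"

section \<open>Differential forms\<close>

text \<open>A \<open>k\<close>-form is evaluated at a point and at \<open>k\<close> tangent vectors \<open>v 0, \<dots>, v (k - 1)\<close>.\<close>

type_synonym 'a form = "'a \<Rightarrow> (nat \<Rightarrow> 'a) \<Rightarrow> complex"

primrec C_k_on :: "nat \<Rightarrow> 'a::real_normed_vector set \<Rightarrow> ('a \<Rightarrow> complex) \<Rightarrow> bool" where
  "C_k_on 0 S f \<longleftrightarrow> continuous_on S f"
| "C_k_on (Suc k) S f \<longleftrightarrow> f differentiable_on S \<and>
     (\<forall>v. C_k_on k S (\<lambda>x. frechet_derivative f (at x) v))"

text \<open>Smooth forms of type \<open>(k,0)\<close>: complex multilinear, with coefficients smooth in the real sense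
  (those of \<open>\<Omega>\<^sub>r\<close> involve \<open>ln \<bar>L\<^sub>i\<bar>\<close>).\<close>

definition differential_form :: "nat \<Rightarrow> (complex^'m) set \<Rightarrow> (complex^'m) form \<Rightarrow> bool" where
  "differential_form k S \<omega> \<longleftrightarrow> open S \<and>
     (\<forall>x\<in>S.
        (\<forall>v w. (\<forall>i<k. v i = w i) \<longrightarrow> \<omega> x v = \<omega> x w) \<and>
        (\<forall>v i b c d. i < k \<longrightarrow>
           \<omega> x (v(i := c *s b + d)) = c * \<omega> x (v(i := b)) + \<omega> x (v(i := d))) \<and>
        (\<forall>v i j. i < k \<and> j < k \<and> i \<noteq> j \<and> v i = v j \<longrightarrow> \<omega> x v = 0)) \<and>
     (\<forall>v n. C_k_on n S (\<lambda>x. \<omega> x v))"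

definition pullback :: "('a::real_normed_vector \<Rightarrow> 'b::real_normed_vector) \<Rightarrow> 'b form \<Rightarrow> 'a form"
  where "pullback f \<omega> y v = \<omega> (f y) (\<lambda>i. frechet_derivative f (at y) (v i))"

definition wedge :: "('a \<Rightarrow> 'a \<Rightarrow> complex) list \<Rightarrow> 'a form" where
  "wedge \<alpha>s x v = (\<Sum>p | p permutes {..<length \<alpha>s}.
     of_int (sign p) * (\<Prod>j<length \<alpha>s. (\<alpha>s ! j) x (v (p j))))"

text \<open>\<open>k\<close>-abelian relations, on the common domain \<open>D\<close>, of the web with first integrals
  \<open>U F\<close>, \<open>F \<in> K\<close>.\<close>

definition abelian_relation ::
  "nat \<Rightarrow> 'i set \<Rightarrow> (complex^'n) set \<Rightarrow> ('i \<Rightarrow> complex^'n \<Rightarrow> complex^'m) \<Rightarrow>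
     ('i \<Rightarrow> (complex^'n) form) \<Rightarrow> bool" where
  "abelian_relation k K D U \<eta> \<longleftrightarrow>
     (\<exists>S \<omega>. \<forall>F\<in>K. differential_form k (S F) (\<omega> F) \<and> U F ` D \<subseteq> S F \<and>
        (\<forall>y\<in>D. \<forall>v. \<eta> F y v = pullback (U F) (\<omega> F) y v)) \<and>
     (\<forall>y\<in>D. \<forall>v. (\<Sum>F\<in>K. \<eta> F y v) = 0)"

section \<open>The form and the web\<close>

definition L_fun :: "nat \<Rightarrow> ('m::finite \<Rightarrow> nat) \<Rightarrow> nat \<Rightarrow> complex^'m \<Rightarrow> complex" where
  "L_fun r lab i u = (if i = r - 2 then 1 + (\<Sum>k\<in>UNIV. u $ k) else u $ inv_into UNIV lab i)"

definition dln :: "(complex^'m \<Rightarrow> complex) \<Rightarrow> complex^'m \<Rightarrow> complex^'m \<Rightarrow> complex" where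
  "dln f u v = frechet_derivative f (at u) v / f u"

text \<open>The single-valued version of \<open>\<Omega>\<^sub>r\<close>, with coefficients \<open>ln \<bar>L\<^sub>i\<bar>\<close>.\<close>

definition Omega :: "nat \<Rightarrow> ('m::finite \<Rightarrow> nat) \<Rightarrow> (complex^'m) form" where
  "Omega r lab u v = (\<Sum>i=1..r - 2. (- 1) ^ (i - 1) * of_real (ln (cmod (L_fun r lab i u))) *
     wedge (map (\<lambda>j. dln (L_fun r lab j)) (remove1 i [1..<r - 1])) u v)"

text \<open>The points where all the \<open>U\<^sub>F\<^sup>*(\<Omega>\<^sub>r)\<close> are defined: \<open>U\<^sub>F\<close> takes values in the chart \<open>u\<^sub>0 = 1\<close>, outside
  the hyperplanes \<open>L\<^sub>i = 0\<close>.\<close>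

definition web_domain :: "nat \<Rightarrow> ('m::finite \<Rightarrow> nat) \<Rightarrow> (complex^'n \<Rightarrow> weight_vec) \<Rightarrow>
    (pic \<Rightarrow> nat \<Rightarrow> pic) \<Rightarrow> (pic \<Rightarrow> nat \<Rightarrow> complex) \<Rightarrow> (complex^'n) set" where
  "web_domain r lab \<phi> a s = {y. \<forall>F\<in>conics r. face_coord F (a F) (s F) 0 (\<phi> y) \<noteq> 0 \<and>
     (\<forall>i\<in>{1..r - 2}. L_fun r lab i (face_map lab \<phi> F (a F) (s F) y) \<noteq> 0)}"

definition hlog_relation :: "nat \<Rightarrow> ('m::finite \<Rightarrow> nat) \<Rightarrow> (complex^'n \<Rightarrow> weight_vec) \<Rightarrow>
    (pic \<Rightarrow> nat \<Rightarrow> pic) \<Rightarrow> (pic \<Rightarrow> nat \<Rightarrow> complex) \<Rightarrow> (pic \<Rightarrow> int) \<Rightarrow> bool" where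
  "hlog_relation r lab \<phi> a s \<epsilon> \<longleftrightarrow>
     (\<forall>y\<in>web_domain r lab \<phi> a s. \<forall>v.
        (\<Sum>F\<in>conics r. of_int (\<epsilon> F) *
           pullback (face_map lab \<phi> F (a F) (s F)) (Omega r lab) y v) = 0)"

definition sign_vector :: "nat \<Rightarrow> (pic \<Rightarrow> int) \<Rightarrow> bool" where
  "sign_vector r \<epsilon> \<longleftrightarrow> (\<forall>F\<in>conics r. \<epsilon> F = 1 \<or> \<epsilon> F = - 1)"

end

theory Submission
  imports Defs "Jordan_Normal_Form.Determinant" "HOL-Real_Asymp.Real_Asymp"
begin

text \<open>
  The coordinates \<open>u\<^sub>j = \<plusminus> x\<^bsub>a\<^esub> x\<^bsub>F-a\<^esub>\<close>, \<open>a = a\<^sub>j\<close>, of the face of a conic class \<open>F\<close> have sum 0 on the cone.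
  With this, \<open>U\<^sub>F\<^sup>*(\<Omega>\<^sub>r)\<close>, evaluated on tangent vectors \<open>\<xi>\<^sub>i\<close>, is the determinant of size \<open>r - 1\<close> whose
  columns are the pairs of lines of \<open>F\<close>, with a row of ones, the row of the \<open>ln \<bar>u\<^sub>j\<bar>\<close>, and the rows of
  the logarithmic derivatives of the \<open>u\<^sub>j\<close> along the \<open>\<xi>\<^sub>i\<close>.  The row of ones makes it depend on the
  ratios of the \<open>u\<^sub>j\<close> only (\<open>Omega_mdet\<close>, \<open>pullback_Omega\<close>).  The entries \<open>ln \<bar>u\<^sub>j\<bar> = ln \<bar>x\<^bsub>a\<^esub>\<bar> + ln \<bar>x\<^bsub>F-a\<^esub>\<bar>\<close>
  and the logarithmic derivatives have the form \<open>G (a) + G (F - a)\<close> for functions \<open>G\<close> on the set of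
  lines.  The determinant \<open>pairdet\<close> makes sense for arbitrary such functions \<open>G\<^sub>0, \<dots>, G\<^sub>r\<^sub>-\<^sub>3\<close>.

  Existence.  The relation holds for arbitrary functions \<open>G\<^sub>k\<close> (\<open>hlog_sum_eq_0\<close>), so it is a
  statement about lines alone.  An ordering of the pairs of \<open>F\<close> has an orientation, the sign of
  the determinant of the vectors \<open>2 a\<^sub>j - F\<close>, \<open>K\<close> and \<open>F\<close>, corrected by a parity to make it insensitive
  to replacing \<open>a\<^sub>j\<close> by \<open>F - a\<^sub>j\<close>.  Multiplied by its orientation, \<open>pairdet\<close> does not depend on the
  ordering.  A reflection in a root has determinant \<open>-1\<close>, so the sum \<open>T(G)\<close> of these oriented determinants
  over all \<open>F\<close> is anti-invariant under the Weyl group (\<open>hlog_sum_reflection\<close>).  By multilinearity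
  it suffices to let each \<open>G\<^sub>k\<close> be the indicator function of a line.  If \<open>F\<close> contributes, these
  \<open>r - 2\<close> lines lie in different pairs of \<open>F\<close>, and then some root is orthogonal to all of them
  (\<open>orthogonal_root_exists\<close>).  Its reflection fixes all the \<open>G\<^sub>k\<close>, so \<open>T(G) = - T(G) = 0\<close>.

  Uniqueness.  Let \<open>\<kappa>\<^sub>F\<close> be the quotient of another choice of signs by the orientations.  The inverse of
  the chart and a density argument along polynomial paths in the group turn the relation on the
  affine space into one at the points of the cone with non-zero coordinates (\<open>chart_relation\<close>).
  Relations of this kind, called \<open>lin_rel\<close> below, contain the constant ones and are permuted by the
  Weyl group, which is realised by signed permutations of the coordinates (\<open>lin_rel_reflection\<close>).
  After subtracting a constant, \<open>\<kappa>\<close> vanishes on \<open>H - E\<^sub>2\<close>.  Let now \<open>x\<close> tend to a point where exactly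
  the coordinates of \<open>E\<^sub>3, \<dots>, E\<^sub>r\<close> and \<open>H - E\<^sub>1 - E\<^sub>2\<close> vanish, to first order.  For all conic classes
  other than \<open>H - E\<^sub>1\<close> and \<open>H - E\<^sub>2\<close> at least two pairs avoid these lines, and by Cramer's rule their
  determinants tend to 0, whereas the one of \<open>H - E\<^sub>1\<close> tends to a non-zero multiple of \<open>ln (r - 2)\<close>.  Hence
  \<open>\<kappa>\<close> agrees on \<open>H - E\<^sub>1\<close> and \<open>H - E\<^sub>2\<close> (\<open>lin_rel_adjacent\<close>).  The other simple reflections fix
  \<open>H - E\<^sub>1\<close>, so induction along the Weyl group shows that \<open>\<kappa>\<close> is constant (\<open>lin_rel_constant\<close>).

  The terms are smooth forms because the coefficients of \<open>\<Omega>\<^sub>r\<close> lie in an algebra of functions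
  closed under directional derivatives (\<open>log_algebra_derivative\<close>).
\<close>

(* The dollar sign denotes the components of vectors indexed by a finite type only. *)
no_notation Matrix.vec_index (infixl \<open>$\<close> 100)

section \<open>Determinants with given entries\<close>

text \<open>The entries are a function on all pairs of numbers, so passing to a minor is a reindexing.\<close>

definition mdet :: "nat \<Rightarrow> (nat \<Rightarrow> nat \<Rightarrow> 'a::comm_ring_1) \<Rightarrow> 'a" where
  "mdet n f = det (mat n n (\<lambda>(i, j). f i j))"

lemma mdet_leibniz:
  "mdet n f = (\<Sum>p | p permutes {0..<n}. of_int (sign p) * (\<Prod>i=0..<n. f i (p i)))"
proof -
  have "(\<Prod>i = 0..<n. mat n n (\<lambda>(i, j). f i j) $$ (i, p i)) = (\<Prod>i=0..<n. f i (p i))"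
    if "p permutes {0..<n}" for p
    using that by (intro prod.cong) (auto dest: permutes_in_image[of p _])
  then show ?thesis
    unfolding mdet_def by (subst det_def'[of _ n]) (auto intro!: sum.cong)
qed

lemma mdet_cong:
  "(\<And>i j. i < n \<Longrightarrow> j < n \<Longrightarrow> f i j = g i j) \<Longrightarrow> mdet n f = mdet n g"
  unfolding mdet_def by (rule arg_cong[where f = det]) (auto intro!: eq_matI)

lemma mdet_transpose: "mdet n (\<lambda>i j. f j i) = mdet n f"
  unfolding mdet_def
  by (subst det_transpose[of "mat n n (\<lambda>(i, j). f i j)" n, symmetric])
    (auto intro!: arg_cong[where f = det] eq_matI)

lemma mdet_permute_scale_rows:
  assumes "p permutes {0..<n}"
  shows "mdet n (\<lambda>i j. e i * f (p i) j) = (\<Prod>i=0..<n. e i) * (of_int (sign p) * mdet n f)"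
proof -
  have "mdet n (\<lambda>i j. f (p i) j) = of_int (sign p) * mdet n f"
  proof -
    have "mat n n (\<lambda>(i, j). f (p i) j) = mat n n (\<lambda>(i, j). mat n n (\<lambda>(i, j). f i j) $$ (p i, j))"
      using assms by (intro eq_matI) (auto dest: permutes_in_image[of p _])
    then show ?thesis
      unfolding mdet_def using det_permute_rows[of "mat n n (\<lambda>(i, j). f i j)" n p] assms by simp
  qed
  moreover have "mdet n (\<lambda>i j. e i * g i j) = (\<Prod>i=0..<n. e i) * mdet n g" for g
    unfolding mdet_leibniz by (simp add: prod.distrib sum_distrib_left mult_ac)
  ultimately show ?thesis by simp
qed

lemma mdet_permute_columns:
  assumes "p permutes {0..<n}"
  shows "mdet n (\<lambda>i j. f i (p j)) = of_int (sign p) * mdet n f"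
  using mdet_permute_scale_rows[OF assms, of "\<lambda>_. 1" "\<lambda>i j. f j i"]
  by (simp add: mdet_transpose[of n f] mdet_transpose[of n "\<lambda>i j. f i (p j)"])

lemma mdet_linear_row:
  assumes "k < n"
  shows "mdet n (\<lambda>i j. if i = k then \<Sum>l\<in>S. c l * h l j else f i j) =
    (\<Sum>l\<in>S. c l * mdet n (\<lambda>i j. if i = k then h l j else f i j))"
proof -
  have split: "(\<Prod>i=0..<n. if i = k then a i else b i) = a k * (\<Prod>i\<in>{0..<n}-{k}. b i)"
    for a b :: "nat \<Rightarrow> 'a"
    using assms by (subst prod.remove[of _ k]) (auto intro!: prod.cong)
  show ?thesis
    unfolding mdet_leibniz split sum_distrib_left sum_distrib_right
    by (subst sum.swap) (simp add: mult_ac)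
qed

lemma mdet_equal_rows:
  assumes "i < n" "k < n" "i \<noteq> k" "\<And>j. j < n \<Longrightarrow> f i j = f k j"
  shows "mdet n f = 0"
  unfolding mdet_def using assms
  by (intro det_identical_rows[of _ n i k]) (auto intro!: eq_vecI)

lemma mdet_equal_columns:
  assumes "j < n" "k < n" "j \<noteq> k" "\<And>i. i < n \<Longrightarrow> f i j = f i k"
  shows "mdet n f = 0"
  using mdet_equal_rows[of j n k "\<lambda>i j. f j i"] assms by (simp add: mdet_transpose[of n f])

lemma mdet_zero_row:
  assumes "k < n" "\<And>j. j < n \<Longrightarrow> f k j = 0"
  shows "mdet n f = 0"
proof -
  have "(\<Prod>i=0..<n. f i (p i)) = 0" if "p permutes {0..<n}" for p
    using assms permutes_in_image[OF that, of k] by (intro prod_zero) (auto intro!: bexI[of _ k])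
  then show ?thesis
    unfolding mdet_leibniz by (intro sum.neutral) auto
qed

lemma mdet_mult:
  "mdet n (\<lambda>i j. \<Sum>k<n. f i k * g k j) = mdet n f * mdet n g"
proof -
  have "mat n n (\<lambda>(i, j). \<Sum>k<n. f i k * g k j) = mat n n (\<lambda>(i, j). f i j) * mat n n (\<lambda>(i, j). g i j)"
    by (intro eq_matI) (auto simp: scalar_prod_def atLeast0LessThan)
  then show ?thesis
    unfolding mdet_def by (simp add: det_mult[of _ n])
qed

lemma mdet_lower_triangular:
  assumes "\<And>i j. i < j \<Longrightarrow> j < n \<Longrightarrow> f i j = 0"
  shows "mdet n f = (\<Prod>i<n. f i i)"
proof -
  have "mdet n f = prod_list (diag_mat (mat n n (\<lambda>(i, j). f i j)))"
    unfolding mdet_def by (rule det_lower_triangular[of n]) (use assms in auto)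
  then show ?thesis
    by (simp add: prod_list_diag_prod atLeast0LessThan)
qed

lemma mdet_upper_triangular:
  assumes "\<And>i j. j < i \<Longrightarrow> i < n \<Longrightarrow> f i j = 0"
  shows "mdet n f = (\<Prod>i<n. f i i)"
  using mdet_lower_triangular[of n "\<lambda>i j. f j i"] assms by (simp add: mdet_transpose[of n f])

lemma cofactor_mdet:
  "cofactor (mat (Suc n) (Suc n) (\<lambda>(i, j). f i j)) i j = (- 1) ^ (i + j) *
     mdet n (\<lambda>i' j'. f (if i' < i then i' else Suc i') (if j' < j then j' else Suc j'))"
  unfolding cofactor_def mdet_def mat_delete_def
  by (intro arg_cong[where f = "\<lambda>x. (- 1) ^ (i + j) * det x"]) (auto intro!: eq_matI)

lemma mdet_laplace_row_0:
  "mdet (Suc n) f = (\<Sum>j<Suc n. (- 1) ^ j * f 0 j *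
     mdet n (\<lambda>i' j'. f (Suc i') (if j' < j then j' else Suc j')))"
  unfolding mdet_def[of "Suc n"]
  by (subst laplace_expansion_row[of _ "Suc n" 0]) (auto simp: cofactor_mdet mult_ac intro!: sum.cong)

text \<open>Subtracting multiples of the first row clears the first column below a pivot equal to 1.\<close>

lemma mdet_pivot:
  fixes f :: "nat \<Rightarrow> nat \<Rightarrow> 'a::comm_ring_1"
  assumes "f 0 0 = 1"
  shows "mdet (Suc n) f = mdet n (\<lambda>i j. f (Suc i) (Suc j) - f (Suc i) 0 * f 0 (Suc j))"
proof -
  let ?L = "\<lambda>i j. if i = j then 1 else if j = 0 then - f i 0 else (0::'a)"
  let ?h = "\<lambda>i j. if i = 0 then f i j else f i j - f i 0 * f 0 j"
  have "(\<Sum>k<Suc n. ?L i k * f k j) = ?h i j" if "i < Suc n" for i j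
  proof -
    have "(\<Sum>k<Suc n. ?L i k * f k j) =
        (\<Sum>k<Suc n. (if i = k then f k j else 0) + (if k = 0 then if i = 0 then 0 else - f i 0 * f 0 j else 0))"
      by (rule sum.cong) auto
    also have "\<dots> = ?h i j"
      using that by (subst sum.distrib) simp
    finally show ?thesis .
  qed
  then have "mdet (Suc n) ?h = mdet (Suc n) ?L * mdet (Suc n) f"
    by (subst mdet_mult[symmetric]) (auto intro!: mdet_cong)
  also have "mdet (Suc n) ?L = 1"
    by (subst mdet_lower_triangular) auto
  finally have "mdet (Suc n) f = mdet (Suc n) (\<lambda>i j. ?h j i)"
    by (simp add: mdet_transpose[of "Suc n" ?h])
  also have "\<dots> = (\<Sum>j<Suc n. if j = 0 then mdet n (\<lambda>i' j'. ?h (Suc j') (Suc i')) else 0)"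
    unfolding mdet_laplace_row_0[of n "\<lambda>i j. ?h j i"]
    using assms by (intro sum.cong) (auto intro!: mdet_cong)
  also have "\<dots> = mdet n (\<lambda>i' j'. f (Suc i') (Suc j') - f (Suc i') 0 * f 0 (Suc j'))"
    using mdet_transpose[of n "\<lambda>i' j'. f (Suc i') (Suc j') - f (Suc i') 0 * f 0 (Suc j')"]
    by (subst sum.lessThan_Suc_shift) simp
  finally show ?thesis .
qed

text \<open>The matrix is \<open>f (1 + b c\<^sup>T)\<close>, and \<open>det (1 + b c\<^sup>T) = 1 + c\<^sup>T b\<close>: both are values of the same bordered
  determinant, eliminated from its upper left or from its lower right corner.\<close>

lemma mdet_rank_one_update:
  fixes f :: "nat \<Rightarrow> nat \<Rightarrow> 'a::comm_ring_1"
  shows "mdet n (\<lambda>i j. f i j + (\<Sum>k<n. f i k * b k) * c j) = (1 + (\<Sum>k<n. b k * c k)) * mdet n f"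
proof -
  let ?N = "\<lambda>i j. if i = 0 then if j = 0 then 1 else - c (j - 1)
    else if j = 0 then b (i - 1) else if i = j then 1 else 0"
  let ?U = "\<lambda>i j. if i = j then 1 else if i = 0 then c (j - 1) else (0::'a)"
  let ?S = "\<lambda>i j. (if i = j then 1 else 0) + b i * c j"
  have "(\<Sum>k<n. f i k * ?S k j) = f i j + (\<Sum>k<n. f i k * b k) * c j" if "j < n" for i j
  proof -
    have "(\<Sum>k<n. f i k * ?S k j) = (\<Sum>k<n. (if j = k then f i j else 0) + f i k * b k * c j)"
      by (intro sum.cong) (auto simp: algebra_simps)
    then show ?thesis
      using that by (simp add: sum.distrib sum_distrib_right)
  qed
  then have "mdet n (\<lambda>i j. f i j + (\<Sum>k<n. f i k * b k) * c j) = mdet n f * mdet n ?S"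
    by (subst mdet_mult[symmetric]) (auto intro!: mdet_cong)
  also have "mdet n ?S = mdet (Suc n) ?N"
    by (subst mdet_pivot) (auto intro!: mdet_cong)
  also have "\<dots> = mdet (Suc n) ?U * mdet (Suc n) ?N"
    by (subst mdet_upper_triangular[of _ ?U]) auto
  also have "\<dots> = mdet (Suc n) (\<lambda>i j. \<Sum>k<Suc n. ?U i k * ?N k j)"
    by (rule mdet_mult[symmetric])
  also have "\<dots> = mdet (Suc n) (\<lambda>i j. if i = 0 then if j = 0 then 1 + (\<Sum>k<n. b k * c k) else 0 else ?N i j)"
  proof (rule mdet_cong)
    fix i j assume ij: "i < Suc n" "j < Suc n"
    show "(\<Sum>k<Suc n. ?U i k * ?N k j) = (if i = 0 then if j = 0 then 1 + (\<Sum>k<n. b k * c k) else 0 else ?N i j)"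
    proof (cases "i = 0")
      case True
      have *: "(\<Sum>k<n. c k * (if Suc k = j then 1 else 0)) = c (j - 1)" if "j \<noteq> 0"
      proof -
        have "(\<Sum>k<n. c k * (if Suc k = j then 1 else 0)) = (\<Sum>k<n. if j - 1 = k then c k else 0)"
          using that by (intro sum.cong) auto
        then show ?thesis using that ij by simp
      qed
      show ?thesis
        unfolding sum.lessThan_Suc_shift using True * by (auto simp: mult.commute)
    next
      case False
      have "(\<Sum>k<Suc n. ?U i k * ?N k j) = (\<Sum>k<Suc n. if i = k then ?N k j else 0)"
        using False by (intro sum.cong) auto
      then show ?thesis using False ij by simp
    qed
  qed
  also have "\<dots> = (\<Prod>i<Suc n. if i = 0 then 1 + (\<Sum>k<n. b k * c k) else 1)"
    by (subst mdet_lower_triangular, force, rule prod.cong) auto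
  also have "\<dots> = 1 + (\<Sum>k<n. b k * c k)"
    by (simp add: prod.delta)
  finally show ?thesis by (simp add: mult.commute)
qed

text \<open>Cramer's rule in the form that remains valid if the matrix is singular: the inverse is replaced by
  the adjugate.\<close>

lemma mdet_cramer:
  fixes f :: "nat \<Rightarrow> nat \<Rightarrow> 'a::comm_ring_1"
  assumes "i\<^sub>0 < Suc n" "j\<^sub>0 < Suc n"
    and "\<And>i. i < Suc n \<Longrightarrow> (\<Sum>j<Suc n. f i j * u j) = (if i = i\<^sub>0 then h else 0)"
  shows "u j\<^sub>0 * mdet (Suc n) f = h * ((- 1) ^ (i\<^sub>0 + j\<^sub>0) *
     mdet n (\<lambda>i j. f (if i < i\<^sub>0 then i else Suc i) (if j < j\<^sub>0 then j else Suc j)))"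
proof -
  let ?M = "mat (Suc n) (Suc n) (\<lambda>(i, j). f i j)"
  have M: "?M \<in> carrier_mat (Suc n) (Suc n)" by simp
  have adj: "(\<Sum>i<Suc n. cofactor ?M i j\<^sub>0 * f i j) = (if j\<^sub>0 = j then mdet (Suc n) f else 0)"
    if "j < Suc n" for j
  proof -
    have "(adj_mat ?M * ?M) $$ (j\<^sub>0, j) = (det ?M \<cdot>\<^sub>m 1\<^sub>m (Suc n)) $$ (j\<^sub>0, j)"
      using adj_mat(3)[OF M] by simp
    moreover have "(adj_mat ?M * ?M) $$ (j\<^sub>0, j) = (\<Sum>i<Suc n. cofactor ?M i j\<^sub>0 * f i j)"
      using that assms(2) unfolding adj_mat_def
      by (simp add: scalar_prod_def atLeast0LessThan)
    ultimately show ?thesis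
      using that assms(2) by (simp add: mdet_def)
  qed
  have "u j\<^sub>0 * mdet (Suc n) f = (\<Sum>j<Suc n. (if j\<^sub>0 = j then mdet (Suc n) f else 0) * u j)"
  proof -
    have "(\<Sum>j<Suc n. (if j\<^sub>0 = j then mdet (Suc n) f else 0) * u j) =
        (\<Sum>j<Suc n. if j\<^sub>0 = j then mdet (Suc n) f * u j else 0)"
      by (intro sum.cong) auto
    then show ?thesis using assms(2) by (simp add: mult.commute)
  qed
  also have "\<dots> = (\<Sum>j<Suc n. (\<Sum>i<Suc n. cofactor ?M i j\<^sub>0 * f i j) * u j)"
    by (intro sum.cong refl) (simp add: adj del: sum.lessThan_Suc)
  also have "\<dots> = (\<Sum>i<Suc n. cofactor ?M i j\<^sub>0 * (\<Sum>j<Suc n. f i j * u j))"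
    unfolding sum_distrib_left sum_distrib_right mult.assoc by (rule sum.swap)
  also have "\<dots> = (\<Sum>i<Suc n. if i\<^sub>0 = i then cofactor ?M i j\<^sub>0 * h else 0)"
    using assms(3) by (intro sum.cong) auto
  also have "\<dots> = cofactor ?M i\<^sub>0 j\<^sub>0 * h"
    using assms(1) by simp
  finally show ?thesis
    unfolding cofactor_mdet by (simp add: mult.commute)
qed

lemma tendsto_mdet:
  fixes f :: "'b \<Rightarrow> nat \<Rightarrow> nat \<Rightarrow> 'a::real_normed_field"
  assumes "\<And>i j. i < n \<Longrightarrow> j < n \<Longrightarrow> ((\<lambda>x. f x i j) \<longlongrightarrow> g i j) F"
  shows "((\<lambda>x. mdet n (f x)) \<longlongrightarrow> mdet n g) F"
  unfolding mdet_leibniz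
  by (intro tendsto_intros assms) (auto dest: permutes_in_image)

section \<open>The Picard lattice and its reflections\<close>

lemma intersection_form_commute: "intersection_form r a b = intersection_form r b a"
  by (simp add: intersection_form_def mult.commute)

lemma intersection_form_add:
  "intersection_form r (\<lambda>i. a i + b i) c = intersection_form r a c + intersection_form r b c"
  "intersection_form r c (\<lambda>i. a i + b i) = intersection_form r c a + intersection_form r c b"
  by (simp_all add: intersection_form_def algebra_simps sum.distrib)

lemma intersection_form_diff:
  "intersection_form r (\<lambda>i. a i - b i) c = intersection_form r a c - intersection_form r b c"
  "intersection_form r c (\<lambda>i. a i - b i) = intersection_form r c a - intersection_form r c b"
  by (simp_all add: intersection_form_def algebra_simps sum_subtractf)

lemma intersection_form_scale:
  "intersection_form r (\<lambda>i. k * a i) c = k * intersection_form r a c"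
  "intersection_form r c (\<lambda>i. k * a i) = k * intersection_form r c a"
  by (simp_all add: intersection_form_def algebra_simps sum_distrib_left)

lemma intersection_form_uminus:
  "intersection_form r (\<lambda>i. - a i) c = - intersection_form r a c"
  "intersection_form r c (\<lambda>i. - a i) = - intersection_form r c a"
  by (simp_all add: intersection_form_def sum_negf)

lemmas intersection_form_linear =
  intersection_form_add intersection_form_diff intersection_form_scale intersection_form_uminus

lemma sum_1_7: "(\<Sum>i=1..7. f i) = f 1 + f 2 + f 3 + f 4 + f 5 + f 6 + (f 7 :: int)" for f :: "nat \<Rightarrow> int"
  by (simp add: numeral_eq_Suc)

lemma intersection_form_explicit:
  assumes "v \<in> pic_lattice r" "r \<le> 7"
  shows "intersection_form r v w = v 0 * w 0 -
    (v 1 * w 1 + v 2 * w 2 + v 3 * w 3 + v 4 * w 4 + v 5 * w 5 + v 6 * w 6 + v 7 * w 7)"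
proof -
  have "(\<Sum>i=1..r. v i * w i) = (\<Sum>i=1..7. v i * w i)"
    using assms by (intro sum.mono_neutral_left) (auto simp: pic_lattice_def)
  then show ?thesis
    by (simp add: intersection_form_def sum_1_7 del: One_nat_def)
qed

lemma canonical_intersection_explicit:
  assumes "v \<in> pic_lattice r" "r \<le> 7"
  shows "intersection_form r (canonical_class r) v =
    - 3 * v 0 - (v 1 + v 2 + v 3 + v 4 + v 5 + v 6 + v 7)"
proof -
  have "intersection_form r (canonical_class r) v = - 3 * v 0 - (\<Sum>i=1..r. v i)"
    by (simp add: intersection_form_def canonical_class_def)
  also have "(\<Sum>i=1..r. v i) = (\<Sum>i=1..7. v i)"
    using assms by (intro sum.mono_neutral_left) (auto simp: pic_lattice_def)
  finally show ?thesis by (simp add: sum_1_7 del: One_nat_def)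
qed

lemma pic_eqI:
  assumes "v \<in> pic_lattice r" "w \<in> pic_lattice r" "r \<le> 7"
    and "v 0 = w 0" "v 1 = w 1" "v 2 = w 2" "v 3 = w 3" "v 4 = w 4" "v 5 = w 5" "v 6 = w 6" "v 7 = w 7"
  shows "v = w"
proof
  fix i :: nat
  have "i \<in> {0, 1, 2, 3, 4, 5, 6, 7} \<or> i > 7" by auto
  then show "v i = w i" using assms by (auto simp: pic_lattice_def)
qed

text \<open>The plus sign is due to \<open>\<alpha>\<^sup>2 = - 2\<close>.\<close>

definition reflection :: "nat \<Rightarrow> pic \<Rightarrow> pic \<Rightarrow> pic" where
  "reflection r \<alpha> v = (\<lambda>i. v i + intersection_form r v \<alpha> * \<alpha> i)"

definition root :: "nat \<Rightarrow> pic \<Rightarrow> bool" where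
  "root r \<alpha> \<longleftrightarrow> \<alpha> \<in> pic_lattice r \<and> intersection_form r \<alpha> \<alpha> = - 2 \<and>
     intersection_form r (canonical_class r) \<alpha> = 0"

lemma reflection_linear:
  "reflection r \<alpha> (\<lambda>i. v i + w i) = (\<lambda>i. reflection r \<alpha> v i + reflection r \<alpha> w i)"
  "reflection r \<alpha> (\<lambda>i. v i - w i) = (\<lambda>i. reflection r \<alpha> v i - reflection r \<alpha> w i)"
  "reflection r \<alpha> (\<lambda>i. k * v i) = (\<lambda>i. k * reflection r \<alpha> v i)"
  by (auto simp: reflection_def intersection_form_linear algebra_simps)

lemma reflection_sum:
  "reflection r \<alpha> (\<lambda>i. \<Sum>j\<in>S. v j i) = (\<lambda>i. \<Sum>j\<in>S. reflection r \<alpha> (v j) i)"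
proof (induction S rule: infinite_finite_induct)
  case (insert x S)
  then show ?case by (simp add: reflection_linear)
qed (auto simp: reflection_def intersection_form_def)

lemma reflection_isometry:
  assumes "root r \<alpha>"
  shows "intersection_form r (reflection r \<alpha> v) (reflection r \<alpha> w) = intersection_form r v w"
proof -
  have "intersection_form r \<alpha> w = intersection_form r w \<alpha>"
    by (rule intersection_form_commute)
  moreover have "intersection_form r \<alpha> \<alpha> = - 2"
    using assms by (simp add: root_def)
  ultimately show ?thesis
    by (simp add: reflection_def intersection_form_linear)
qed

lemma intersection_reflection_root:
  assumes "root r \<alpha>"
  shows "intersection_form r (reflection r \<alpha> v) \<alpha> = - intersection_form r v \<alpha>"
  using assms unfolding reflection_def root_def by (simp add: intersection_form_linear)

lemma reflection_involution:
  assumes "root r \<alpha>"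
  shows "reflection r \<alpha> (reflection r \<alpha> v) = v"
  using intersection_reflection_root[OF assms, of v]
  by (auto simp: reflection_def[of r \<alpha> "reflection r \<alpha> v"] fun_eq_iff) (simp add: reflection_def)

lemma reflection_canonical_class:
  "root r \<alpha> \<Longrightarrow> reflection r \<alpha> (canonical_class r) = canonical_class r"
  by (auto simp: reflection_def root_def)

lemma reflection_pic_lattice:
  "root r \<alpha> \<Longrightarrow> v \<in> pic_lattice r \<Longrightarrow> reflection r \<alpha> v \<in> pic_lattice r"
  by (auto simp: reflection_def root_def pic_lattice_def)

lemma reflection_lines:
  assumes "root r \<alpha>" "l \<in> lines r"
  shows "reflection r \<alpha> l \<in> lines r"
  using assms reflection_isometry[OF assms(1), of l l]
    reflection_isometry[OF assms(1), of "canonical_class r" l]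
  by (auto simp: lines_def reflection_pic_lattice reflection_canonical_class)

lemma reflection_conics:
  assumes "root r \<alpha>" "c \<in> conics r"
  shows "reflection r \<alpha> c \<in> conics r"
  using assms reflection_isometry[OF assms(1), of c c]
    reflection_isometry[OF assms(1), of "canonical_class r" c]
  by (auto simp: conics_def reflection_pic_lattice reflection_canonical_class)

lemma bij_reflection_conics: "root r \<alpha> \<Longrightarrow> bij_betw (reflection r \<alpha>) (conics r) (conics r)"
  by (rule bij_betw_byWitness[of _ "reflection r \<alpha>"])
    (auto simp: reflection_involution reflection_conics)

lemma partner_reflection:
  "partner (reflection r \<alpha> c) (reflection r \<alpha> l) = reflection r \<alpha> (partner c l)"
  by (simp add: partner_def reflection_linear)

lemma partner_partner [simp]: "partner c (partner c l) = l"
  by (simp add: partner_def)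

lemma simple_root_explicit:
  assumes "0 < i"
  shows "simple_root i j = (if j = i then 1 else if j = Suc i then - 1 else 0)"
  using assms by (simp add: simple_root_def exceptional_class_def)

lemma simple_root_0_explicit:
  "simple_root 0 j = (if j = 0 then 1 else if j \<le> 3 then - 1 else 0)"
  by (simp add: simple_root_def)

lemma intersection_simple_root:
  assumes "0 < i" "i < r"
  shows "intersection_form r v (simple_root i) = v (Suc i) - v i"
proof -
  have "(\<Sum>j=1..r. v j * simple_root i j) =
      (\<Sum>j=1..r. (if i = j then v j else 0) - (if Suc i = j then v j else 0))"
    using assms by (intro sum.cong) (auto simp: simple_root_explicit)
  also have "\<dots> = v i - v (Suc i)"
    using assms by (simp add: sum_subtractf)
  finally show ?thesis
    using assms by (simp add: intersection_form_def simple_root_explicit)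
qed

lemma intersection_simple_root_0:
  assumes "3 \<le> r"
  shows "intersection_form r v (simple_root 0) = v 0 + v 1 + v 2 + v 3"
proof -
  have "(\<Sum>j=1..r. v j * simple_root 0 j) = (\<Sum>j\<in>{1..3}. - v j)"
    using assms by (intro sum.mono_neutral_cong_right) (auto simp: simple_root_0_explicit)
  then show ?thesis
    by (simp add: intersection_form_def simple_root_0_explicit numeral_eq_Suc)
qed

lemma root_simple_root:
  assumes "3 \<le> r" "i < r"
  shows "root r (simple_root i)"
proof (cases "i = 0")
  case True
  then show ?thesis
    using assms by (simp add: root_def intersection_simple_root_0 simple_root_0_explicit
        canonical_class_def pic_lattice_def)
next
  case False
  then show ?thesis
    using assms by (simp add: root_def intersection_simple_root simple_root_explicit
        canonical_class_def pic_lattice_def)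
qed

section \<open>Conic classes and their Weyl group orbit\<close>

text \<open>The class \<open>H - E\<^sub>1\<close> of the lines through the first blown-up point.  It serves as the base point of the
  Weyl group orbit of the conic classes.\<close>

definition ruling :: pic where
  "ruling = (\<lambda>i. if i = 0 then 1 else if i = 1 then - 1 else 0)"

lemma conic_equations:
  assumes "c \<in> conics r" "r \<le> 7"
  shows "c \<in> pic_lattice r"
    and "(c 0)\<^sup>2 = (c 1)\<^sup>2 + (c 2)\<^sup>2 + (c 3)\<^sup>2 + (c 4)\<^sup>2 + (c 5)\<^sup>2 + (c 6)\<^sup>2 + (c 7)\<^sup>2"
    and "3 * c 0 + (c 1 + c 2 + c 3 + c 4 + c 5 + c 6 + c 7) = 2"
  using assms by (auto simp: conics_def intersection_form_explicit canonical_intersection_explicit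
      power2_eq_square)

text \<open>This is Cauchy's inequality for the two equations, in the quantitative form
  \<open>\<Sum>\<^sub>i (7 c\<^sub>i + 3 c\<^sub>0)\<^sup>2 = 14 c\<^sub>0 (6 - c\<^sub>0)\<close>.  The extreme values 0 and 6 make all squares vanish, which is
  excluded by divisibility.\<close>

lemma conic_degree_bounds:
  assumes "c \<in> conics r" "r \<le> 7"
  shows "1 \<le> c 0" "c 0 \<le> 5"
proof -
  note eq = conic_equations[OF assms]
  define a where "a = c 0"
  define S where "S = (7 * c 1 + 3 * a)\<^sup>2 + (7 * c 2 + 3 * a)\<^sup>2 + (7 * c 3 + 3 * a)\<^sup>2
    + (7 * c 4 + 3 * a)\<^sup>2 + (7 * c 5 + 3 * a)\<^sup>2 + (7 * c 6 + 3 * a)\<^sup>2 + (7 * c 7 + 3 * a)\<^sup>2"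
  have "S = 49 * ((c 1)\<^sup>2 + (c 2)\<^sup>2 + (c 3)\<^sup>2 + (c 4)\<^sup>2 + (c 5)\<^sup>2 + (c 6)\<^sup>2 + (c 7)\<^sup>2)
      + 42 * a * (c 1 + c 2 + c 3 + c 4 + c 5 + c 6 + c 7) + 63 * a\<^sup>2"
    by (simp add: S_def power2_eq_square algebra_simps)
  also have "\<dots> = 49 * a\<^sup>2 + 42 * a * (2 - 3 * a) + 63 * a\<^sup>2"
  proof -
    have "c 1 + c 2 + c 3 + c 4 + c 5 + c 6 + c 7 = 2 - 3 * a" using eq(3) by (simp add: a_def)
    moreover have "(c 1)\<^sup>2 + (c 2)\<^sup>2 + (c 3)\<^sup>2 + (c 4)\<^sup>2 + (c 5)\<^sup>2 + (c 6)\<^sup>2 + (c 7)\<^sup>2 = a\<^sup>2"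
      using eq(2) by (simp add: a_def)
    ultimately show ?thesis by (simp only:)
  qed
  finally have S: "S = 14 * (a * (6 - a))"
    by (simp add: power2_eq_square algebra_simps)
  have "S \<ge> 0" by (simp add: S_def)
  then have "a * (6 - a) \<ge> 0" using S by simp
  then have a: "0 \<le> a" "a \<le> 6"
    by (auto simp: zero_le_mult_iff)
  have "a \<noteq> 0"
  proof
    assume "a = 0"
    then have "c 1 = 0 \<and> c 2 = 0 \<and> c 3 = 0 \<and> c 4 = 0 \<and> c 5 = 0 \<and> c 6 = 0 \<and> c 7 = 0"
      using eq(2) unfolding a_def
      by (smt (verit) zero_le_power2 power2_eq_square mult_eq_0_iff zero_less_power2)
    then have "3 * c 0 = 2" using eq(3) by simp
    then show False by presburger
  qed
  moreover have "a \<noteq> 6"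
  proof
    assume "a = 6"
    then have "S = 0" using S by simp
    then have "(7 * c 1 + 3 * a)\<^sup>2 = 0"
      unfolding S_def by (smt (verit) zero_le_power2)
    then have "7 * c 1 + 18 = 0" using \<open>a = 6\<close> by simp
    then show False by presburger
  qed
  ultimately show "1 \<le> c 0" "c 0 \<le> 5"
    using a by (auto simp: a_def)
qed

lemma conic_coefficient_bound:
  assumes "c \<in> conics r" "r \<le> 7"
  shows "\<bar>c i\<bar> \<le> 5"
proof -
  note eq = conic_equations[OF assms] and b = conic_degree_bounds[OF assms]
  have "i \<in> {0, 1, 2, 3, 4, 5, 6, 7} \<or> i > 7" by auto
  then have "(c i)\<^sup>2 \<le> (c 0)\<^sup>2"
    using eq(1) assms(2) by (auto simp: pic_lattice_def) (auto simp: eq(2))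
  then have "\<bar>c i\<bar> \<le> \<bar>c 0\<bar>"
    by (simp add: abs_le_square_iff)
  then show ?thesis using b by simp
qed

lemma finite_bounded_classes: "finite {v \<in> pic_lattice r. \<forall>i. \<bar>v i\<bar> \<le> k}"
proof (rule finite_subset)
  show "{v \<in> pic_lattice r. \<forall>i. \<bar>v i\<bar> \<le> k} \<subseteq>
      {v. \<forall>i. (i \<in> {0..r} \<longrightarrow> v i \<in> {- k..k}) \<and> (i \<notin> {0..r} \<longrightarrow> v i = 0)}"
    by (auto simp: pic_lattice_def abs_le_iff) (smt (verit))+
  show "finite {v. \<forall>i. (i \<in> {0..r} \<longrightarrow> v i \<in> {- k..k}) \<and> (i \<notin> {0..r} \<longrightarrow> v i = 0)}"
    by (rule finite_set_of_finite_funs) auto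
qed

lemma finite_conics: "r \<le> 7 \<Longrightarrow> finite (conics r)"
  by (rule finite_subset[OF _ finite_bounded_classes[of r 5]])
    (auto simp: conics_def conic_coefficient_bound)

lemma ruling_conic: "1 \<le> r \<Longrightarrow> r \<le> 7 \<Longrightarrow> ruling \<in> conics r"
  by (auto simp: conics_def intersection_form_explicit canonical_intersection_explicit
      ruling_def pic_lattice_def)

text \<open>The orbit of conic classes has one point in the fundamental chamber: there the coefficients
  of the \<open>E\<^sub>i\<close> increase with \<open>i\<close>, so the condition for \<open>H - E\<^sub>1 - E\<^sub>2 - E\<^sub>3\<close> and the value of the degree leave
  only \<open>c\<^sub>0 \<le> 3\<close>, and the cases \<open>c\<^sub>0 = 2, 3\<close> are impossible.\<close>

lemma extremal_conic:
  assumes "c \<in> conics r" "4 \<le> r" "r \<le> 7"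
    and nef: "\<And>i. i < r \<Longrightarrow> intersection_form r c (simple_root i) \<ge> 0"
  shows "c = ruling"
proof -
  note eq = conic_equations[OF assms(1,3)] and b = conic_degree_bounds[OF assms(1,3)]
  have mono: "c i \<le> c j" if "1 \<le> i" "i \<le> j" "j \<le> r" for i j
    using that(2,1,3)
  proof (induction j rule: dec_induct)
    case (step j)
    then show ?case using nef[of j] by (auto simp: intersection_simple_root)
  qed simp
  have c0: "c 0 + c 1 + c 2 + c 3 \<ge> 0"
    using nef[of 0] assms(2) by (simp add: intersection_simple_root_0)
  have le: "c 1 \<le> c 2" "c 2 \<le> c 3" using mono assms(2) by auto
  have tail: "c 3 \<le> c i \<or> c i = 0" if "4 \<le> i" for i
    using mono[of 3 i] that eq(1) assms(2) by (cases "i \<le> r") (auto simp: pic_lattice_def)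
  have c3: "c 3 \<le> 0"
  proof (rule ccontr)
    assume "\<not> c 3 \<le> 0"
    moreover have "c 4 \<ge> c 3" using mono[of 3 4] assms(2) by simp
    ultimately have "c 4 \<ge> 1" "c 5 \<ge> 0" "c 6 \<ge> 0" "c 7 \<ge> 0"
      using tail[of 4] tail[of 5] tail[of 6] tail[of 7] by linarith+
    then show False using eq(3) c0 b by linarith
  qed
  have t: "c 3 \<le> c 4" "c 3 \<le> c 5" "c 3 \<le> c 6" "c 3 \<le> c 7"
    using c3 tail[of 4] tail[of 5] tail[of 6] tail[of 7] by linarith+
  have "c 0 \<le> 3" using eq(3) c0 b le t by linarith
  then consider "c 0 = 1" | "c 0 = 2" | "c 0 = 3" using b by linarith
  then show ?thesis
  proof cases
    case 1
    then have c123: "c 1 = - 1" "c 2 = 0" "c 3 = 0"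
      using eq(3) c0 le t c3 by linarith+
    then have "c 4 = 0" "c 5 = 0" "c 6 = 0" "c 7 = 0"
      using 1 eq(3) t by linarith+
    then show ?thesis
      using c123 1 eq(1) ruling_conic[of r] assms
      by (intro pic_eqI[of c r ruling]) (auto simp: ruling_def pic_lattice_def)
  next
    case 2
    then have "c 3 < 0" using eq(3) c0 le t by linarith
    then show ?thesis using 2 c0 le by linarith
  next
    case 3
    then have "c 1 = - 1" "c 2 = - 1" "c 3 = - 1" "c 4 = - 1" "c 5 = - 1" "c 6 = - 1" "c 7 = - 1"
      using eq(3) c0 le t c3 by linarith+
    then show ?thesis using eq(2) 3 by simp
  qed
qed

text \<open>Reflections in simple roots that are negative on \<open>c\<close> lead into the fundamental chamber.\<close>

lemma conic_induct [consumes 3, case_names ruling reflection]: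
  assumes "c \<in> conics r" "4 \<le> r" "r \<le> 7" "P ruling"
    and step: "\<And>c i. c \<in> conics r \<Longrightarrow> i < r \<Longrightarrow> P c \<Longrightarrow> P (reflection r (simple_root i) c)"
  shows "P c"
  using assms(1)
\<comment> \<open>The linear form is 1 on every simple root, so it decreases by \<open>- c \<cdot> \<alpha>\<^sub>i\<close>; 1000 makes it positive.\<close>
proof (induction "nat (1000 + 19 * c 0 + 7 * c 1 + 6 * c 2 + 5 * c 3 + 4 * c 4 + 3 * c 5 + 2 * c 6 + c 7)"
    arbitrary: c rule: less_induct)
  case less
  show ?case
  proof (cases "\<exists>i<r. intersection_form r c (simple_root i) < 0")
    case True
    then obtain i where i: "i < r" "intersection_form r c (simple_root i) < 0" by blast
    let ?d = "reflection r (simple_root i) c"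
    note root = root_simple_root[OF _ i(1)]
    have root: "root r (simple_root i)" using assms(2) by (intro root) simp
    have d: "?d \<in> conics r"
      by (rule reflection_conics[OF root less.prems])
    define k where "k = intersection_form r c (simple_root i)"
    have dj: "?d j = c j + k * simple_root i j" for j by (simp add: reflection_def k_def)
    have "19 * simple_root i 0 + 7 * simple_root i 1 + 6 * simple_root i 2 + 5 * simple_root i 3
        + 4 * simple_root i 4 + 3 * simple_root i 5 + 2 * simple_root i 6 + simple_root i 7 = 1"
    proof -
      have "i \<in> {0, 1, 2, 3, 4, 5, 6}" using i(1) assms(3) by auto
      then show ?thesis by (auto simp: simple_root_0_explicit simple_root_explicit)
    qed
    then have "k * (19 * simple_root i 0 + 7 * simple_root i 1 + 6 * simple_root i 2 + 5 * simple_root i 3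
        + 4 * simple_root i 4 + 3 * simple_root i 5 + 2 * simple_root i 6 + simple_root i 7) = k" by simp
    moreover have "1000 + 19 * c 0 + 7 * c 1 + 6 * c 2 + 5 * c 3 + 4 * c 4 + 3 * c 5 + 2 * c 6 + c 7 > 0"
      using conic_coefficient_bound[OF less.prems assms(3)]
      by (smt (verit))
    ultimately have "P ?d"
      using d i(2) unfolding k_def[symmetric]
      by (intro less.hyps) (auto simp: dj algebra_simps)
    then have "P (reflection r (simple_root i) ?d)"
      by (rule step[OF d i(1)])
    then show ?thesis by (simp add: reflection_involution[OF root])
  next
    case False
    then have "c = ruling"
      using extremal_conic[OF less.prems assms(2,3)] by (meson not_less)
    then show ?thesis using assms(4) by simp
  qed
qed

section \<open>Frames of a conic class and their orientation\<close>

definition conic_frame :: "nat \<Rightarrow> pic \<Rightarrow> (nat \<Rightarrow> pic) \<Rightarrow> bool" where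
  "conic_frame r c a \<longleftrightarrow>
     bij_betw (\<lambda>j. {a j, partner c (a j)}) {0..<r - 1}
       {{l, partner c l} | l. l \<in> lines r \<and> partner c l \<in> lines r}"

lemma conic_frame_lines:
  assumes "conic_frame r c a" "j < r - 1"
  shows "a j \<in> lines r" "partner c (a j) \<in> lines r"
proof -
  have "{a j, partner c (a j)} \<in> {{l, partner c l} | l. l \<in> lines r \<and> partner c l \<in> lines r}"
    using assms unfolding conic_frame_def bij_betw_def
    by (metis (no_types, lifting) atLeastLessThan_iff image_eqI zero_le)
  then obtain l where l: "{a j, partner c (a j)} = {l, partner c l}" "l \<in> lines r" "partner c l \<in> lines r"
    by auto
  then have "a j \<in> {l, partner c l}" "partner c (a j) \<in> {l, partner c l}" by blast+
  with l show "a j \<in> lines r" "partner c (a j) \<in> lines r" by auto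
qed

lemma conic_frame_inj:
  assumes "conic_frame r c a" "i < r - 1" "j < r - 1" "a i = a j \<or> a i = partner c (a j)"
  shows "i = j"
proof -
  have "{a i, partner c (a i)} = {a j, partner c (a j)}"
    using assms(4) by auto
  then show ?thesis
    using assms(1-3) unfolding conic_frame_def bij_betw_def inj_on_def by auto
qed

lemma conic_frame_cover:
  assumes "conic_frame r c a" "l \<in> lines r" "partner c l \<in> lines r"
  shows "\<exists>j<r - 1. l = a j \<or> l = partner c (a j)"
proof -
  have "{l, partner c l} \<in> (\<lambda>j. {a j, partner c (a j)}) ` {0..<r - 1}"
    using assms unfolding conic_frame_def bij_betw_def by auto
  then obtain j where j: "j < r - 1" "{l, partner c l} = {a j, partner c (a j)}" by auto
  then have "l \<in> {a j, partner c (a j)}" by blast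
  with j show ?thesis by auto
qed

lemma conic_frameI:
  assumes "\<And>j. j < r - 1 \<Longrightarrow> a j \<in> lines r \<and> partner c (a j) \<in> lines r"
    and "\<And>i j. i < r - 1 \<Longrightarrow> j < r - 1 \<Longrightarrow> a i = a j \<or> a i = partner c (a j) \<Longrightarrow> i = j"
    and "\<And>l. l \<in> lines r \<Longrightarrow> partner c l \<in> lines r \<Longrightarrow> \<exists>j<r - 1. l = a j \<or> l = partner c (a j)"
  shows "conic_frame r c a"
  unfolding conic_frame_def bij_betw_def
proof
  show "inj_on (\<lambda>j. {a j, partner c (a j)}) {0..<r - 1}"
  proof (rule inj_onI)
    fix i j assume ij: "i \<in> {0..<r - 1}" "j \<in> {0..<r - 1}"
      and eq: "{a i, partner c (a i)} = {a j, partner c (a j)}"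
    have "a i \<in> {a j, partner c (a j)}" using eq by blast
    then show "i = j" using assms(2)[of i j] ij by simp
  qed
  show "(\<lambda>j. {a j, partner c (a j)}) ` {0..<r - 1} =
      {{l, partner c l} | l. l \<in> lines r \<and> partner c l \<in> lines r}" (is "?A = ?B")
  proof
    show "?A \<subseteq> ?B" using assms(1) by fastforce
    show "?B \<subseteq> ?A"
    proof
      fix S assume "S \<in> ?B"
      then obtain l where l: "S = {l, partner c l}" "l \<in> lines r" "partner c l \<in> lines r" by blast
      from assms(3)[OF l(2,3)] obtain j where "j < r - 1" "l = a j \<or> l = partner c (a j)" by blast
      then show "S \<in> ?A"
        unfolding l(1) by (auto intro!: image_eqI[of _ _ j])
    qed
  qed
qed

lemma conic_frame_reflection:
  assumes "root r \<alpha>" "conic_frame r c a"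
  shows "conic_frame r (reflection r \<alpha> c) (\<lambda>j. reflection r \<alpha> (a j))"
proof (rule conic_frameI)
  fix j assume "j < r - 1"
  then show "reflection r \<alpha> (a j) \<in> lines r \<and> partner (reflection r \<alpha> c) (reflection r \<alpha> (a j)) \<in> lines r"
    using conic_frame_lines[OF assms(2)] assms(1)
    by (simp add: partner_reflection reflection_lines)
next
  fix i j assume "i < r - 1" "j < r - 1" and
    "reflection r \<alpha> (a i) = reflection r \<alpha> (a j) \<or>
     reflection r \<alpha> (a i) = partner (reflection r \<alpha> c) (reflection r \<alpha> (a j))"
  moreover from this(3) have "a i = a j \<or> a i = partner c (a j)"
    unfolding partner_reflection by (metis assms(1) reflection_involution)
  ultimately show "i = j" using conic_frame_inj[OF assms(2)] by blast
next
  fix l assume l: "l \<in> lines r" "partner (reflection r \<alpha> c) l \<in> lines r"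
  let ?l = "reflection r \<alpha> l"
  have "partner c ?l = reflection r \<alpha> (partner (reflection r \<alpha> c) l)"
    by (metis assms(1) partner_reflection reflection_involution)
  then have "\<exists>j<r - 1. ?l = a j \<or> ?l = partner c (a j)"
    using l assms(1) by (intro conic_frame_cover[OF assms(2)]) (simp_all add: reflection_lines)
  then show "\<exists>j<r - 1. l = reflection r \<alpha> (a j) \<or> l = partner (reflection r \<alpha> c) (reflection r \<alpha> (a j))"
    unfolding partner_reflection by (metis assms(1) reflection_involution)
qed

lemma conic_frame_change:
  assumes "conic_frame r c a" "conic_frame r c b"
  shows "\<exists>p. p permutes {0..<r - 1} \<and> (\<forall>j<r - 1. b j = a (p j) \<or> b j = partner c (a (p j)))"
proof -
  let ?I = "{0..<r - 1}"
  have ex: "\<forall>j\<in>?I. \<exists>i. i < r - 1 \<and> (b j = a i \<or> b j = partner c (a i))"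
    using conic_frame_cover[OF assms(1)] conic_frame_lines[OF assms(2)] by simp
  from bchoice[OF ex] obtain q
    where "\<forall>j\<in>?I. q j < r - 1 \<and> (b j = a (q j) \<or> b j = partner c (a (q j)))"
    by blast
  then have q: "q j < r - 1 \<and> (b j = a (q j) \<or> b j = partner c (a (q j)))" if "j < r - 1" for j
    using that by simp
  have inj: "inj_on q ?I"
  proof (rule inj_onI)
    fix i j assume ij: "i \<in> ?I" "j \<in> ?I" "q i = q j"
    then have "b i = b j \<or> b i = partner c (b j)"
      using q[of i] q[of j] by auto
    then show "i = j" using conic_frame_inj[OF assms(2)] ij by simp
  qed
  have "q ` ?I = ?I"
    using inj q by (intro endo_inj_surj) auto
  then have "bij_betw q ?I ?I" using inj by (simp add: bij_betw_def)
  then have "bij_betw (\<lambda>j. if j \<in> ?I then q j else j) ?I ?I"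
    by (subst bij_betw_cong[of _ _ q]) simp_all
  then have "(\<lambda>j. if j \<in> ?I then q j else j) permutes ?I"
    by (rule bij_imp_permutes) (simp only: if_False)
  then show ?thesis
    using q by (intro exI[of _ "\<lambda>j. if j \<in> ?I then q j else j"]) auto
qed

text \<open>Exchanging \<open>a\<^sub>j\<close> with \<open>c - a\<^sub>j\<close> negates the row \<open>2 a\<^sub>j - c\<close>.  The rows \<open>K\<close> and \<open>c\<close>, which do not
  depend on the order of the pairs, complete these rows to a basis of the rational Picard lattice.\<close>

definition frame_matrix :: "nat \<Rightarrow> pic \<Rightarrow> (nat \<Rightarrow> pic) \<Rightarrow> nat \<Rightarrow> nat \<Rightarrow> int" where
  "frame_matrix r c a i j = (if i < r - 1 then 2 * a i j - c j
     else if i = r - 1 then canonical_class r j else c j)"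

definition frame_sum :: "nat \<Rightarrow> (nat \<Rightarrow> pic) \<Rightarrow> pic" where
  "frame_sum r a = (\<lambda>i. canonical_class r i + (\<Sum>j=0..<r - 1. a j i))"

definition even_class :: "pic \<Rightarrow> bool" where
  "even_class v \<longleftrightarrow> (\<forall>i. even (v i))"

text \<open>Exchanging \<open>a\<^sub>j\<close> with \<open>c - a\<^sub>j\<close> negates the determinant, but it also changes the sum of the \<open>a\<^sub>j\<close> by \<open>c\<close>
  modulo 2.  The parity of \<open>K + \<Sum> a\<^sub>j\<close> thus compensates the sign, and what remains changes with the
  ordering of the pairs by the sign of a permutation.\<close>

definition orientation :: "nat \<Rightarrow> pic \<Rightarrow> (nat \<Rightarrow> pic) \<Rightarrow> int" where
  "orientation r c a = sgn (mdet (r + 1) (frame_matrix r c a)) *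
     (if even_class (frame_sum r a) then 1 else - 1)"

text \<open>The conditions under which the orientation is a sign with the expected behaviour: exactly one of
  \<open>K + \<Sum> a\<^sub>j\<close> and \<open>K + \<Sum> a\<^sub>j + c\<close> is even.  They are stable under reflections, so it suffices to know them
  for one conic class.\<close>

definition oriented_frame :: "nat \<Rightarrow> pic \<Rightarrow> (nat \<Rightarrow> pic) \<Rightarrow> bool" where
  "oriented_frame r c a \<longleftrightarrow> conic_frame r c a \<and> mdet (r + 1) (frame_matrix r c a) \<noteq> 0 \<and>
     \<not> even_class c \<and> (even_class (frame_sum r a) \<or> even_class (\<lambda>i. frame_sum r a i + c i))"

lemma even_class_reflection:
  assumes "root r \<alpha>"
  shows "even_class (reflection r \<alpha> v) \<longleftrightarrow> even_class v"
proof -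
  have *: "even_class (reflection r \<alpha> v)" if "even_class v" for v
  proof -
    have "v = (\<lambda>i. 2 * (v i div 2))" using that by (auto simp: even_class_def)
    then have "reflection r \<alpha> v = (\<lambda>i. 2 * reflection r \<alpha> (\<lambda>i. v i div 2) i)"
      by (metis reflection_linear(3))
    then show ?thesis by (simp add: even_class_def)
  qed
  show ?thesis using *[of v] *[of "reflection r \<alpha> v"] by (auto simp: reflection_involution[OF assms])
qed

lemma frame_sum_reflection:
  assumes "root r \<alpha>"
  shows "frame_sum r (\<lambda>j. reflection r \<alpha> (a j)) = reflection r \<alpha> (frame_sum r a)"
  unfolding frame_sum_def reflection_linear reflection_sum reflection_canonical_class[OF assms] ..

text \<open>The reflection acts on the rows by a rank one update of determinant \<open>1 + \<alpha>\<^sup>2 = - 1\<close>.\<close>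

lemma mdet_frame_reflection:
  assumes "root r \<alpha>"
  shows "mdet (r + 1) (frame_matrix r (reflection r \<alpha> c) (\<lambda>j. reflection r \<alpha> (a j))) =
    - mdet (r + 1) (frame_matrix r c a)"
proof -
  let ?b = "\<lambda>k. if k = 0 then \<alpha> 0 else - \<alpha> k"
  have b: "(\<Sum>k<r + 1. v k * ?b k) = intersection_form r v \<alpha>" for v
  proof -
    have "(\<Sum>k<r + 1. v k * ?b k) = v 0 * \<alpha> 0 + (\<Sum>k<r. v (Suc k) * ?b (Suc k))"
      by (simp add: sum.lessThan_Suc_shift del: sum.lessThan_Suc)
    also have "(\<Sum>k<r. v (Suc k) * ?b (Suc k)) = (\<Sum>k\<in>{1..r}. v k * ?b k)"
      by (rule sum.reindex_bij_witness[of _ "\<lambda>k. k - 1" Suc]) auto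
    also have "\<dots> = (\<Sum>k\<in>{1..r}. - (v k * \<alpha> k))"
      by (rule sum.cong) auto
    finally show ?thesis by (simp add: intersection_form_def sum_negf)
  qed
  have rows: "frame_matrix r (reflection r \<alpha> c) (\<lambda>j. reflection r \<alpha> (a j)) i = reflection r \<alpha> (frame_matrix r c a i)" for i
  proof -
    have "frame_matrix r c a i = (if i < r - 1 then \<lambda>j. 2 * a i j - c j
        else if i = r - 1 then canonical_class r else c)" for c a
      by (auto simp: frame_matrix_def)
    then show ?thesis
      by (simp add: reflection_linear reflection_canonical_class[OF assms])
  qed
  have "mdet (r + 1) (frame_matrix r (reflection r \<alpha> c) (\<lambda>j. reflection r \<alpha> (a j))) =
      mdet (r + 1) (\<lambda>i j. frame_matrix r c a i j + (\<Sum>k<r + 1. frame_matrix r c a i k * ?b k) * \<alpha> j)"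
    unfolding rows b by (intro mdet_cong) (simp add: reflection_def)
  also have "\<dots> = (1 + (\<Sum>k<r + 1. ?b k * \<alpha> k)) * mdet (r + 1) (frame_matrix r c a)"
    by (rule mdet_rank_one_update)
  also have "(\<Sum>k<r + 1. ?b k * \<alpha> k) = - 2"
    using b[of \<alpha>] assms by (simp add: root_def mult.commute)
  finally show ?thesis by simp
qed

lemma orientation_reflection:
  assumes "root r \<alpha>"
  shows "orientation r (reflection r \<alpha> c) (\<lambda>j. reflection r \<alpha> (a j)) = - orientation r c a"
  unfolding orientation_def mdet_frame_reflection[OF assms] frame_sum_reflection[OF assms]
    even_class_reflection[OF assms] by (simp add: sgn_minus)

lemma oriented_frame_reflection:
  assumes "root r \<alpha>" "oriented_frame r c a"
  shows "oriented_frame r (reflection r \<alpha> c) (\<lambda>j. reflection r \<alpha> (a j))"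
proof -
  have "even_class (\<lambda>i. reflection r \<alpha> (frame_sum r a) i + reflection r \<alpha> c i) \<longleftrightarrow>
      even_class (\<lambda>i. frame_sum r a i + c i)"
    using even_class_reflection[OF assms(1), of "\<lambda>i. frame_sum r a i + c i"]
    by (simp add: reflection_linear)
  then show ?thesis
    using assms(2) mdet_frame_reflection[OF assms(1), of c a]
    unfolding oriented_frame_def frame_sum_reflection[OF assms(1)] even_class_reflection[OF assms(1)]
    by (simp add: conic_frame_reflection[OF assms(1)])
qed

lemma orientation_unit: "oriented_frame r c a \<Longrightarrow> orientation r c a = 1 \<or> orientation r c a = - 1"
  by (auto simp: oriented_frame_def orientation_def sgn_if)

text \<open>The signs of the exchanges cancel between the determinant and the parity.\<close>

lemma orientation_change:
  assumes a: "oriented_frame r c a" and r: "1 \<le> r" and p: "p permutes {0..<r - 1}"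
    and b: "\<And>j. j < r - 1 \<Longrightarrow> b j = a (p j) \<or> b j = partner c (a (p j))"
  shows "orientation r c b = sign p * orientation r c a"
proof -
  \<comment> \<open>Exchanging the members of the pairs in \<open>swapped\<close> turns \<open>a \<circ> p\<close> into \<open>b\<close>.\<close>
  define swapped where "swapped = {j. j < r - 1 \<and> b j \<noteq> a (p j)}"
  define e where "e j = (if j \<in> swapped then - 1 else 1 :: int)" for j
  have fin: "finite swapped" unfolding swapped_def by simp
  have prod_e: "(\<Prod>j=0..<r - 1. e j) = (- 1) ^ card swapped"
  proof -
    have "(\<Prod>j=0..<r - 1. e j) = (\<Prod>j\<in>swapped. - 1)"
      by (rule prod.mono_neutral_cong_right) (auto simp: e_def swapped_def)
    then show ?thesis by simp
  qed
  have d: "2 * b j i - c i = e j * (2 * a (p j) i - c i)" if "j < r - 1" for i j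
    using b[OF that] that by (auto simp: e_def swapped_def partner_def)
  have "mdet (r + 1) (frame_matrix r c b) =
      mdet (r + 1) (\<lambda>i j. (if i < r - 1 then e i else 1) * frame_matrix r c a (p i) j)"
  proof (rule mdet_cong)
    fix i j assume "i < r + 1" "j < r + 1"
    show "frame_matrix r c b i j = (if i < r - 1 then e i else 1) * frame_matrix r c a (p i) j"
    proof (cases "i < r - 1")
      case True
      moreover have "p i < r - 1" using permutes_in_image[OF p, of i] True by simp
      ultimately show ?thesis by (simp add: frame_matrix_def d)
    next
      case False
      moreover have "p i = i" using permutes_not_in[OF p, of i] False by simp
      ultimately show ?thesis by (simp add: frame_matrix_def)
    qed
  qed
  also have "\<dots> = (\<Prod>i=0..<r + 1. if i < r - 1 then e i else 1) * (sign p * mdet (r + 1) (frame_matrix r c a))"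
  proof -
    have "p permutes {0..<r + 1}" by (rule permutes_subset[OF p]) auto
    from mdet_permute_scale_rows[OF this, of "\<lambda>i. if i < r - 1 then e i else 1" "frame_matrix r c a"]
    show ?thesis by simp
  qed
  also have "(\<Prod>i=0..<r + 1. if i < r - 1 then e i else 1) = (\<Prod>j=0..<r - 1. e j)"
    by (rule prod.mono_neutral_cong_right) auto
  finally have det: "mdet (r + 1) (frame_matrix r c b) =
      (- 1) ^ card swapped * (sign p * mdet (r + 1) (frame_matrix r c a))"
    unfolding prod_e .
  have sum: "frame_sum r b i = frame_sum r a i + int (card swapped) * c i - 2 * (\<Sum>j\<in>swapped. a (p j) i)" for i
  proof -
    have "(\<Sum>j=0..<r - 1. b j i) = (\<Sum>j=0..<r - 1. a (p j) i + (if j \<in> swapped then c i - 2 * a (p j) i else 0))"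
    proof (rule sum.cong)
      fix j assume "j \<in> {0..<r - 1}"
      then show "b j i = a (p j) i + (if j \<in> swapped then c i - 2 * a (p j) i else 0)"
        using b[of j] by (auto simp: swapped_def partner_def)
    qed simp
    also have "\<dots> = (\<Sum>j=0..<r - 1. a (p j) i) + (\<Sum>j\<in>swapped. c i - 2 * a (p j) i)"
    proof -
      have "(\<Sum>j=0..<r - 1. if j \<in> swapped then c i - 2 * a (p j) i else 0) = (\<Sum>j\<in>swapped. c i - 2 * a (p j) i)"
        by (rule sum.mono_neutral_cong_right) (auto simp: swapped_def)
      then show ?thesis by (simp add: sum.distrib)
    qed
    also have "(\<Sum>j=0..<r - 1. a (p j) i) = (\<Sum>j=0..<r - 1. a j i)"
      using sum.permute[OF p, of "\<lambda>j. a j i"] by (simp add: o_def)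
    finally show ?thesis
      by (simp add: frame_sum_def sum_subtractf sum_distrib_left)
  qed
  have not_both: "\<not> (even_class (frame_sum r a) \<and> even_class (\<lambda>i. frame_sum r a i + c i))"
    using a by (auto simp: oriented_frame_def even_class_def)
  have "even_class (frame_sum r b) \<longleftrightarrow> (if even (card swapped) then even_class (frame_sum r a)
      else even_class (\<lambda>i. frame_sum r a i + c i))"
    by (auto simp: even_class_def sum)
  then have "(if even_class (frame_sum r b) then 1 else - 1 :: int) =
      (- 1) ^ card swapped * (if even_class (frame_sum r a) then 1 else - 1)"
    using a not_both by (auto simp: oriented_frame_def)
  then show ?thesis
    unfolding orientation_def det
    by (cases "even (card swapped)") (auto simp: sgn_mult sign_def sgn_minus)
qed

lemma mdet_nonzeroI:
  fixes f :: "nat \<Rightarrow> nat \<Rightarrow> 'a::idom"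
  assumes "\<And>v. (\<And>i. i < n \<Longrightarrow> (\<Sum>j<n. f i j * v j) = 0) \<Longrightarrow> \<forall>j<n. v j = 0"
  shows "mdet n f \<noteq> 0"
proof
  let ?A = "mat n n (\<lambda>(i, j). f i j)"
  assume "mdet n f = 0"
  then obtain v where v: "v \<in> carrier_vec n" "v \<noteq> 0\<^sub>v n" "?A *\<^sub>v v = 0\<^sub>v n"
    unfolding mdet_def using det_0_iff_vec_prod_zero[of ?A n] by auto
  have "(\<Sum>j<n. f i j * vec_index v j) = 0" if "i < n" for i
  proof -
    have "vec_index (?A *\<^sub>v v) i = (\<Sum>j<n. f i j * vec_index v j)"
      using that v(1) by (simp add: scalar_prod_def atLeast0LessThan)
    then show ?thesis using that v(3) by simp
  qed
  then have "\<forall>j<n. vec_index v j = 0" by (rule assms)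
  then have "v = 0\<^sub>v n" using v(1) by (intro eq_vecI) auto
  then show False using v(2) by simp
qed

lemma sum_power2_eq_1:
  fixes f :: "'a \<Rightarrow> int"
  assumes "finite A" "(\<Sum>i\<in>A. (f i)\<^sup>2) = 1"
  obtains k where "k \<in> A" "f k = 1 \<or> f k = - 1" "\<And>i. i \<in> A \<Longrightarrow> i \<noteq> k \<Longrightarrow> f i = 0"
proof -
  have "\<exists>k\<in>A. f k \<noteq> 0"
  proof (rule ccontr)
    assume "\<not> (\<exists>k\<in>A. f k \<noteq> 0)"
    then have "(\<Sum>i\<in>A. (f i)\<^sup>2) = 0" by (intro sum.neutral) auto
    then show False using assms(2) by simp
  qed
  then obtain k where k: "k \<in> A" "f k \<noteq> 0" by blast
  have "(f k)\<^sup>2 + (\<Sum>i\<in>A - {k}. (f i)\<^sup>2) = 1"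
    using assms sum.remove[OF assms(1) k(1), of "\<lambda>i. (f i)\<^sup>2"] by simp
  moreover have "(\<Sum>i\<in>A - {k}. (f i)\<^sup>2) \<ge> 0" by (rule sum_nonneg) simp
  moreover have "(f k)\<^sup>2 \<ge> 1" using k(2) by (simp add: int_one_le_iff_zero_less)
  ultimately have "(f k)\<^sup>2 = 1" and 0: "(\<Sum>i\<in>A - {k}. (f i)\<^sup>2) = 0" by linarith+
  moreover have "\<forall>i\<in>A - {k}. (f i)\<^sup>2 = 0"
    using 0 assms(1) by (subst (asm) sum_nonneg_eq_0_iff) auto
  ultimately show ?thesis
    using k by (intro that[of k]) (auto simp: power2_eq_1_iff)
qed

lemma intersection_exceptional_class:
  assumes "1 \<le> k" "k \<le> r"
  shows "intersection_form r v (exceptional_class k) = - v k"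
proof -
  have "(\<Sum>i=1..r. v i * exceptional_class k i) = (\<Sum>i=1..r. if k = i then v i else 0)"
    by (intro sum.cong) (auto simp: exceptional_class_def)
  then show ?thesis
    using assms by (simp add: intersection_form_def exceptional_class_def)
qed

lemma intersection_ruling:
  assumes "1 \<le> r"
  shows "intersection_form r v ruling = v 0 + v 1"
proof -
  have "(\<Sum>i=1..r. v i * ruling i) = (\<Sum>i=1..r. if 1 = i then - v i else 0)"
    by (intro sum.cong) (auto simp: ruling_def)
  then show ?thesis
    using assms by (simp add: intersection_form_def ruling_def)
qed

lemma ruling_values: "ruling 0 = 1" "ruling 1 = - 1" "i \<ge> 2 \<Longrightarrow> ruling i = 0"
  by (auto simp: ruling_def)

lemma exceptional_class_line:
  assumes "1 \<le> k" "k \<le> r"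
  shows "exceptional_class k \<in> lines r"
proof -
  have "exceptional_class k \<in> pic_lattice r" using assms by (auto simp: pic_lattice_def exceptional_class_def)
  moreover have "exceptional_class k k = 1" "canonical_class r k = 1"
    using assms by (auto simp: exceptional_class_def canonical_class_def)
  ultimately show ?thesis
    using assms by (simp add: lines_def intersection_exceptional_class)
qed

lemma partner_ruling_line:
  assumes "2 \<le> k" "k \<le> r"
  shows "partner ruling (exceptional_class k) \<in> lines r"
proof -
  let ?E = "exceptional_class k"
  have E: "?E \<in> lines r" using assms exceptional_class_line[of k r] by simp
  have 0: "intersection_form r ?E ruling = 0"
    using assms by (simp add: intersection_ruling exceptional_class_def)
  have "intersection_form r (partner ruling ?E) (partner ruling ?E) = - 1"
    using 0 E assms
    by (simp add: partner_def intersection_form_diff intersection_form_commute[of r ruling ?E] lines_def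
        intersection_ruling ruling_values del: One_nat_def)
  moreover have "intersection_form r (canonical_class r) (partner ruling ?E) = - 1"
    using E assms by (simp add: partner_def intersection_form_diff lines_def intersection_ruling canonical_class_def)
  moreover have "partner ruling ?E \<in> pic_lattice r"
    using assms by (auto simp: pic_lattice_def partner_def ruling_def exceptional_class_def)
  ultimately show ?thesis by (simp add: lines_def)
qed

text \<open>The lines in the fibres of \<open>H - E\<^sub>1\<close> have \<open>l\<^sub>1 = - l\<^sub>0\<close>, so \<open>l\<^sup>2 = - 1\<close> leaves a sum of squares equal
  to 1.\<close>

lemma ruling_lines:
  assumes "1 \<le> r" "l \<in> lines r" "partner ruling l \<in> lines r"
  shows "\<exists>k\<in>{2..r}. l = exceptional_class k \<or> l = partner ruling (exceptional_class k)"
proof -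
  have l: "intersection_form r l l = - 1" "intersection_form r (canonical_class r) l = - 1" "\<And>i. i > r \<Longrightarrow> l i = 0"
    using assms(2) by (auto simp: lines_def pic_lattice_def)
  have "intersection_form r (partner ruling l) (partner ruling l) = - 1"
    using assms(3) by (simp add: lines_def)
  then have "intersection_form r l ruling = 0"
    using l(1) assms(1) by (simp add: partner_def intersection_form_diff intersection_form_commute[of r ruling l]
        intersection_ruling ruling_values del: One_nat_def)
  then have l1: "l 1 = - l 0" using assms(1) by (simp add: intersection_ruling)
  have split: "(\<Sum>i=1..r. f i) = f 1 + (\<Sum>i=2..r. f i)" for f :: "nat \<Rightarrow> int"
    using assms(1) by (simp add: sum.atLeast_Suc_atMost numeral_2_eq_2)
  have "(\<Sum>i=2..r. (l i)\<^sup>2) = 1"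
    using l(1) l1 unfolding intersection_form_def split by (simp add: power2_eq_square)
  then obtain k where k: "k \<in> {2..r}" "l k = 1 \<or> l k = - 1" "\<And>i. i \<in> {2..r} \<Longrightarrow> i \<noteq> k \<Longrightarrow> l i = 0"
    by (rule sum_power2_eq_1[rotated]) auto
  have "(\<Sum>i=2..r. l i) = l k"
    using k(1,3) sum.remove[of "{2..r}" k l] by (simp add: sum.neutral)
  then have a: "2 * l 0 + l k = 1"
  proof -
    have "(\<Sum>i=2..r. canonical_class r i * l i) = (\<Sum>i=2..r. l i)"
      by (intro sum.cong) (auto simp: canonical_class_def)
    then show ?thesis
      using l(2) l1 assms(1) \<open>(\<Sum>i=2..r. l i) = l k\<close>
      unfolding intersection_form_def split by (simp add: canonical_class_def)
  qed
  have li: "l i = 0" if "i \<ge> 2" "i \<noteq> k" for i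
    using k l(3) that by (cases "i \<le> r") auto
  have "l = exceptional_class k \<or> l = partner ruling (exceptional_class k)"
  proof (cases "l k = 1")
    case True
    have "l i = exceptional_class k i" for i
    proof -
      consider "i = 0" | "i = 1" | "i \<ge> 2" by linarith
      then show ?thesis using True a l1 li[of i] k(1) by cases (auto simp: exceptional_class_def)
    qed
    then have "l = exceptional_class k" by (rule ext)
    then show ?thesis by blast
  next
    case False
    then have "l k = - 1" using k(2) by simp
    have "l i = partner ruling (exceptional_class k) i" for i
    proof -
      consider "i = 0" | "i = 1" | "i \<ge> 2" by linarith
      then show ?thesis using \<open>l k = - 1\<close> a l1 li[of i] k(1)
        by cases (auto simp: exceptional_class_def partner_def ruling_def)
    qed
    then have "l = partner ruling (exceptional_class k)" by (rule ext)
    then show ?thesis by blast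
  qed
  then show ?thesis using k(1) by blast
qed

definition ruling_frame :: "nat \<Rightarrow> pic" where
  "ruling_frame j = exceptional_class (j + 2)"

lemma conic_frame_ruling: "1 \<le> r \<Longrightarrow> conic_frame r ruling ruling_frame"
proof (rule conic_frameI)
  fix j assume "j < r - 1"
  then show "ruling_frame j \<in> lines r \<and> partner ruling (ruling_frame j) \<in> lines r"
    by (auto simp: ruling_frame_def intro!: exceptional_class_line partner_ruling_line)
next
  fix i j assume "ruling_frame i = ruling_frame j \<or> ruling_frame i = partner ruling (ruling_frame j)"
  then have "ruling_frame i = ruling_frame j"
  proof
    assume "ruling_frame i = partner ruling (ruling_frame j)"
    then have "ruling_frame i 0 = partner ruling (ruling_frame j) 0" by simp
    then show ?thesis by (simp add: ruling_frame_def partner_def exceptional_class_def ruling_def)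
  qed
  then have "ruling_frame i (j + 2) = ruling_frame j (j + 2)" by simp
  then show "i = j" by (simp add: ruling_frame_def exceptional_class_def split: if_splits)
next
  fix l assume "1 \<le> r" "l \<in> lines r" "partner ruling l \<in> lines r"
  from ruling_lines[OF this] obtain k where "k \<in> {2..r}"
    "l = exceptional_class k \<or> l = partner ruling (exceptional_class k)" by blast
  then show "\<exists>j<r - 1. l = ruling_frame j \<or> l = partner ruling (ruling_frame j)"
  proof (intro exI[of _ "k - 2"] conjI)
    have "2 \<le> k" using \<open>k \<in> {2..r}\<close> by simp
    then have "k - 2 + 2 = k" by (rule le_add_diff_inverse2)
    then have "ruling_frame (k - 2) = exceptional_class k"
      unfolding ruling_frame_def by (simp only:)
    then show "l = ruling_frame (k - 2) \<or> l = partner ruling (ruling_frame (k - 2))"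
      using \<open>l = exceptional_class k \<or> l = partner ruling (exceptional_class k)\<close> by (simp only:)
    show "k - 2 < r - 1" using \<open>k \<in> {2..r}\<close> by auto
  qed
qed

text \<open>The kernel of the matrix is zero because the vectors \<open>2 E\<^sub>i\<close>, modulo \<open>H - E\<^sub>1\<close>, kill all coordinates but two
  and the rows \<open>K\<close> and \<open>H - E\<^sub>1\<close> kill these; and \<open>K + \<Sum>\<^sub>i E\<^sub>i + (H - E\<^sub>1)\<close>, with \<open>i \<ge> 2\<close>, is even.\<close>

lemma oriented_frame_ruling:
  assumes "3 \<le> r"
  shows "oriented_frame r ruling ruling_frame"
proof -
  have "mdet (r + 1) (frame_matrix r ruling ruling_frame) \<noteq> 0"
  proof (rule mdet_nonzeroI)
    fix v assume v: "\<And>i. i < r + 1 \<Longrightarrow> (\<Sum>j<r + 1. frame_matrix r ruling ruling_frame i j * v j) = 0"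
    have ruling_v: "(\<Sum>j<r + 1. ruling j * v j) = v 0 - v 1"
    proof -
      have "(\<Sum>j<r + 1. ruling j * v j) = (\<Sum>j<r + 1. (if 0 = j then v j else 0) - (if 1 = j then v j else 0))"
        by (intro sum.cong) (auto simp: ruling_def)
      then show ?thesis using assms by (simp add: sum_subtractf)
    qed
    have "v 0 - v 1 = 0"
    proof -
      have "(\<Sum>j<r + 1. frame_matrix r ruling ruling_frame r j * v j) = (\<Sum>j<r + 1. ruling j * v j)"
        using assms by (intro sum.cong) (auto simp: frame_matrix_def)
      then show ?thesis using v[of r] ruling_v by simp
    qed
    moreover have e: "v (k + 2) = 0" if "k < r - 1" for k
    proof -
      have "(\<Sum>j<r + 1. frame_matrix r ruling ruling_frame k j * v j) =
          (\<Sum>j<r + 1. (if k + 2 = j then 2 * v j else 0) - ruling j * v j)"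
        using that by (intro sum.cong)
          (auto simp: frame_matrix_def ruling_frame_def exceptional_class_def algebra_simps)
      also have "\<dots> = 2 * v (k + 2) - (v 0 - v 1)"
      proof -
        have "k + 2 < r + 1" using that by linarith
        then show ?thesis unfolding ruling_v[symmetric] sum_subtractf by (simp add: sum.delta')
      qed
      finally show ?thesis using v[of k] that \<open>v 0 - v 1 = 0\<close> by simp
    qed
    moreover have e2: "v j = 0" if "2 \<le> j" "j < r + 1" for j
    proof -
      have "j - 2 + 2 = j" "j - 2 < r - 1" using that by auto
      then show ?thesis using e[of "j - 2"] by (simp only:)
    qed
    moreover have "- 3 * v 0 + v 1 = 0"
    proof -
      have "(\<Sum>j<r + 1. canonical_class r j * v j) =
          (\<Sum>j<r + 1. (if 0 = j then - 3 * v j else 0) + (if 1 = j then v j else 0))"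
      proof (rule sum.cong)
        fix j assume "j \<in> {..<r + 1}"
        then show "canonical_class r j * v j = (if 0 = j then - 3 * v j else 0) + (if 1 = j then v j else 0)"
          using e2[of j] by (auto simp: canonical_class_def)
      qed simp
      moreover have "(\<Sum>j<r + 1. frame_matrix r ruling ruling_frame (r - 1) j * v j) = (\<Sum>j<r + 1. canonical_class r j * v j)"
        using assms by (intro sum.cong) (auto simp: frame_matrix_def)
      ultimately show ?thesis
        using v[of "r - 1"] assms by (simp add: sum.distrib)
    qed
    ultimately have v01: "v 0 = 0" "v 1 = 0" by linarith+
    show "\<forall>j<r + 1. v j = 0"
    proof (intro allI impI)
      fix j assume "j < r + 1"
      then show "v j = 0"
        using v01 e2[of j] by (cases "j = 0 \<or> j = 1") auto
    qed
  qed
  moreover have "frame_sum r ruling_frame i = (if i = 0 then - 3 else if i = 1 then 1 else if i \<le> r then 2 else 0)" for i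
  proof -
    have "(\<Sum>j=0..<r - 1. ruling_frame j i) = (\<Sum>j\<in>{0..<r - 1} \<inter> {j. j + 2 = i}. 1)"
      by (intro sum.mono_neutral_cong_right) (auto simp: ruling_frame_def exceptional_class_def)
    also have "\<dots> = (if 2 \<le> i \<and> i \<le> r then 1 else 0)"
    proof (cases "2 \<le> i \<and> i \<le> r")
      case True
      then have "{0..<r - 1} \<inter> {j. j + 2 = i} = {i - 2}" by auto
      then show ?thesis using True by simp
    next
      case False
      then have "{0..<r - 1} \<inter> {j. j + 2 = i} = {}" by auto
      then show ?thesis using False by simp
    qed
    finally show ?thesis using assms by (simp add: frame_sum_def canonical_class_def)
  qed
  then have "even_class (\<lambda>i. frame_sum r ruling_frame i + ruling i)"
    by (auto simp: even_class_def ruling_def)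
  moreover have "\<not> even_class ruling"
    by (auto simp: even_class_def ruling_def intro: exI[of _ 0])
  ultimately show ?thesis
    using assms by (simp add: oriented_frame_def conic_frame_ruling)
qed

lemma oriented_frame_exists:
  assumes "4 \<le> r" "r \<le> 7" "c \<in> conics r"
  shows "\<exists>a. oriented_frame r c a"
proof (rule conic_induct[OF assms(3,1,2), where P = "\<lambda>c. \<exists>a. oriented_frame r c a"])
  have "oriented_frame r ruling ruling_frame"
    by (rule oriented_frame_ruling) (use assms(1) in linarith)
  then show "\<exists>a. oriented_frame r ruling a" by blast
next
  fix c i assume "c \<in> conics r" "i < r" "\<exists>a. oriented_frame r c a"
  then obtain a where "oriented_frame r c a" by blast
  moreover have "root r (simple_root i)"
    by (rule root_simple_root) (use \<open>i < r\<close> assms(1) in linarith)+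
  ultimately show "\<exists>a. oriented_frame r (reflection r (simple_root i) c) a"
    using oriented_frame_reflection by blast
qed

section \<open>The combinatorial identity\<close>

text \<open>For \<open>G 0 = ln \<bar>x\<bar>\<close> and the logarithmic derivatives \<open>G k\<close> of \<open>x\<close> this is the value of \<open>U\<^sub>F\<^sup>*(\<Omega>\<^sub>r)\<close>.\<close>

definition pairdet :: "nat \<Rightarrow> pic \<Rightarrow> (nat \<Rightarrow> pic) \<Rightarrow> (nat \<Rightarrow> pic \<Rightarrow> complex) \<Rightarrow> complex" where
  "pairdet r c a G = mdet (r - 1) (\<lambda>k j. if k = 0 then 1
     else G (k - 1) (a j) + G (k - 1) (partner c (a j)))"

definition oriented_det :: "nat \<Rightarrow> pic \<Rightarrow> (nat \<Rightarrow> pic) \<Rightarrow> (nat \<Rightarrow> pic \<Rightarrow> complex) \<Rightarrow> complex" where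
  "oriented_det r c a G = of_int (orientation r c a) * pairdet r c a G"

lemma pairdet_change:
  assumes p: "p permutes {0..<r - 1}"
    and b: "\<And>j. j < r - 1 \<Longrightarrow> b j = a (p j) \<or> b j = partner c (a (p j))"
  shows "pairdet r c b G = of_int (sign p) * pairdet r c a G"
proof -
  have "pairdet r c b G = mdet (r - 1) (\<lambda>k j. if k = 0 then 1
     else G (k - 1) (a (p j)) + G (k - 1) (partner c (a (p j))))"
    unfolding pairdet_def
  proof (rule mdet_cong)
    fix k j assume "j < r - 1"
    then show "(if k = 0 then 1 else G (k - 1) (b j) + G (k - 1) (partner c (b j))) =
        (if k = 0 then 1 else G (k - 1) (a (p j)) + G (k - 1) (partner c (a (p j))))"
      using b[of j] by (auto simp: add.commute)
  qed
  then show ?thesis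
    unfolding pairdet_def using mdet_permute_columns[OF p, of
        "\<lambda>k j. if k = 0 then 1 else G (k - 1) (a j) + G (k - 1) (partner c (a j))"] by simp
qed

lemma pairdet_cong:
  assumes "conic_frame r c a"
    and "\<And>k l. k < r - 2 \<Longrightarrow> l \<in> lines r \<Longrightarrow> partner c l \<in> lines r \<Longrightarrow> G k l = H k l"
  shows "pairdet r c a G = pairdet r c a H"
  unfolding pairdet_def
  by (rule mdet_cong) (use assms(2) conic_frame_lines[OF assms(1)] in auto)

lemma oriented_det_frame_independent:
  assumes "4 \<le> r" "r \<le> 7" "c \<in> conics r" "conic_frame r c a" "conic_frame r c b"
  shows "oriented_det r c a G = oriented_det r c b G"
proof -
  obtain g where g: "oriented_frame r c g" using oriented_frame_exists[OF assms(1-3)] by blast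
  then have cg: "conic_frame r c g" by (simp add: oriented_frame_def)
  have "oriented_det r c a G = oriented_det r c g G" if a: "conic_frame r c a" for a
  proof -
    obtain p where p: "p permutes {0..<r - 1}" "\<And>j. j < r - 1 \<Longrightarrow> a j = g (p j) \<or> a j = partner c (g (p j))"
      using conic_frame_change[OF cg a] by blast
    have "orientation r c a = sign p * orientation r c g"
      by (rule orientation_change[OF g _ p]) (use assms(1) in auto)
    moreover have "pairdet r c a G = of_int (sign p) * pairdet r c g G"
      by (rule pairdet_change) (use p in auto)
    ultimately show ?thesis
      unfolding oriented_det_def by (simp add: sign_def)
  qed
  from this[OF assms(4)] this[OF assms(5)] show ?thesis by simp
qed

lemma orientation_frame_unit:
  assumes "4 \<le> r" "r \<le> 7" "c \<in> conics r" "conic_frame r c a"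
  shows "orientation r c a = 1 \<or> orientation r c a = - 1"
proof -
  obtain g where g: "oriented_frame r c g" using oriented_frame_exists[OF assms(1-3)] by blast
  then have cg: "conic_frame r c g" by (simp add: oriented_frame_def)
  obtain p where p: "p permutes {0..<r - 1}" "\<And>j. j < r - 1 \<Longrightarrow> a j = g (p j) \<or> a j = partner c (g (p j))"
    using conic_frame_change[OF cg assms(4)] by blast
  have "orientation r c a = sign p * orientation r c g"
    by (rule orientation_change[OF g _ p]) (use assms(1) in auto)
  then show ?thesis using orientation_unit[OF g] by (auto simp: sign_def)
qed

lemma oriented_det_reflection:
  assumes "root r \<alpha>"
  shows "oriented_det r (reflection r \<alpha> c) (\<lambda>j. reflection r \<alpha> (a j)) G =
    - oriented_det r c a (\<lambda>k l. G k (reflection r \<alpha> l))"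
proof -
  have "pairdet r (reflection r \<alpha> c) (\<lambda>j. reflection r \<alpha> (a j)) G =
      pairdet r c a (\<lambda>k l. G k (reflection r \<alpha> l))"
    unfolding pairdet_def by (rule mdet_cong) (simp only: partner_reflection)
  then show ?thesis
    by (simp add: oriented_det_def orientation_reflection[OF assms])
qed

definition indicators :: "(nat \<Rightarrow> pic) \<Rightarrow> nat \<Rightarrow> pic \<Rightarrow> complex" where
  "indicators m k l = (if l = m k then 1 else 0)"

lemma indicators_reflection:
  "root r \<alpha> \<Longrightarrow> (\<lambda>k l. indicators m k (reflection r \<alpha> l)) = indicators (\<lambda>k. reflection r \<alpha> (m k))"
proof (intro ext)
  fix k l
  assume root: "root r \<alpha>"
  have "reflection r \<alpha> l = m k \<longleftrightarrow> l = reflection r \<alpha> (m k)"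
    by (metis root reflection_involution)
  then show "indicators m k (reflection r \<alpha> l) = indicators (\<lambda>k. reflection r \<alpha> (m k)) k l"
    by (simp add: indicators_def)
qed

lemma line_equations:
  assumes "l \<in> lines r" "r \<le> 7"
  shows "l \<in> pic_lattice r"
    and "(l 0)\<^sup>2 + 1 = (l 1)\<^sup>2 + (l 2)\<^sup>2 + (l 3)\<^sup>2 + (l 4)\<^sup>2 + (l 5)\<^sup>2 + (l 6)\<^sup>2 + (l 7)\<^sup>2"
    and "3 * l 0 + (l 1 + l 2 + l 3 + l 4 + l 5 + l 6 + l 7) = 1"
  using assms by (auto simp: lines_def intersection_form_explicit canonical_intersection_explicit
      power2_eq_square)

text \<open>As for conic classes, from \<open>\<Sum>\<^sub>i (7 l\<^sub>i + 3 l\<^sub>0 - 1)\<^sup>2 = 14 (3 - l\<^sub>0 (l\<^sub>0 - 3))\<close>.\<close>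

lemma line_degree_bounds:
  assumes "l \<in> lines r" "r \<le> 7"
  shows "0 \<le> l 0" "l 0 \<le> 3"
proof -
  note eq = line_equations[OF assms]
  define a where "a = l 0"
  define S where "S = (7 * l 1 + 3 * a - 1)\<^sup>2 + (7 * l 2 + 3 * a - 1)\<^sup>2 + (7 * l 3 + 3 * a - 1)\<^sup>2
    + (7 * l 4 + 3 * a - 1)\<^sup>2 + (7 * l 5 + 3 * a - 1)\<^sup>2 + (7 * l 6 + 3 * a - 1)\<^sup>2 + (7 * l 7 + 3 * a - 1)\<^sup>2"
  have "S = 49 * ((l 1)\<^sup>2 + (l 2)\<^sup>2 + (l 3)\<^sup>2 + (l 4)\<^sup>2 + (l 5)\<^sup>2 + (l 6)\<^sup>2 + (l 7)\<^sup>2)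
      + 14 * (3 * a - 1) * (l 1 + l 2 + l 3 + l 4 + l 5 + l 6 + l 7) + 7 * (3 * a - 1)\<^sup>2"
    by (simp add: S_def power2_eq_square algebra_simps)
  also have "\<dots> = 49 * (a\<^sup>2 + 1) + 14 * (3 * a - 1) * (1 - 3 * a) + 7 * (3 * a - 1)\<^sup>2"
  proof -
    have "l 1 + l 2 + l 3 + l 4 + l 5 + l 6 + l 7 = 1 - 3 * a" using eq(3) by (simp add: a_def)
    moreover have "(l 1)\<^sup>2 + (l 2)\<^sup>2 + (l 3)\<^sup>2 + (l 4)\<^sup>2 + (l 5)\<^sup>2 + (l 6)\<^sup>2 + (l 7)\<^sup>2 = a\<^sup>2 + 1"
      using eq(2) by (simp add: a_def)
    ultimately show ?thesis by (simp only:)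
  qed
  finally have S: "S = 14 * (3 - a * (a - 3))"
    by (simp add: power2_eq_square algebra_simps)
  have "S \<ge> 0" by (simp add: S_def)
  then have le: "a * (a - 3) \<le> 3" using S by simp
  have "0 \<le> a"
  proof (rule ccontr)
    assume "\<not> 0 \<le> a"
    then have "(- a) * (3 - a) \<ge> 1 * 4" by (intro mult_mono) auto
    then show False using le by (simp add: algebra_simps)
  qed
  moreover have "a \<le> 3"
  proof (rule ccontr)
    assume "\<not> a \<le> 3"
    then have "a * (a - 3) \<ge> 4 * 1" by (intro mult_mono) auto
    then show False using le by simp
  qed
  ultimately show "0 \<le> l 0" "l 0 \<le> 3" by (auto simp: a_def)
qed

lemma line_coefficient_bound:
  assumes "l \<in> lines r" "r \<le> 7"
  shows "\<bar>l i\<bar> \<le> 3"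
proof -
  note eq = line_equations[OF assms] and b = line_degree_bounds[OF assms]
  have "(l 0)\<^sup>2 \<le> 3\<^sup>2" using b by (intro power_mono) auto
  have "i \<in> {0, 1, 2, 3, 4, 5, 6, 7} \<or> i > 7" by auto
  then have "(l i)\<^sup>2 \<le> (l 0)\<^sup>2 + 1"
    using eq(1) assms(2) by (auto simp: pic_lattice_def) (auto simp: eq(2))
  then have "(l i)\<^sup>2 < 4\<^sup>2" using \<open>(l 0)\<^sup>2 \<le> 3\<^sup>2\<close> by simp
  then have "\<not> \<bar>4\<bar> \<le> \<bar>l i\<bar>" unfolding abs_le_square_iff by simp
  then show ?thesis by simp
qed

lemma finite_lines: "r \<le> 7 \<Longrightarrow> finite (lines r)"
  by (rule finite_subset[OF _ finite_bounded_classes[of r 3]])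
    (auto simp: lines_def line_coefficient_bound)

text \<open>One pair \<open>{E\<^sub>q, H - E\<^sub>1 - E\<^sub>q}\<close> of \<open>H - E\<^sub>1\<close> is left out, and from each other pair one line is chosen: \<open>E\<^sub>k\<close> for
  \<open>k \<notin> J\<close> and \<open>H - E\<^sub>1 - E\<^sub>k\<close> for \<open>k \<in> J\<close>.  Being orthogonal to these lines forces the shape
  \<open>h H - (h - 1) E\<^sub>1 - b E\<^sub>q - \<Sum>\<^sub>J E\<^sub>k\<close>, and the conditions on roots are met by \<open>b = 1\<close> or \<open>b = 0\<close> according as the
  number of elements of \<open>J\<close> is even or odd.\<close>

lemma orthogonal_root_exists:
  assumes r: "3 \<le> r" and q: "q \<in> {2..r}" and J: "J \<subseteq> {2..r} - {q}"
  shows "\<exists>\<alpha>. root r \<alpha> \<and> (\<forall>k\<in>{2..r} - {q} - J. reflection r \<alpha> (exceptional_class k) = exceptional_class k) \<and>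
    (\<forall>k\<in>J. reflection r \<alpha> (partner ruling (exceptional_class k)) = partner ruling (exceptional_class k))"
proof -
  have finJ: "finite J" using J finite_subset by blast
  define n where "n = int (card J)"
  define h where "h = n div 2"
  define \<alpha> :: pic where "\<alpha> i = (if i = 0 then h else if i = 1 then 1 - h
    else if i = q then - (if even n then 1 else 0) else if i \<in> J then - 1 else 0)" for i
  have n: "n = 2 * h + (if even n then 0 else 1)"
    unfolding h_def by presburger
  have notin: "q \<notin> J" "0 \<notin> J" "1 \<notin> J" using J by auto
  have sum: "(\<Sum>i=1..r. f i) = f 1 + f q + (\<Sum>i\<in>J. f i)" if "\<And>i. i \<notin> J \<union> {0, 1, q} \<Longrightarrow> f i = 0" for f :: "nat \<Rightarrow> int"
  proof -
    have "(\<Sum>i=1..r. f i) = (\<Sum>i\<in>insert 1 (insert q J). f i)"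
      using that J q by (intro sum.mono_neutral_right) auto
    then show ?thesis using notin finJ q by simp
  qed
  have "\<alpha> \<in> pic_lattice r"
    using J q r by (auto simp: pic_lattice_def \<alpha>_def)
  moreover have "intersection_form r \<alpha> \<alpha> = - 2"
  proof -
    have "(\<Sum>i\<in>J. \<alpha> i * \<alpha> i) = n"
      using notin by (subst sum.cong[of _ _ _ "\<lambda>_. 1"]) (auto simp: \<alpha>_def n_def)
    moreover have "(\<Sum>i=1..r. \<alpha> i * \<alpha> i) = \<alpha> 1 * \<alpha> 1 + \<alpha> q * \<alpha> q + (\<Sum>i\<in>J. \<alpha> i * \<alpha> i)"
      by (rule sum) (auto simp: \<alpha>_def)
    ultimately have "intersection_form r \<alpha> \<alpha> = h * h - ((1 - h) * (1 - h) + (if even n then 1 else 0) + n)"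
      using q by (simp add: intersection_form_def \<alpha>_def)
    also have "\<dots> = 2 * h - 1 - (if even n then 1 else 0) - n" by (simp add: algebra_simps)
    also have "\<dots> = - 2" using n by (simp split: if_splits)
    finally show ?thesis .
  qed
  moreover have "intersection_form r (canonical_class r) \<alpha> = 0"
  proof -
    have "(\<Sum>i\<in>J. canonical_class r i * \<alpha> i) = - n"
    proof (subst sum.cong[of _ _ _ "\<lambda>_. - 1"])
      show "canonical_class r i * \<alpha> i = - 1" if "i \<in> J" for i
        using that J notin by (auto simp: \<alpha>_def canonical_class_def)
    qed (auto simp: n_def)
    moreover have "(\<Sum>i=1..r. canonical_class r i * \<alpha> i) = canonical_class r 1 * \<alpha> 1 + canonical_class r q * \<alpha> q
        + (\<Sum>i\<in>J. canonical_class r i * \<alpha> i)"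
      by (rule sum) (auto simp: \<alpha>_def)
    ultimately have "intersection_form r (canonical_class r) \<alpha> = - 3 * h - (1 - h - (if even n then 1 else 0) - n)"
      using q r by (simp add: intersection_form_def \<alpha>_def canonical_class_def)
    then show ?thesis using n by (simp split: if_splits)
  qed
  ultimately have root: "root r \<alpha>" by (simp add: root_def)
  have E: "intersection_form r (exceptional_class k) \<alpha> = - \<alpha> k" if "k \<in> {2..r}" for k
    using that intersection_exceptional_class[of k r \<alpha>] by (simp add: intersection_form_commute)
  have "reflection r \<alpha> (exceptional_class k) = exceptional_class k" if "k \<in> {2..r} - {q} - J" for k
    using that E[of k] by (simp add: reflection_def \<alpha>_def)
  moreover have "reflection r \<alpha> (partner ruling (exceptional_class k)) = partner ruling (exceptional_class k)"
    if "k \<in> J" for k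
  proof -
    have "intersection_form r ruling \<alpha> = 1"
      using intersection_ruling[of r \<alpha>] r by (simp add: intersection_form_commute[of r ruling] \<alpha>_def)
    moreover have "\<alpha> k = - 1" "k \<in> {2..r}" using that J notin by (auto simp: \<alpha>_def)
    ultimately have "intersection_form r (partner ruling (exceptional_class k)) \<alpha> = 0"
      using E[of k] by (simp add: partner_def intersection_form_diff)
    then show ?thesis by (simp add: reflection_def)
  qed
  ultimately show ?thesis using root by blast
qed

locale framed_conics =
  fixes r :: nat and A :: "pic \<Rightarrow> nat \<Rightarrow> pic"
  assumes r: "4 \<le> r" "r \<le> 7"
    and frame: "\<And>c. c \<in> conics r \<Longrightarrow> conic_frame r c (A c)"
begin

definition hlog_sum :: "(nat \<Rightarrow> pic \<Rightarrow> complex) \<Rightarrow> complex" where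
  "hlog_sum G = (\<Sum>c\<in>conics r. oriented_det r c (A c) G)"

lemma simple_root: "i < r \<Longrightarrow> root r (simple_root i)"
  using r root_simple_root[of r i] by simp

lemma oriented_det_reflection_frame:
  assumes "root r \<alpha>" "c \<in> conics r"
  shows "oriented_det r (reflection r \<alpha> c) (A (reflection r \<alpha> c)) G =
    - oriented_det r c (A c) (\<lambda>k l. G k (reflection r \<alpha> l))"
  unfolding oriented_det_reflection[OF assms(1), symmetric]
  using assms r frame by (intro oriented_det_frame_independent conic_frame_reflection)
    (auto simp: reflection_conics)

lemma hlog_sum_reflection:
  assumes "root r \<alpha>"
  shows "hlog_sum (\<lambda>k l. G k (reflection r \<alpha> l)) = - hlog_sum G"
proof -
  have "hlog_sum G = (\<Sum>c\<in>conics r. oriented_det r (reflection r \<alpha> c) (A (reflection r \<alpha> c)) G)"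
    unfolding hlog_sum_def
    by (rule sum.reindex_bij_betw[OF bij_reflection_conics[OF assms], symmetric])
  then show ?thesis
    by (simp add: hlog_sum_def oriented_det_reflection_frame[OF assms] sum_negf)
qed

lemma hlog_sum_cong:
  assumes "\<And>k l. k < r - 2 \<Longrightarrow> l \<in> lines r \<Longrightarrow> G k l = H k l"
  shows "hlog_sum G = hlog_sum H"
  unfolding hlog_sum_def oriented_det_def
  using assms by (intro sum.cong refl arg_cong2[where f = "(*)"] pairdet_cong frame) auto

text \<open>A non-zero determinant has no zero row and no equal rows, so the lines \<open>m\<^sub>k\<close> lie in different pairs of
  \<open>H - E\<^sub>1\<close>.  They miss one of the \<open>r - 1\<close> pairs, and the reflection in an orthogonal root fixes the whole
  family but negates the sum.\<close>

lemma hlog_sum_indicators_ruling: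
  assumes "oriented_det r ruling (A ruling) (indicators m) \<noteq> 0"
  shows "hlog_sum (indicators m) = 0"
proof -
  have "oriented_det r ruling ruling_frame (indicators m) \<noteq> 0"
    using assms r oriented_det_frame_independent[OF r ruling_conic frame conic_frame_ruling, of "indicators m"]
    by (simp add: ruling_conic)
  then have det: "pairdet r ruling ruling_frame (indicators m) \<noteq> 0"
    by (auto simp: oriented_det_def)
  let ?M = "\<lambda>k j. if k = 0 then 1 else indicators m (k - 1) (ruling_frame j) +
    indicators m (k - 1) (partner ruling (ruling_frame j))"
  have det: "mdet (r - 1) ?M \<noteq> 0" using det by (simp add: pairdet_def)
  have ex: "\<forall>k\<in>{0..<r - 2}. \<exists>j. j \<in> {0..<r - 1} \<and> (m k = ruling_frame j \<or> m k = partner ruling (ruling_frame j))"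
  proof
    fix k assume k: "k \<in> {0..<r - 2}"
    show "\<exists>j. j \<in> {0..<r - 1} \<and> (m k = ruling_frame j \<or> m k = partner ruling (ruling_frame j))"
    proof (rule ccontr)
      assume *: "\<not> ?thesis"
      have "mdet (r - 1) ?M = 0"
        using k * by (intro mdet_zero_row[of "Suc k"]) (auto simp: indicators_def)
      then show False using det by simp
    qed
  qed
  from bchoice[OF this] obtain j where
    j: "\<forall>k\<in>{0..<r - 2}. j k \<in> {0..<r - 1} \<and> (m k = ruling_frame (j k) \<or> m k = partner ruling (ruling_frame (j k)))"
    by blast
  have inj: "inj_on j {0..<r - 2}"
  proof (rule inj_onI, rule ccontr)
    fix k k' assume kk': "k \<in> {0..<r - 2}" "k' \<in> {0..<r - 2}" "j k = j k'" "k \<noteq> k'"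
    have row: "?M (Suc i) n = (if n = j i then 1 else 0)" if "i \<in> {0..<r - 2}" "n < r - 1" for i n
    proof -
      have mi: "m i = ruling_frame (j i) \<or> m i = partner ruling (ruling_frame (j i))" and ji: "j i < r - 1"
        using j that by auto
      have f: "conic_frame r ruling ruling_frame" by (rule conic_frame_ruling) (use r in simp)
      have ne: "ruling_frame i \<noteq> partner ruling (ruling_frame n)" for i n
      proof
        assume "ruling_frame i = partner ruling (ruling_frame n)"
        then have "ruling_frame i 0 = partner ruling (ruling_frame n) 0" by simp
        then show False by (simp add: ruling_frame_def partner_def exceptional_class_def ruling_def)
      qed
      have same: "ruling_frame n = ruling_frame (j i) \<longleftrightarrow> n = j i"
        using conic_frame_inj[OF f that(2) ji] by auto
      have "partner ruling (ruling_frame n) = partner ruling (ruling_frame (j i)) \<longleftrightarrow> n = j i"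
        using same by (metis partner_partner)
      moreover have "partner ruling (ruling_frame n) \<noteq> ruling_frame (j i)"
        "ruling_frame n \<noteq> partner ruling (ruling_frame (j i))"
        using ne[of n "j i"] ne[of "j i" n] by simp_all
      ultimately show ?thesis
        using mi same by (elim disjE) (simp_all add: indicators_def)
    qed
    have "mdet (r - 1) ?M = 0"
      using kk' row[of k] row[of k'] by (intro mdet_equal_rows[of "Suc k" _ "Suc k'"]) auto
    then show False using det by simp
  qed
  have "card (j ` {0..<r - 2}) < card {0..<r - 1}"
    using r by (simp add: card_image[OF inj])
  moreover have sub: "j ` {0..<r - 2} \<subseteq> {0..<r - 1}" using j by auto
  ultimately obtain t where t: "t \<in> {0..<r - 1}" "t \<notin> j ` {0..<r - 2}"
    by (metis card_mono finite_imageI finite_atLeastLessThan not_less subsetI)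
  define J where "J = {j k + 2 | k. k < r - 2 \<and> m k = partner ruling (ruling_frame (j k))}"
  have J: "J \<subseteq> {2..r} - {t + 2}"
  proof
    fix x assume "x \<in> J"
    then obtain k where k: "x = j k + 2" "k \<in> {0..<r - 2}" by (auto simp: J_def)
    then have "j k \<in> {0..<r - 1}" "j k \<noteq> t" using j t(2) by auto
    then show "x \<in> {2..r} - {t + 2}" using k(1) by auto
  qed
  have t2: "t + 2 \<in> {2..r}" using t(1) by auto
  have "3 \<le> r" using r by simp
  from orthogonal_root_exists[OF this t2 J] obtain \<alpha> where root: "root r \<alpha>"
    and E: "\<And>k. k \<in> {2..r} - {t + 2} - J \<Longrightarrow> reflection r \<alpha> (exceptional_class k) = exceptional_class k"
    and E': "\<And>k. k \<in> J \<Longrightarrow> reflection r \<alpha> (partner ruling (exceptional_class k)) = partner ruling (exceptional_class k)"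
    by blast
  have m_fixed: "reflection r \<alpha> (m k) = m k" if k: "k < r - 2" for k
  proof (cases "m k = partner ruling (ruling_frame (j k))")
    case True
    then have "j k + 2 \<in> J" using k unfolding J_def by blast
    then show ?thesis using E'[of "j k + 2"] True by (simp add: ruling_frame_def)
  next
    case False
    have "j k + 2 \<notin> J"
    proof
      assume "j k + 2 \<in> J"
      then obtain k' where k': "j k' = j k" "k' < r - 2" "m k' = partner ruling (ruling_frame (j k'))"
        unfolding J_def by auto
      then have "k' = k" using inj k by (simp add: inj_on_def)
      then show False using k' False by simp
    qed
    moreover have "j k < r - 1" "j k \<noteq> t" using j k t(2) by auto
    ultimately have "j k + 2 \<in> {2..r} - {t + 2} - J" by auto
    moreover have "m k = exceptional_class (j k + 2)"
      using False j k by (auto simp: ruling_frame_def)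
    ultimately show ?thesis using E[of "j k + 2"] by simp
  qed
  have "hlog_sum (indicators m) = hlog_sum (\<lambda>k l. indicators m k (reflection r \<alpha> l))"
    unfolding indicators_reflection[OF root] by (rule hlog_sum_cong) (simp add: indicators_def m_fixed)
  then show ?thesis using hlog_sum_reflection[OF root, of "indicators m"] by simp
qed

lemma hlog_sum_indicators_conic:
  assumes "c \<in> conics r"
  shows "\<forall>m. oriented_det r c (A c) (indicators m) \<noteq> 0 \<longrightarrow> hlog_sum (indicators m) = 0"
proof (rule conic_induct[OF assms r, where
      P = "\<lambda>c. \<forall>m. oriented_det r c (A c) (indicators m) \<noteq> 0 \<longrightarrow> hlog_sum (indicators m) = 0"])
  show "\<forall>m. oriented_det r ruling (A ruling) (indicators m) \<noteq> 0 \<longrightarrow> hlog_sum (indicators m) = 0"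
    using hlog_sum_indicators_ruling by blast
next
  fix c i assume c: "c \<in> conics r" "i < r"
    and IH: "\<forall>m. oriented_det r c (A c) (indicators m) \<noteq> 0 \<longrightarrow> hlog_sum (indicators m) = 0"
  let ?s = "reflection r (simple_root i)"
  show "\<forall>m. oriented_det r (?s c) (A (?s c)) (indicators m) \<noteq> 0 \<longrightarrow> hlog_sum (indicators m) = 0"
  proof (intro allI impI)
    fix m assume "oriented_det r (?s c) (A (?s c)) (indicators m) \<noteq> 0"
    then have "oriented_det r c (A c) (indicators (\<lambda>k. ?s (m k))) \<noteq> 0"
      unfolding oriented_det_reflection_frame[OF simple_root[OF c(2)] c(1)]
        indicators_reflection[OF simple_root[OF c(2)]] by simp
    with IH have "hlog_sum (indicators (\<lambda>k. ?s (m k))) = 0" by blast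
    then show "hlog_sum (indicators m) = 0"
      using hlog_sum_reflection[OF simple_root[OF c(2)], of "indicators m"]
      unfolding indicators_reflection[OF simple_root[OF c(2)]] by simp
  qed
qed

lemma hlog_sum_indicators: "hlog_sum (indicators m) = 0"
proof (cases "\<exists>c\<in>conics r. oriented_det r c (A c) (indicators m) \<noteq> 0")
  case True
  then show ?thesis using hlog_sum_indicators_conic by blast
next
  case False
  then show ?thesis by (simp add: hlog_sum_def)
qed

lemma hlog_sum_linear:
  assumes "n < r - 2"
  shows "hlog_sum G = (\<Sum>l\<in>lines r. G n l * hlog_sum (G(n := (\<lambda>l'. if l' = l then 1 else 0))))"
proof -
  have pd: "pairdet r c (A c) G = (\<Sum>l\<in>lines r. G n l * pairdet r c (A c) (G(n := (\<lambda>l'. if l' = l then 1 else 0))))"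
    if c: "c \<in> conics r" for c
  proof -
    let ?a = "A c"
    let ?f = "\<lambda>k j. if k = 0 then 1 else G (k - 1) (?a j) + G (k - 1) (partner c (?a j))"
    let ?h = "\<lambda>l j. (if ?a j = l then 1 else 0) + (if partner c (?a j) = l then 1 else 0)"
    have "pairdet r c ?a G = mdet (r - 1) (\<lambda>k j. if k = Suc n then \<Sum>l\<in>lines r. G n l * ?h l j else ?f k j)"
      unfolding pairdet_def
    proof (rule mdet_cong)
      fix k j assume j: "j < r - 1"
      have "(\<Sum>l\<in>lines r. G n l * ?h l j) =
          (\<Sum>l\<in>lines r. (if ?a j = l then G n l else 0) + (if partner c (?a j) = l then G n l else 0))"
        by (intro sum.cong) auto
      also have "\<dots> = G n (?a j) + G n (partner c (?a j))"
        using conic_frame_lines[OF frame[OF c] j] finite_lines[OF r(2)] by (simp add: sum.distrib)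
      finally show "?f k j = (if k = Suc n then \<Sum>l\<in>lines r. G n l * ?h l j else ?f k j)" by simp
    qed
    also have "\<dots> = (\<Sum>l\<in>lines r. G n l * mdet (r - 1) (\<lambda>k j. if k = Suc n then ?h l j else ?f k j))"
      using assms by (intro mdet_linear_row) simp
    also have "\<dots> = (\<Sum>l\<in>lines r. G n l * pairdet r c ?a (G(n := (\<lambda>l'. if l' = l then 1 else 0))))"
      unfolding pairdet_def by (intro sum.cong refl arg_cong2[where f = "(*)"] mdet_cong) auto
    finally show ?thesis .
  qed
  have "hlog_sum G = (\<Sum>c\<in>conics r. \<Sum>l\<in>lines r. G n l * oriented_det r c (A c) (G(n := (\<lambda>l'. if l' = l then 1 else 0))))"
    unfolding hlog_sum_def oriented_det_def
    by (intro sum.cong refl) (simp add: pd sum_distrib_left mult_ac)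
  also have "\<dots> = (\<Sum>l\<in>lines r. \<Sum>c\<in>conics r. G n l * oriented_det r c (A c) (G(n := (\<lambda>l'. if l' = l then 1 else 0))))"
    by (rule sum.swap)
  finally show ?thesis by (simp add: hlog_sum_def sum_distrib_left)
qed

text \<open>The functions are replaced by indicators of lines one at a time.\<close>

theorem hlog_sum_eq_0: "hlog_sum G = 0"
proof -
  have "hlog_sum G = 0" if "\<forall>k. n \<le> k \<and> k < r - 2 \<longrightarrow> (\<exists>l. G k = (\<lambda>l'. if l' = l then 1 else 0))" "n \<le> r - 2" for n G
    using that
  proof (induction n arbitrary: G)
    case 0
    then have "\<forall>k\<in>{0..<r - 2}. \<exists>l. G k = (\<lambda>l'. if l' = l then 1 else 0)" by auto
    from bchoice[OF this] obtain m where "\<forall>k\<in>{0..<r - 2}. G k = (\<lambda>l'. if l' = m k then 1 else 0)" by blast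
    then have "hlog_sum G = hlog_sum (indicators m)"
      by (intro hlog_sum_cong) (simp add: indicators_def)
    then show ?case by (simp add: hlog_sum_indicators)
  next
    case (Suc n)
    have "hlog_sum (G(n := (\<lambda>l'. if l' = l then 1 else 0))) = 0" for l
      using Suc.prems by (intro Suc.IH) (auto simp: le_Suc_eq)
    then show ?case using Suc.prems by (subst hlog_sum_linear[of n]) auto
  qed
  note * = this
  show ?thesis by (rule *[of "r - 2"]) auto
qed

end

section \<open>The group and the cone over the homogeneous space\<close>

lemma line_minus_root:
  assumes "root r \<alpha>" "l \<in> lines r"
  shows "(\<lambda>j. l j - \<alpha> j) \<in> lines r \<longleftrightarrow> intersection_form r l \<alpha> = - 1"
  using assms intersection_form_commute[of r \<alpha> l]
  by (auto simp: lines_def root_def intersection_form_linear pic_lattice_def)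

lemma root_uminus: "root r \<alpha> \<Longrightarrow> root r (\<lambda>j. - \<alpha> j)"
  by (auto simp: root_def intersection_form_linear pic_lattice_def)

lemma root_group_element_apply:
  assumes "root r \<alpha>"
  shows "root_group_element r \<alpha> t x l =
    x l + (if l \<in> lines r \<and> intersection_form r l \<alpha> = - 1 then t * x (\<lambda>j. l j - \<alpha> j) else 0)"
  using line_minus_root[OF assms] by (auto simp: root_group_element_def root_operator_def)

lemma root_group_element_0: "root_group_element r \<alpha> 0 = id"
  by (auto simp: root_group_element_def)

lemma root_group_element_linear:
  "root_group_element r \<alpha> t (\<lambda>l. x l + c * y l) =
    (\<lambda>l. root_group_element r \<alpha> t x l + c * root_group_element r \<alpha> t y l)"
  by (auto simp: root_group_element_def root_operator_def algebra_simps)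

lemma G_group_linear:
  assumes "g \<in> G_group r"
  shows "g (\<lambda>l. x l + c * y l) = (\<lambda>l. g x l + c * g y l)"
  using assms by (induction arbitrary: x y) (simp_all add: root_group_element_linear)

lemma G_group_zero:
  assumes "g \<in> G_group r"
  shows "g (\<lambda>_. 0) = (\<lambda>_. 0)"
  using G_group_linear[OF assms, of "\<lambda>_. 0" "- 1" "\<lambda>_. 0"] by simp

lemma G_group_scale:
  assumes "g \<in> G_group r"
  shows "g (scale c x) = scale c (g x)"
  using G_group_linear[OF assms, of "\<lambda>_. 0" c x] by (simp add: scale_def G_group_zero[OF assms])

lemma G_group_comp:
  assumes "g \<in> G_group r" "h \<in> G_group r"
  shows "g \<circ> h \<in> G_group r"
  using assms by (induction) (auto simp: comp_assoc intro: G_group.intros)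

lemma root_group_element_G_group:
  assumes "i < r"
  shows "root_group_element r (simple_root i) t \<in> G_group r"
    and "root_group_element r (\<lambda>j. - simple_root i j) t \<in> G_group r"
  using G_pos[OF G_id assms, of t] G_neg[OF G_id assms, of t] by simp_all

lemma minuscule_cone_G_group:
  assumes "g \<in> G_group r" "x \<in> minuscule_cone r"
  shows "g x \<in> minuscule_cone r"
proof -
  obtain c h where x: "x = scale c (h (weight_vector (exceptional_class r)))" "c \<noteq> 0" "h \<in> G_group r"
    using assms(2) by (auto simp: minuscule_cone_def)
  have "g x = scale c ((g \<circ> h) (weight_vector (exceptional_class r)))"
    unfolding x(1) G_group_scale[OF assms(1)] by simp
  then show ?thesis
    unfolding minuscule_cone_def using x(2) G_group_comp[OF assms(1) x(3)] by blast
qed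

text \<open>The lines \<open>E\<^sub>1, \<dots>, E\<^sub>r\<close> are the weights of a linear subspace contained in the cone, apart from 0.  Its
  translates supply points of the cone along with many tangent vectors.\<close>

definition exceptional_span :: "nat \<Rightarrow> weight_vec set" where
  "exceptional_span r = {x. \<forall>l. x l \<noteq> 0 \<longrightarrow> l \<in> exceptional_class ` {1..r}}"

lemma exceptional_class_inj: "exceptional_class i = exceptional_class j \<longleftrightarrow> i = j"
  by (auto simp: exceptional_class_def fun_eq_iff)

lemma exceptional_span_closed:
  "x \<in> exceptional_span r \<Longrightarrow> y \<in> exceptional_span r \<Longrightarrow> (\<lambda>l. x l + c * y l) \<in> exceptional_span r"
  unfolding exceptional_span_def by (auto; metis add.right_neutral mult_zero_right)

lemma exceptional_span_eqI:
  assumes "x \<in> exceptional_span r" "y \<in> exceptional_span r"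
    and "\<And>i. 1 \<le> i \<Longrightarrow> i \<le> r \<Longrightarrow> x (exceptional_class i) = y (exceptional_class i)"
  shows "x = y"
proof
  fix l
  show "x l = y l"
  proof (cases "l \<in> exceptional_class ` {1..r}")
    case True
    then show ?thesis using assms(3) by auto
  next
    case False
    then have "x l = 0" "y l = 0" using assms(1,2) by (auto simp: exceptional_span_def)
    then show ?thesis by simp
  qed
qed

lemma exceptional_minus_simple_root:
  "0 < n \<Longrightarrow> (\<lambda>j. exceptional_class n j - simple_root n j) = exceptional_class (Suc n)"
  "0 < n \<Longrightarrow> (\<lambda>j. exceptional_class (Suc n) j + simple_root n j) = exceptional_class n"
  by (auto simp: simple_root_def)

lemma root_group_span:
  assumes "3 \<le> r" "0 < n" "n < r" "x \<in> exceptional_span r"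
  shows "root_group_element r (simple_root n) t x =
      x(exceptional_class n := x (exceptional_class n) + t * x (exceptional_class (Suc n)))" (is ?up)
    and "root_group_element r (\<lambda>j. - simple_root n j) t x =
      x(exceptional_class (Suc n) := x (exceptional_class (Suc n)) + t * x (exceptional_class n))" (is ?down)
proof -
  have root: "root r (simple_root n)" using assms root_simple_root by simp
  note root' = root_uminus[OF root]
  have E: "intersection_form r (exceptional_class j) (simple_root n) = (if j = Suc n then 1 else if j = n then - 1 else 0)" for j
    using assms(2,3) by (auto simp: intersection_simple_root exceptional_class_def)
  show ?up
  proof
    fix l
    show "root_group_element r (simple_root n) t x l =
      (x(exceptional_class n := x (exceptional_class n) + t * x (exceptional_class (Suc n)))) l"
    proof (cases "l = exceptional_class n")
      case True
      then show ?thesis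
        using E[of n] assms exceptional_minus_simple_root(1)[of n] exceptional_class_line[of n r]
        by (simp add: root_group_element_apply[OF root])
    next
      case False
      have "x (\<lambda>j. l j - simple_root n j) = 0" if "intersection_form r l (simple_root n) = - 1"
      proof (rule ccontr)
        assume "x (\<lambda>j. l j - simple_root n j) \<noteq> 0"
        then obtain j where j: "(\<lambda>j. l j - simple_root n j) = exceptional_class j"
          using assms(4) by (auto simp: exceptional_span_def)
        have "intersection_form r (exceptional_class j) (simple_root n) = 1"
          using that root unfolding j[symmetric] by (simp add: intersection_form_linear root_def)
        then have "j = Suc n" using E[of j] by (auto split: if_splits)
        then have "l = (\<lambda>i. exceptional_class (Suc n) i + simple_root n i)"
          using j by (auto simp: fun_eq_iff algebra_simps)
        then show False using False exceptional_minus_simple_root(2)[OF assms(2)] by simp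
      qed
      then show ?thesis using False by (simp add: root_group_element_apply[OF root])
    qed
  qed
  show ?down
  proof
    fix l
    show "root_group_element r (\<lambda>j. - simple_root n j) t x l =
      (x(exceptional_class (Suc n) := x (exceptional_class (Suc n)) + t * x (exceptional_class n))) l"
    proof (cases "l = exceptional_class (Suc n)")
      case True
      then show ?thesis
        using E[of "Suc n"] assms exceptional_minus_simple_root(2)[of n] exceptional_class_line[of "Suc n" r]
        by (simp add: root_group_element_apply[OF root'] intersection_form_linear)
    next
      case False
      have "x (\<lambda>j. l j + simple_root n j) = 0" if "intersection_form r l (simple_root n) = 1"
      proof (rule ccontr)
        assume "x (\<lambda>j. l j + simple_root n j) \<noteq> 0"
        then obtain j where j: "(\<lambda>j. l j + simple_root n j) = exceptional_class j"
          using assms(4) by (auto simp: exceptional_span_def)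
        have "intersection_form r (exceptional_class j) (simple_root n) = - 1"
          using that root unfolding j[symmetric] by (simp add: intersection_form_linear root_def)
        then have "j = n" using E[of j] by (auto split: if_splits)
        then have "l = (\<lambda>i. exceptional_class n i - simple_root n i)"
          using j by (auto simp: fun_eq_iff algebra_simps)
        then show False using False exceptional_minus_simple_root(1)[OF assms(2)] by simp
      qed
      then show ?thesis using False by (simp add: root_group_element_apply[OF root'] intersection_form_linear)
    qed
  qed
qed

text \<open>The root subgroups of the \<open>E\<^sub>i - E\<^sub>i\<^sub>+\<^sub>1\<close> act on the subspace as elementary matrices, so elimination moves every
  non-zero vector to a multiple of the lowest weight vector.\<close>

lemma exceptional_span_cone:
  assumes "3 \<le> r" "x \<in> exceptional_span r" "x \<noteq> (\<lambda>_. 0)"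
  shows "x \<in> minuscule_cone r"
proof -
  have "x \<in> minuscule_cone r" if "1 \<le> n" "n \<le> r" "x \<in> exceptional_span r"
    "\<And>j. 1 \<le> j \<Longrightarrow> j < n \<Longrightarrow> x (exceptional_class j) = 0" "x \<noteq> (\<lambda>_. 0)" for n x
    using that(2,1,3-)
  proof (induction arbitrary: x rule: inc_induct)
    case base
    have "scale (x (exceptional_class r)) (weight_vector (exceptional_class r)) = x"
      using base assms(1)
      by (intro exceptional_span_eqI[of _ r])
        (auto simp: scale_def weight_vector_def exceptional_span_def exceptional_class_inj)
    moreover have "x (exceptional_class r) \<noteq> 0"
      using base calculation by (auto simp: scale_def)
    ultimately show ?case
      unfolding minuscule_cone_def using G_id[of r]
      by (auto intro!: exI[of _ "x (exceptional_class r)"] exI[of _ id])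
  next
    case (step n)
    let ?E = exceptional_class
    let ?up = "\<lambda>t. root_group_element r (simple_root n) t"
    let ?down = "\<lambda>t. root_group_element r (\<lambda>j. - simple_root n j) t"
    have n: "0 < n" "n < r" using step by auto
    show ?case
    proof (cases "x (?E n) = 0")
      case True
      then show ?thesis using step.prems by (intro step.IH) (auto simp: less_Suc_eq)
    next
      case False
      \<comment> \<open>First make the next coordinate non-zero, then use it to clear the coordinate of \<open>E\<^sub>n\<close>.\<close>
      define t where "t = (if x (?E (Suc n)) = 0 then 1 else 0 :: complex)"
      define y where "y = x(?E (Suc n) := x (?E (Suc n)) + t * x (?E n))"
      define u where "u = - y (?E n) / y (?E (Suc n))"
      define z where "z = y(?E n := 0)"
      have inS: "w(?E j := c) \<in> exceptional_span r" if "w \<in> exceptional_span r" "1 \<le> j" "j \<le> r" for w j c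
        using that by (auto simp: exceptional_span_def)
      have y0: "y (?E (Suc n)) \<noteq> 0"
        using False by (auto simp: y_def t_def)
      have y: "y \<in> exceptional_span r" using n step.prems unfolding y_def by (intro inS) auto
      then have z: "z \<in> exceptional_span r" using n unfolding z_def by (intro inS) auto
      have "z \<in> minuscule_cone r"
      proof (rule step.IH)
        show "z (?E j) = 0" if "1 \<le> j" "j < Suc n" for j
          using that step.prems by (auto simp: z_def y_def exceptional_class_inj less_Suc_eq)
        have "z (?E (Suc n)) \<noteq> 0" using y0 by (simp add: z_def exceptional_class_inj)
        then show "z \<noteq> (\<lambda>_. 0)" by auto
      qed (use z in auto)
      moreover have "?up (- u) z = y"
        using y0 unfolding root_group_span(1)[OF assms(1) n z]
        by (intro ext) (simp add: z_def u_def exceptional_class_inj)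
      moreover have "?down (- t) y = x"
        unfolding root_group_span(2)[OF assms(1) n y]
        by (intro ext) (simp add: y_def exceptional_class_inj)
      ultimately show ?thesis
        using minuscule_cone_G_group root_group_element_G_group[OF n(2)] by metis
    qed
  qed
  from this[of 1 x] show ?thesis using assms by simp
qed

lemma weight_vector_span: "1 \<le> i \<Longrightarrow> i \<le> r \<Longrightarrow> weight_vector (exceptional_class i) \<in> exceptional_span r"
  by (auto simp: exceptional_span_def weight_vector_def)

section \<open>Polynomial paths in the group\<close>

text \<open>Complex polynomials in one variable suffice for the density arguments: away from finitely many parameters
  a non-zero one has no zeros.\<close>

definition poly_curve :: "(complex \<Rightarrow> complex) \<Rightarrow> bool" where
  "poly_curve f \<longleftrightarrow> (\<exists>p. f = poly p)"

lemma poly_curve_const: "poly_curve (\<lambda>_. c)"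
  unfolding poly_curve_def by (rule exI[of _ "[:c:]"]) auto

lemma poly_curve_id: "poly_curve (\<lambda>s. s)"
  unfolding poly_curve_def by (rule exI[of _ "[:0, 1:]"]) auto

lemma poly_curve_add: "poly_curve f \<Longrightarrow> poly_curve g \<Longrightarrow> poly_curve (\<lambda>s. f s + g s)"
  unfolding poly_curve_def
proof safe
  fix p q :: "complex poly"
  show "\<exists>p'. (\<lambda>s. poly p s + poly q s) = poly p'"
    by (rule exI[of _ "p + q"]) auto
qed

lemma poly_curve_mult: "poly_curve f \<Longrightarrow> poly_curve g \<Longrightarrow> poly_curve (\<lambda>s. f s * g s)"
  unfolding poly_curve_def
proof safe
  fix p q :: "complex poly"
  show "\<exists>p'. (\<lambda>s. poly p s * poly q s) = poly p'"
    by (rule exI[of _ "p * q"]) auto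
qed

lemma poly_curve_reverse: "poly_curve f \<Longrightarrow> poly_curve (\<lambda>s. f (1 - s))"
  unfolding poly_curve_def
proof safe
  fix p :: "complex poly"
  show "\<exists>q. (\<lambda>s. poly p (1 - s)) = poly q"
    by (rule exI[of _ "pcompose p [:1, - 1:]"]) (auto simp: poly_pcompose)
qed

lemma poly_curve_isCont: "poly_curve f \<Longrightarrow> isCont f s"
  unfolding poly_curve_def by (auto intro!: continuous_intros)

lemma poly_curve_eventually_nonzero:
  assumes "poly_curve f" "f s1 \<noteq> 0"
  shows "\<forall>\<^sub>F s in at s0. f s \<noteq> 0"
proof -
  obtain p where p: "f = poly p" using assms(1) by (auto simp: poly_curve_def)
  then have "p \<noteq> 0" using assms(2) by auto
  then have fin: "finite {s. f s = 0}" using poly_roots_finite p by auto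
  have "open (- ({s. f s = 0} - {s0}))"
    using fin by (intro open_Compl finite_imp_closed) auto
  then have "\<forall>\<^sub>F s in at s0. s \<in> - ({s. f s = 0} - {s0})"
    by (intro eventually_at_in_open') auto
  then show ?thesis
    using eventually_neq_at_within[of s0 s0 UNIV] by eventually_elim auto
qed

text \<open>The second condition says that the matrix coefficients of \<open>k\<close> are polynomials, phrased for curves of
  vectors because this form is stable under composition.\<close>

definition G_path :: "nat \<Rightarrow> (complex \<Rightarrow> weight_vec \<Rightarrow> weight_vec) \<Rightarrow> bool" where
  "G_path r k \<longleftrightarrow> (\<forall>s. k s \<in> G_group r) \<and>
     (\<forall>x. (\<forall>l. poly_curve (\<lambda>s. x s l)) \<longrightarrow> (\<forall>l. poly_curve (\<lambda>s. k s (x s) l)))"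

lemma G_path_comp:
  assumes "G_path r k" "G_path r k'"
  shows "G_path r (\<lambda>s. k s \<circ> k' s)"
  using assms G_group_comp unfolding G_path_def by auto

lemma poly_curve_root_group_element:
  assumes "\<forall>l. poly_curve (\<lambda>s. x s l)" "poly_curve t"
  shows "poly_curve (\<lambda>s. root_group_element r \<alpha> (t s) (x s) l)"
  using assms unfolding root_group_element_def root_operator_def
  by (cases "l \<in> lines r"; cases "(\<lambda>j. l j - \<alpha> j) \<in> lines r")
    (simp_all add: poly_curve_add poly_curve_mult)

lemma G_path_from_id:
  assumes "g \<in> G_group r"
  shows "\<exists>k. G_path r k \<and> k 0 = id \<and> k 1 = g"
  using assms
proof induction
  case G_id
  show ?case by (rule exI[of _ "\<lambda>_. id"]) (simp add: G_path_def G_group.G_id[unfolded id_def] id_def)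
next
  case (G_pos g i t)
  then obtain k where k: "G_path r k" "k 0 = id" "k 1 = g" by blast
  have "G_path r (\<lambda>s. root_group_element r (simple_root i) (s * t))"
    unfolding G_path_def using G_pos.hyps
    by (auto intro!: root_group_element_G_group poly_curve_root_group_element poly_curve_mult
        poly_curve_id poly_curve_const)
  from G_path_comp[OF this k(1)] show ?case
    using k(2,3) by (intro exI[of _ "\<lambda>s. root_group_element r (simple_root i) (s * t) \<circ> k s"])
      (simp add: root_group_element_0 o_def)
next
  case (G_neg g i t)
  then obtain k where k: "G_path r k" "k 0 = id" "k 1 = g" by blast
  have "G_path r (\<lambda>s. root_group_element r (\<lambda>j. - simple_root i j) (s * t))"
    unfolding G_path_def using G_neg.hyps
    by (auto intro!: root_group_element_G_group poly_curve_root_group_element poly_curve_mult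
        poly_curve_id poly_curve_const)
  from G_path_comp[OF this k(1)] show ?case
    using k(2,3) by (intro exI[of _ "\<lambda>s. root_group_element r (\<lambda>j. - simple_root i j) (s * t) \<circ> k s"])
      (simp add: root_group_element_0 o_def)
qed

lemma G_path_reverse:
  assumes "G_path r k"
  shows "G_path r (\<lambda>s. k (1 - s))"
  unfolding G_path_def
proof (intro conjI allI impI)
  show "k (1 - s) \<in> G_group r" for s using assms by (simp add: G_path_def)
  fix x :: "complex \<Rightarrow> weight_vec" and l assume "\<forall>l. poly_curve (\<lambda>s. x s l)"
  then have "\<forall>l. poly_curve (\<lambda>s. x (1 - s) l)"
    using poly_curve_reverse by blast
  then have "poly_curve (\<lambda>s. k s (x (1 - s)) l)" using assms by (simp add: G_path_def)
  from poly_curve_reverse[OF this] show "poly_curve (\<lambda>s. k (1 - s) (x s) l)" by simp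
qed

lemma G_path_exists:
  assumes "g \<in> G_group r" "h \<in> G_group r"
  shows "\<exists>k. G_path r k \<and> k 0 = g \<and> k 1 = h"
proof -
  obtain k k' where "G_path r k" "k 0 = id" "k 1 = g" "G_path r k'" "k' 0 = id" "k' 1 = h"
    using G_path_from_id assms by meson
  then show ?thesis
    by (intro exI[of _ "\<lambda>s. k (1 - s) \<circ> k' s"]) (auto intro: G_path_comp G_path_reverse)
qed

section \<open>Representatives of the simple reflections\<close>

text \<open>The integers \<open>(l\<^sub>i - b) (l\<^sub>i - b - 1)\<close> are non-negative, and for the given \<open>b\<close> the equations of a line make their sum
  over the seven indices 0.\<close>

lemma line_coefficients:
  assumes "l \<in> lines r" "r \<le> 7"
  obtains b where "\<And>i. 1 \<le> i \<Longrightarrow> i \<le> 7 \<Longrightarrow> l i = b \<or> l i = b + 1"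
    and "l 0 = 0 \<and> b = 0 \<or> l 0 = 1 \<and> b = - 1 \<or> l 0 = 2 \<and> b = - 1 \<or> l 0 = 3 \<and> b = - 2"
proof -
  note eq = line_equations[OF assms] and bd = line_degree_bounds[OF assms]
  define b where "b = (if l 0 = 0 then 0 else if l 0 = 3 then - 2 else - 1 :: int)"
  have b: "l 0 = 0 \<and> b = 0 \<or> l 0 = 1 \<and> b = - 1 \<or> l 0 = 2 \<and> b = - 1 \<or> l 0 = 3 \<and> b = - 2"
    using bd by (auto simp: b_def)
  define f where "f i = (l i - b) * (l i - (b + 1))" for i
  have f: "f i \<ge> 0" for i
    unfolding f_def zero_le_mult_iff by linarith
  have "f 1 + f 2 + f 3 + f 4 + f 5 + f 6 + f 7 =
      ((l 1)\<^sup>2 + (l 2)\<^sup>2 + (l 3)\<^sup>2 + (l 4)\<^sup>2 + (l 5)\<^sup>2 + (l 6)\<^sup>2 + (l 7)\<^sup>2)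
      - (2 * b + 1) * (l 1 + l 2 + l 3 + l 4 + l 5 + l 6 + l 7) + 7 * (b * (b + 1))"
    by (simp add: f_def power2_eq_square algebra_simps)
  also have "\<dots> = ((l 0)\<^sup>2 + 1) - (2 * b + 1) * (1 - 3 * l 0) + 7 * (b * (b + 1))"
  proof -
    have "l 1 + l 2 + l 3 + l 4 + l 5 + l 6 + l 7 = 1 - 3 * l 0" using eq(3) by simp
    then show ?thesis using eq(2) by (simp only:)
  qed
  also have "\<dots> = 0" using b by auto
  finally have "f 1 = 0" "f 2 = 0" "f 3 = 0" "f 4 = 0" "f 5 = 0" "f 6 = 0" "f 7 = 0"
    using f[of 1] f[of 2] f[of 3] f[of 4] f[of 5] f[of 6] f[of 7] by linarith+
  moreover have "i \<in> {1, 2, 3, 4, 5, 6, 7}" if "1 \<le> i" "i \<le> 7" for i :: nat using that by auto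
  ultimately have "f i = 0" if "1 \<le> i" "i \<le> 7" for i using that by blast
  then have "l i = b \<or> l i = b + 1" if "1 \<le> i" "i \<le> 7" for i using that by (auto simp: f_def)
  then show ?thesis using b that by blast
qed

text \<open>This is the minuscule property: under the root subgroups \<open>SL\<^sub>2\<close> of the simple roots the representation splits into
  pieces of dimension at most two.\<close>

lemma line_simple_root_bound:
  assumes "l \<in> lines r" "3 \<le> r" "r \<le> 7" "i < r"
  shows "intersection_form r l (simple_root i) \<in> {- 1, 0, 1}"
proof -
  obtain b where b: "\<And>i. 1 \<le> i \<Longrightarrow> i \<le> 7 \<Longrightarrow> l i = b \<or> l i = b + 1"
    "l 0 = 0 \<and> b = 0 \<or> l 0 = 1 \<and> b = - 1 \<or> l 0 = 2 \<and> b = - 1 \<or> l 0 = 3 \<and> b = - 2"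
    using line_coefficients[OF assms(1,3)] by blast
  show ?thesis
  proof (cases "i = 0")
    case True
    have "b \<le> l i" "l i \<le> b + 1" if "1 \<le> i" "i \<le> 7" for i
      using b(1)[OF that] by linarith+
    then have le: "b \<le> l 1" "b \<le> l 2" "b \<le> l 3" "b \<le> l 4" "b \<le> l 5" "b \<le> l 6" "b \<le> l 7"
      "l 1 \<le> b + 1" "l 2 \<le> b + 1" "l 3 \<le> b + 1" "l 4 \<le> b + 1" "l 5 \<le> b + 1" "l 6 \<le> b + 1" "l 7 \<le> b + 1"
      by simp_all
    have "- 1 \<le> l 0 + l 1 + l 2 + l 3 \<and> l 0 + l 1 + l 2 + l 3 \<le> 1"
      using b(2) by (elim disjE conjE) (use le line_equations(3)[OF assms(1,3)] in linarith)+
    then have "l 0 + l 1 + l 2 + l 3 \<in> {- 1, 0, 1}" by auto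
    then show ?thesis using True assms(2) by (simp add: intersection_simple_root_0)
  next
    case False
    then show ?thesis
      using b(1)[of i] b(1)[of "Suc i"] assms by (auto simp: intersection_simple_root)
  qed
qed

text \<open>The usual representative \<open>exp e \<cdot> exp (- f) \<cdot> exp e\<close> of the reflection, which on a two-dimensional piece
  is a rotation by a right angle.\<close>

definition weyl_element :: "nat \<Rightarrow> nat \<Rightarrow> weight_vec \<Rightarrow> weight_vec" where
  "weyl_element r i = root_group_element r (simple_root i) 1 \<circ>
     (root_group_element r (\<lambda>j. - simple_root i j) (- 1) \<circ> root_group_element r (simple_root i) 1)"

lemma weyl_element_G_group: "i < r \<Longrightarrow> weyl_element r i \<in> G_group r"
  unfolding weyl_element_def by (intro G_group_comp root_group_element_G_group)

lemma weyl_element_apply: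
  assumes "l \<in> lines r" "3 \<le> r" "r \<le> 7" "i < r"
  shows "weyl_element r i x l =
    (if intersection_form r l (simple_root i) = 1 then - 1 else 1) * x (reflection r (simple_root i) l)"
proof -
  let ?\<alpha> = "simple_root i"
  have root: "root r ?\<alpha>" using assms root_simple_root by simp
  note root' = root_uminus[OF root]
  have aa: "intersection_form r ?\<alpha> ?\<alpha> = - 2" using root by (simp add: root_def)
  have minus: "intersection_form r (\<lambda>j. l j - ?\<alpha> j) ?\<alpha> = intersection_form r l ?\<alpha> + 2"
    and plus: "intersection_form r (\<lambda>j. l j + ?\<alpha> j) ?\<alpha> = intersection_form r l ?\<alpha> - 2"
    by (simp_all add: intersection_form_linear aa)
  have lm: "intersection_form r l ?\<alpha> = - 1 \<Longrightarrow> (\<lambda>j. l j - ?\<alpha> j) \<in> lines r"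
    and lp: "intersection_form r l ?\<alpha> = 1 \<Longrightarrow> (\<lambda>j. l j + ?\<alpha> j) \<in> lines r"
    using line_minus_root[OF root assms(1)] line_minus_root[OF root' assms(1)]
    by (simp_all add: intersection_form_linear)
  have "intersection_form r l ?\<alpha> \<in> {- 1, 0, 1}" by (rule line_simple_root_bound[OF assms])
  then consider "intersection_form r l ?\<alpha> = - 1" | "intersection_form r l ?\<alpha> = 0" | "intersection_form r l ?\<alpha> = 1"
    by auto
  then show ?thesis
    using assms(1) lm lp
    by cases (simp_all add: weyl_element_def root_group_element_apply[OF root] root_group_element_apply[OF root']
        intersection_form_linear minus plus aa reflection_def)
qed

section \<open>Raising elements and the chain of low weights\<close>

text \<open>The lines \<open>E\<^sub>3, \<dots>, E\<^sub>r\<close> and \<open>H - E\<^sub>1 - E\<^sub>2\<close>.  Subtracting a simple root from one of them leads to another one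
  or to no line at all, so raising operators never carry other coordinates into these.\<close>

definition chain :: "nat \<Rightarrow> pic set" where
  "chain r = insert (partner ruling (exceptional_class 2)) (exceptional_class ` {3..r})"

text \<open>Elements of the group with non-negative matrix entries, which cannot produce cancellations.\<close>

inductive_set raising :: "nat \<Rightarrow> (weight_vec \<Rightarrow> weight_vec) set" for r :: nat where
  id: "id \<in> raising r"
| step: "g \<in> raising r \<Longrightarrow> i < r \<Longrightarrow> root_group_element r (simple_root i) 1 \<circ> g \<in> raising r"

lemma raising_G_group: "g \<in> raising r \<Longrightarrow> g \<in> G_group r"
proof (induction rule: raising.induct)
  case id
  show ?case by (rule G_id)
next
  case (step g i)
  then show ?case by (intro G_pos)
qed

lemma raising_comp: "g \<in> raising r \<Longrightarrow> h \<in> raising r \<Longrightarrow> g \<circ> h \<in> raising r"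
  by (induction rule: raising.induct) (auto simp: comp_assoc intro: raising.intros)

lemma raise_exceptional:
  assumes "3 \<le> r" "i < r" "3 \<le> j" "j \<le> r"
  shows "root_group_element r (simple_root i) 1 x (exceptional_class j) =
    x (exceptional_class j) + (if i = j then x (exceptional_class (Suc j)) else 0)"
proof -
  have root: "root r (simple_root i)" using assms root_simple_root by simp
  have line: "exceptional_class j \<in> lines r" using assms by (intro exceptional_class_line) auto
  have "intersection_form r (exceptional_class j) (simple_root i) = - 1 \<longleftrightarrow> i = j"
  proof (cases "i = 0")
    case True
    have "intersection_form r (exceptional_class j) (simple_root 0) \<ge> 0"
      using assms by (simp add: intersection_simple_root_0 exceptional_class_def)
    then show ?thesis using True assms by auto
  next
    case False
    then show ?thesis using assms by (auto simp: intersection_simple_root exceptional_class_def)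
  qed
  then show ?thesis
    using line assms(3) exceptional_minus_simple_root(1)[of j]
    by (auto simp: root_group_element_apply[OF root])
qed

lemma raise_chain_end:
  assumes "3 \<le> r" "i < r"
  shows "root_group_element r (simple_root i) 1 x (partner ruling (exceptional_class 2)) =
    x (partner ruling (exceptional_class 2)) + (if i = 0 then x (exceptional_class 3) else 0)"
proof -
  let ?m = "partner ruling (exceptional_class 2)"
  have root: "root r (simple_root i)" using assms root_simple_root by simp
  have line: "?m \<in> lines r" using assms by (intro partner_ruling_line) auto
  have m: "?m j = (if j = 0 then 1 else if j = 1 \<or> j = 2 then - 1 else 0)" for j
    by (auto simp: partner_def ruling_def exceptional_class_def)
  have "intersection_form r ?m (simple_root i) = - 1 \<longleftrightarrow> i = 0"
  proof (cases "i = 0")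
    case True
    then show ?thesis using assms by (simp add: intersection_simple_root_0 m)
  next
    case False
    then show ?thesis using assms by (auto simp: intersection_simple_root m)
  qed
  moreover have "(\<lambda>j. ?m j - simple_root 0 j) = exceptional_class 3"
    unfolding m simple_root_0_explicit by (auto simp: exceptional_class_def[of 3])
  ultimately show ?thesis
    using line by (auto simp: root_group_element_apply[OF root])
qed

text \<open>On the coordinates of \<open>E\<^sub>3, \<dots>, E\<^sub>r\<close> the group element is unipotent, hence invertible.\<close>

lemma raising_surjective:
  assumes "g \<in> raising r" "3 \<le> r"
  shows "\<exists>z. \<forall>x. (\<forall>j\<in>{3..r}. x (exceptional_class j) = z j) \<longrightarrow>
    (\<forall>j\<in>{3..r}. g x (exceptional_class j) = y j)"
  using assms(1)
proof (induction arbitrary: y rule: raising.induct)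
  case id
  show ?case by (rule exI[of _ y]) auto
next
  case (step g i)
  define y' where "y' j = (if j = i then y j - y (Suc j) else y j)" for j
  obtain z where z: "\<And>x. \<forall>j\<in>{3..r}. x (exceptional_class j) = z j \<Longrightarrow>
      \<forall>j\<in>{3..r}. g x (exceptional_class j) = y' j"
    using step.IH[of y'] by blast
  show ?case
  proof (intro exI[of _ z] allI impI ballI)
    fix x j assume x: "\<forall>j\<in>{3..r}. x (exceptional_class j) = z j" and j: "j \<in> {3..r}"
    have "g x (exceptional_class k) = y' k" if "k \<in> {3..r}" for k
      using z[OF x] that by blast
    then show "(root_group_element r (simple_root i) 1 \<circ> g) x (exceptional_class j) = y j"
      using raise_exceptional[OF assms(2) step.hyps(2), of j "g x"] j step.hyps(2)
      by (auto simp: y'_def)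
  qed
qed

lemma raising_chain_zero:
  assumes "g \<in> raising r" "3 \<le> r" "\<And>l. l \<in> chain r \<Longrightarrow> x l = 0" "l \<in> chain r"
  shows "g x l = 0"
  using assms(1,4)
proof (induction arbitrary: l rule: raising.induct)
  case id
  then show ?case using assms(3) by simp
next
  case (step g i)
  have E: "g x (exceptional_class j) = 0" if "j \<in> {3..r}" for j
    using step.IH that by (simp add: chain_def)
  have m: "g x (partner ruling (exceptional_class 2)) = 0"
    using step.IH by (simp add: chain_def)
  from step.prems consider "l = partner ruling (exceptional_class 2)"
    | j where "j \<in> {3..r}" "l = exceptional_class j" by (auto simp: chain_def)
  then show ?case
  proof cases
    case 1
    then show ?thesis
      using raise_chain_end[OF assms(2) step.hyps(2), of "g x"] m E[of 3] assms(2) by simp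
  next
    case 2
    then show ?thesis
      using raise_exceptional[OF assms(2) step.hyps(2), of j "g x"] E[of j] E[of "Suc j"] step.hyps(2) by auto
  qed
qed

definition nonneg_vec :: "weight_vec \<Rightarrow> bool" where
  "nonneg_vec x \<longleftrightarrow> (\<exists>f :: pic \<Rightarrow> real. (\<forall>l. f l \<ge> 0) \<and> x = (\<lambda>l. of_real (f l)))"

lemma raise_nonneg:
  assumes "nonneg_vec x"
  shows "nonneg_vec (root_group_element r \<alpha> 1 x)"
    and "x l \<noteq> 0 \<Longrightarrow> root_group_element r \<alpha> 1 x l \<noteq> 0"
    and "x (\<lambda>j. l j - \<alpha> j) \<noteq> 0 \<Longrightarrow> l \<in> lines r \<Longrightarrow> (\<lambda>j. l j - \<alpha> j) \<in> lines r \<Longrightarrow>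
      root_group_element r \<alpha> 1 x l \<noteq> 0"
proof -
  obtain f where f: "\<And>l. f l \<ge> 0" "x = (\<lambda>l. of_real (f l))"
    using assms by (auto simp: nonneg_vec_def)
  define h where "h l = f l + (if l \<in> lines r \<and> (\<lambda>j. l j - \<alpha> j) \<in> lines r then f (\<lambda>j. l j - \<alpha> j) else 0)" for l
  have h: "root_group_element r \<alpha> 1 x = (\<lambda>l. of_real (h l))"
    by (auto simp: root_group_element_def root_operator_def h_def f(2))
  show "nonneg_vec (root_group_element r \<alpha> 1 x)"
    unfolding nonneg_vec_def using h f(1) by (intro exI[of _ h]) (auto simp: h_def)
  show "root_group_element r \<alpha> 1 x l \<noteq> 0" if "x l \<noteq> 0"
    using that f(1)[of l] f(1)[of "\<lambda>j. l j - \<alpha> j"] unfolding h by (auto simp: f(2) h_def simp del: of_real_add)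
  show "root_group_element r \<alpha> 1 x l \<noteq> 0"
    if "x (\<lambda>j. l j - \<alpha> j) \<noteq> 0" "l \<in> lines r" "(\<lambda>j. l j - \<alpha> j) \<in> lines r"
    using that f(1)[of l] f(1)[of "\<lambda>j. l j - \<alpha> j"] unfolding h by (auto simp: f(2) h_def simp del: of_real_add)
qed

lemma raising_nonneg:
  assumes "g \<in> raising r" "nonneg_vec x"
  shows "nonneg_vec (g x) \<and> (\<forall>l. x l \<noteq> 0 \<longrightarrow> g x l \<noteq> 0)"
  using assms by (induction rule: raising.induct) (auto simp: raise_nonneg)

text \<open>Outside the chain, \<open>E\<^sub>2\<close> is the only lowest weight: every other line can be lowered by a simple root without
  entering the chain.  Where the coefficients of the \<open>E\<^sub>i\<close> decrease, \<open>E\<^sub>i - E\<^sub>i\<^sub>+\<^sub>1\<close> can be subtracted;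
  if they increase throughout, \<open>H - E\<^sub>1 - E\<^sub>2 - E\<^sub>3\<close> can.\<close>

lemma line_predecessor:
  assumes "l \<in> lines r" "4 \<le> r" "r \<le> 7" "l \<notin> chain r" "l \<noteq> exceptional_class 2"
  shows "\<exists>i<r. intersection_form r l (simple_root i) = - 1 \<and> (\<lambda>j. l j - simple_root i j) \<notin> chain r"
proof -
  note eq = line_equations[OF assms(1,3)]
  obtain b where b: "\<And>i. 1 \<le> i \<Longrightarrow> i \<le> 7 \<Longrightarrow> l i = b \<or> l i = b + 1"
    "l 0 = 0 \<and> b = 0 \<or> l 0 = 1 \<and> b = - 1 \<or> l 0 = 2 \<and> b = - 1 \<or> l 0 = 3 \<and> b = - 2"
    using line_coefficients[OF assms(1,3)] by blast
  have E2: "l 0 \<noteq> 0 \<or> l = exceptional_class 1"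
  proof (cases "l 0 = 0")
    case True
    have "(\<Sum>i=1..7. (l i)\<^sup>2) = 1"
      using eq(2) True by (simp add: sum_1_7 del: One_nat_def)
    then obtain k where k: "k \<in> {1..7}" "l k = 1 \<or> l k = - 1" "\<And>i. i \<in> {1..7} \<Longrightarrow> i \<noteq> k \<Longrightarrow> l i = 0"
      by (rule sum_power2_eq_1[rotated]) auto
    have lk: "l k = 1" using k(1,2) b(1)[of k] b(2) True by auto
    then have kr: "k \<le> r" using eq(1) by (auto simp: pic_lattice_def not_less[symmetric])
    have "l = exceptional_class k"
    proof
      fix i :: nat
      have "i = 0 \<or> i \<in> {1..7} \<or> i > 7" by auto
      then show "l i = exceptional_class k i"
        using True lk k(1,3) eq(1) assms(3) by (auto simp: exceptional_class_def pic_lattice_def)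
    qed
    then show ?thesis
      using assms(4,5) k(1) kr by (cases "k = 1"; cases "k = 2") (auto simp: chain_def)
  qed simp
  show ?thesis
  proof (cases "l 0 = 0")
    case True
    then have "l = exceptional_class 1" using E2 by simp
    moreover have "(\<lambda>j. exceptional_class 1 j - simple_root 1 j) = exceptional_class 2"
      using exceptional_minus_simple_root(1)[of 1] by (simp add: numeral_2_eq_2)
    moreover have "exceptional_class 2 \<notin> chain r"
    proof
      assume "exceptional_class 2 \<in> chain r"
      then have "exceptional_class 2 = partner ruling (exceptional_class 2)"
        by (auto simp: chain_def exceptional_class_inj)
      then have "exceptional_class 2 0 = partner ruling (exceptional_class 2) 0" by simp
      then show False by (simp add: partner_def ruling_def exceptional_class_def)
    qed
    moreover have "intersection_form r (exceptional_class 1) (simple_root 1) = - 1"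
      using assms(2) by (simp add: intersection_simple_root exceptional_class_def)
    ultimately show ?thesis using assms(2) by (intro exI[of _ 1]) auto
  next
    case False
    have chain_0: "v \<notin> chain r" if "v 0 \<noteq> 0" "v \<noteq> partner ruling (exceptional_class 2)" for v
      using that by (auto simp: chain_def exceptional_class_def)
    show ?thesis
    proof (cases "\<exists>i. 0 < i \<and> i < r \<and> l (Suc i) < l i")
      case True
      then obtain i where i: "0 < i" "i < r" "l (Suc i) < l i" by blast
      then have "l (Suc i) = l i - 1"
        using b(1)[of i] b(1)[of "Suc i"] assms(3) by auto
      then have int: "intersection_form r l (simple_root i) = - 1"
        using i by (simp add: intersection_simple_root)
      show ?thesis
      proof (cases "(\<lambda>j. l j - simple_root i j) = partner ruling (exceptional_class 2)")
        case False
        then show ?thesis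
          using int i \<open>l 0 \<noteq> 0\<close> by (intro exI[of _ i] conjI chain_0) (auto simp: simple_root_explicit)
      next
        case True
        \<comment> \<open>Here \<open>l\<close> is \<open>H - E\<^sub>1 - E\<^sub>3\<close>, which is also above \<open>E\<^sub>2\<close>.\<close>
        have lj: "l j = partner ruling (exceptional_class 2) j + simple_root i j" for j
          using fun_cong[OF True, of j] by simp
        have m: "partner ruling (exceptional_class 2) j = (if j = 0 then 1 else if j = 1 \<or> j = 2 then - 1 else 0)" for j
          by (auto simp: partner_def ruling_def exceptional_class_def)
        have "i = 2"
        proof (rule ccontr)
          assume "i \<noteq> 2"
          then show False
            using i(1,2) \<open>l (Suc i) = l i - 1\<close> unfolding lj m
            by (auto simp: simple_root_explicit split: if_splits)
        qed
        then have l: "l j = (if j = 0 then 1 else if j = 1 \<or> j = 3 then - 1 else 0)" for j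
          unfolding lj m by (auto simp: simple_root_explicit)
        have "(\<lambda>j. l j - simple_root 0 j) = exceptional_class 2"
          by (auto simp: l simple_root_0_explicit exceptional_class_def)
        moreover have "exceptional_class 2 \<notin> chain r"
        proof
          assume "exceptional_class 2 \<in> chain r"
          then have "exceptional_class 2 = partner ruling (exceptional_class 2)"
            by (auto simp: chain_def exceptional_class_inj)
          then have "exceptional_class 2 0 = partner ruling (exceptional_class 2) 0" by simp
          then show False by (simp add: partner_def ruling_def exceptional_class_def)
        qed
        moreover have "intersection_form r l (simple_root 0) = - 1"
          using assms(2) by (simp add: intersection_simple_root_0 l)
        ultimately show ?thesis using assms(2) by (intro exI[of _ 0]) auto
      qed
    next
      case F2: False
      have mono: "l i \<le> l j" if "1 \<le> i" "i \<le> j" "j \<le> r" for i j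
        using that(2,1,3)
      proof (induction j rule: dec_induct)
        case (step j)
        have "0 < j \<and> j < r" using step.hyps step.prems by linarith
        then have "l j \<le> l (Suc j)" using F2 not_less by blast
        then show ?case using step by simp
      qed simp
      have le: "b \<le> l i" "l i \<le> b + 1" if "1 \<le> i" "i \<le> 7" for i
        using b(1)[OF that] by linarith+
      then have le7: "b \<le> l 1" "b \<le> l 2" "b \<le> l 3" "b \<le> l 4" "b \<le> l 5" "b \<le> l 6" "b \<le> l 7"
        "l 1 \<le> b + 1" "l 2 \<le> b + 1" "l 3 \<le> b + 1" "l 4 \<le> b + 1" "l 5 \<le> b + 1" "l 6 \<le> b + 1" "l 7 \<le> b + 1"
        by simp_all
      have m4: "l 1 \<le> l 2" "l 2 \<le> l 3" "l 3 \<le> l 4" using mono assms(2) by auto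
      have tail: "l 4 \<le> l i \<or> l i = 0" if "4 \<le> i" for i
        using mono[of 4 i] that eq(1) assms(2) by (cases "i \<le> r") (auto simp: pic_lattice_def)
      have notm: "l \<noteq> partner ruling (exceptional_class 2)"
        using assms(4) by (auto simp: chain_def)
      have "l 0 \<noteq> 1"
      proof
        assume l0: "l 0 = 1"
        then have "b = - 1" using b(2) by auto
        then have t: "l 4 \<le> l 5" "l 4 \<le> l 6" "l 4 \<le> l 7"
          using tail[of 5] tail[of 6] tail[of 7] le7 by auto
        have "l 3 = 0" using l0 \<open>b = - 1\<close> b(1)[of 3] m4 t le7 eq(3) by linarith
        then have "l 4 = 0" "l 5 = 0" "l 6 = 0" "l 7 = 0" using m4 t le7 \<open>b = - 1\<close> by linarith+
        then have "l 1 = - 1" "l 2 = - 1" using l0 eq(3) le7 \<open>l 3 = 0\<close> \<open>b = - 1\<close> by linarith+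
        then have "l = partner ruling (exceptional_class 2)"
          using l0 \<open>l 3 = 0\<close> \<open>l 4 = 0\<close> \<open>l 5 = 0\<close> \<open>l 6 = 0\<close> \<open>l 7 = 0\<close> eq(1) assms(2,3)
          by (intro pic_eqI[of l r]) (auto simp: partner_def ruling_def exceptional_class_def pic_lattice_def)
        then show False using notm by simp
      qed
      then have l0: "l 0 = 2 \<and> b = - 1 \<or> l 0 = 3 \<and> b = - 2" using False b(2) by auto
      then have t: "l 4 \<le> l 5" "l 4 \<le> l 6" "l 4 \<le> l 7"
        using tail[of 5] tail[of 6] tail[of 7] le7 by auto
      have "l 0 + l 1 + l 2 + l 3 = - 1"
      proof -
        have "l 0 + l 1 + l 2 + l 3 < 0"
        proof (rule ccontr)
          assume "\<not> ?thesis"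
          moreover have "l 3 = b \<or> l 3 = b + 1" using b(1)[of 3] by simp
          ultimately show False using l0 le7 m4 t eq(3) by (elim disjE conjE) linarith+
        qed
        moreover have "intersection_form r l (simple_root 0) \<in> {- 1, 0, 1}"
          using assms by (intro line_simple_root_bound) auto
        ultimately show ?thesis using assms(2) by (auto simp: intersection_simple_root_0)
      qed
      then have "intersection_form r l (simple_root 0) = - 1"
        using assms(2) by (simp add: intersection_simple_root_0)
      moreover have "(\<lambda>j. l j - simple_root 0 j) \<notin> chain r"
      proof (rule chain_0)
        show "l 0 - simple_root 0 0 \<noteq> 0" using l0 by (auto simp: simple_root_0_explicit)
        show "(\<lambda>j. l j - simple_root 0 j) \<noteq> partner ruling (exceptional_class 2)"
        proof
          assume "(\<lambda>j. l j - simple_root 0 j) = partner ruling (exceptional_class 2)"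
          then have "l j = partner ruling (exceptional_class 2) j + simple_root 0 j" for j
            by (metis diff_add_cancel)
          then have "l 0 = 2" "l 1 = - 2"
            by (simp_all add: partner_def ruling_def exceptional_class_def simple_root_0_explicit)
          then show False using l0 le7 by auto
        qed
      qed
      ultimately show ?thesis using assms(2) by (intro exI[of _ 0]) auto
    qed
  qed
qed

text \<open>Going down to \<open>E\<^sub>2\<close> and applying the raising elements of the way back makes the coordinate of \<open>l\<close> positive.\<close>

lemma line_reachable:
  assumes "l \<in> lines r" "4 \<le> r" "r \<le> 7" "l \<notin> chain r"
  shows "\<exists>g\<in>raising r. \<forall>x. nonneg_vec x \<longrightarrow> x (exceptional_class 2) \<noteq> 0 \<longrightarrow> g x l \<noteq> 0"
  using assms(1,4)
\<comment> \<open>The same height function as for conic classes: it is 1 on every simple root.\<close>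
proof (induction "nat (1000 + 19 * l 0 + 7 * l 1 + 6 * l 2 + 5 * l 3 + 4 * l 4 + 3 * l 5 + 2 * l 6 + l 7)"
    arbitrary: l rule: less_induct)
  case less
  show ?case
  proof (cases "l = exceptional_class 2")
    case True
    then show ?thesis by (intro bexI[of _ id] raising.id) auto
  next
    case False
    obtain i where i: "i < r" "intersection_form r l (simple_root i) = - 1"
      "(\<lambda>j. l j - simple_root i j) \<notin> chain r"
      using line_predecessor[OF less.prems(1) assms(2,3) less.prems(2) False] by blast
    let ?l = "\<lambda>j. l j - simple_root i j"
    have root: "root r (simple_root i)" using i(1) assms(2) by (intro root_simple_root) auto
    have line: "?l \<in> lines r" using line_minus_root[OF root less.prems(1)] i(2) by simp
    have "19 * simple_root i 0 + 7 * simple_root i 1 + 6 * simple_root i 2 + 5 * simple_root i 3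
        + 4 * simple_root i 4 + 3 * simple_root i 5 + 2 * simple_root i 6 + simple_root i 7 = 1"
    proof -
      have "i \<in> {0, 1, 2, 3, 4, 5, 6}" using i(1) assms(3) by auto
      then show ?thesis by (auto simp: simple_root_0_explicit simple_root_explicit)
    qed
    moreover have "1000 + 19 * l 0 + 7 * l 1 + 6 * l 2 + 5 * l 3 + 4 * l 4 + 3 * l 5 + 2 * l 6 + l 7 > 0"
      using line_coefficient_bound[OF less.prems(1) assms(3)] by (smt (verit))
    ultimately have "\<exists>g\<in>raising r. \<forall>x. nonneg_vec x \<longrightarrow> x (exceptional_class 2) \<noteq> 0 \<longrightarrow> g x ?l \<noteq> 0"
      using line i(3) by (intro less.hyps) auto
    then obtain g where g: "g \<in> raising r" "\<And>x. nonneg_vec x \<Longrightarrow> x (exceptional_class 2) \<noteq> 0 \<Longrightarrow> g x ?l \<noteq> 0"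
      by blast
    show ?thesis
    proof (intro bexI[of _ "root_group_element r (simple_root i) 1 \<circ> g"] allI impI)
      fix x assume x: "nonneg_vec x" "x (exceptional_class 2) \<noteq> 0"
      have "nonneg_vec (g x)" using raising_nonneg[OF g(1) x(1)] by blast
      from raise_nonneg(3)[OF this g(2)[OF x] less.prems(1) line]
      show "(root_group_element r (simple_root i) 1 \<circ> g) x l \<noteq> 0" by simp
    qed (use g(1) i(1) in \<open>auto intro: raising.step\<close>)
  qed
qed

text \<open>Positive coordinates stay positive, so the raising elements for the individual lines can be composed.\<close>

lemma raising_generic:
  assumes "4 \<le> r" "r \<le> 7"
  shows "\<exists>g\<in>raising r. \<forall>l\<in>lines r - chain r. g (weight_vector (exceptional_class 2)) l \<noteq> 0"
proof -
  let ?e = "weight_vector (exceptional_class 2)"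
  have e: "nonneg_vec ?e" "?e (exceptional_class 2) \<noteq> 0"
    by (auto simp: nonneg_vec_def weight_vector_def intro!: exI[of _ "\<lambda>l. if l = exceptional_class 2 then 1 else 0"])
  have "\<exists>g\<in>raising r. \<forall>l\<in>T. g ?e l \<noteq> 0" if "finite T" "T \<subseteq> lines r - chain r" for T
    using that
  proof (induction T rule: finite_induct)
    case empty
    show ?case by (intro bexI[of _ id] raising.id) auto
  next
    case (insert l T)
    then obtain g where g: "g \<in> raising r" "\<forall>l\<in>T. g ?e l \<noteq> 0" by blast
    obtain h where h: "h \<in> raising r" "\<And>x. nonneg_vec x \<Longrightarrow> x (exceptional_class 2) \<noteq> 0 \<Longrightarrow> h x l \<noteq> 0"
      using line_reachable[of l r] insert.prems assms by blast
    note gn = raising_nonneg[OF g(1) e(1)]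
    note hn = raising_nonneg[OF h(1) conjunct1[OF gn]]
    show ?case
      using g h(2)[of "g ?e"] gn hn e(2) by (intro bexI[of _ "h \<circ> g"] raising_comp h(1) g(1)) auto
  qed
  from this[of "lines r - chain r"] show ?thesis using finite_lines[OF assms(2)] by simp
qed

text \<open>One line \<open>x\<close> of the chain is exempt.  The remaining equations leave at most one unknown coefficient beyond \<open>c\<^sub>0\<close>, \<open>c\<^sub>1\<close>,
  \<open>c\<^sub>2\<close>, and the comparison of \<open>(c\<^sub>1 + c\<^sub>2)\<^sup>2\<close> with \<open>2 (c\<^sub>1\<^sup>2 + c\<^sub>2\<^sup>2)\<close> forces \<open>c\<^sub>0 = 1\<close>.  The second solution is \<open>H - E\<^sub>2\<close>.\<close>

lemma conic_orthogonal_to_chain: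
  assumes c: "c \<in> conics r" and r: "4 \<le> r" "r \<le> 7"
    and orth: "\<forall>l\<in>chain r - {x}. intersection_form r c l = 0"
  shows "c = ruling \<or> c = reflection r (simple_root 1) ruling"
proof -
  note eq = conic_equations[OF c r(2)] and bd = conic_degree_bounds[OF c r(2)]
  have E: "intersection_form r c (exceptional_class j) = - c j" if "j \<in> {3..r}" for j
    using that by (intro intersection_exceptional_class) auto
  have m: "intersection_form r c (partner ruling (exceptional_class 2)) = c 0 + c 1 + c 2"
    using r intersection_exceptional_class[of 2 r c] by (simp add: partner_def intersection_form_diff intersection_ruling)
  have zero: "c j = 0" if "j \<ge> 3" "x \<noteq> exceptional_class j" for j
    using that orth E[of j] eq(1) by (cases "j \<le> r") (auto simp: chain_def pic_lattice_def)
  have sq2: "2 * ((c 1)\<^sup>2 + (c 2)\<^sup>2) = (c 1 + c 2)\<^sup>2 + (c 1 - c 2)\<^sup>2"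
    by (simp add: power2_eq_square algebra_simps)
  have all_zero: "\<forall>j\<ge>3. c j = 0"
  proof (rule ccontr)
    assume "\<not> ?thesis"
    then obtain k where k: "k \<ge> 3" "c k \<noteq> 0" by auto
    then have x: "x = exceptional_class k" using zero by blast
    have z: "c j = 0" if "j \<ge> 3" "j \<noteq> k" for j
      using zero[OF that(1)] that(2) x by (simp add: exceptional_class_inj)
    have k7: "k \<in> {3, 4, 5, 6, 7}"
    proof -
      have "k \<le> r" using k(2) eq(1) by (auto simp: pic_lattice_def not_less[symmetric])
      then show ?thesis using k(1) r(2) by auto
    qed
    have "partner ruling (exceptional_class 2) \<noteq> x"
    proof
      assume "partner ruling (exceptional_class 2) = x"
      then have "partner ruling (exceptional_class 2) 0 = exceptional_class k 0" using x by simp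
      then show False using k(1) by (simp add: partner_def ruling_def exceptional_class_def)
    qed
    then have c12: "c 1 + c 2 = - c 0" using orth m by (simp add: chain_def)
    have "c 3 + c 4 + c 5 + c 6 + c 7 = c k" "(c 3)\<^sup>2 + (c 4)\<^sup>2 + (c 5)\<^sup>2 + (c 6)\<^sup>2 + (c 7)\<^sup>2 = (c k)\<^sup>2"
      using k7 z by auto
    then have ck: "c k = 2 - 2 * c 0" "(c 0)\<^sup>2 = (c 1)\<^sup>2 + (c 2)\<^sup>2 + (c k)\<^sup>2"
      using eq(2,3) c12 by linarith+
    have "2 * (c 0)\<^sup>2 = (c 0)\<^sup>2 + (c 1 - c 2)\<^sup>2 + 2 * (2 - 2 * c 0)\<^sup>2"
      using ck sq2 c12 by simp
    then have "(c 0)\<^sup>2 \<ge> 2 * (2 - 2 * c 0)\<^sup>2" by simp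
    moreover have "c 0 \<in> {1, 2, 3, 4, 5}" using bd by auto
    ultimately have "c 0 = 1" by auto
    then show False using ck(1) k(2) by simp
  qed
  then have z: "c 3 = 0" "c 4 = 0" "c 5 = 0" "c 6 = 0" "c 7 = 0" by auto
  then have sum: "c 1 + c 2 = 2 - 3 * c 0" and sq: "(c 0)\<^sup>2 = (c 1)\<^sup>2 + (c 2)\<^sup>2" using eq by auto
  have "2 * (c 0)\<^sup>2 \<ge> (2 - 3 * c 0)\<^sup>2" using sq2 sq sum by simp
  moreover have "c 0 \<in> {1, 2, 3, 4, 5}" using bd by auto
  ultimately have c0: "c 0 = 1" by auto
  have "(c 1 - c 2)\<^sup>2 = 1" using sq2 sq sum c0 by simp
  then have "c 1 - c 2 = 1 \<or> c 1 - c 2 = - 1" by (simp add: power2_eq_1_iff)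
  then have "c 1 = 0 \<and> c 2 = - 1 \<or> c 1 = - 1 \<and> c 2 = 0" using sum c0 by linarith
  moreover have ref: "reflection r (simple_root 1) ruling j = (if j = 0 then 1 else if j = 2 then - 1 else 0)" for j
    using r(1) by (simp add: reflection_def intersection_simple_root simple_root_explicit ruling_def)
  moreover have "c \<in> pic_lattice r" "ruling \<in> pic_lattice r" "reflection r (simple_root 1) ruling \<in> pic_lattice r"
    using eq(1) r(1) ref by (auto simp: pic_lattice_def ruling_def)
  ultimately show ?thesis
    using z c0 r(2) by (elim disjE; intro disjI1 disjI2 pic_eqI[of c r]) (auto simp: ruling_def)
qed

section \<open>Linear relations between the oriented determinants\<close>

text \<open>The functions on lines that turn \<open>pairdet\<close> into \<open>U\<^sub>F\<^sup>*(\<Omega>\<^sub>r)\<close> at the point \<open>x\<close> and the tangent vectors \<open>\<xi>\<close>.\<close>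

definition log_data :: "weight_vec \<Rightarrow> (nat \<Rightarrow> weight_vec) \<Rightarrow> nat \<Rightarrow> pic \<Rightarrow> complex" where
  "log_data x \<xi> k l = (if k = 0 then of_real (ln (cmod (x l))) else \<xi> (k - 1) l / x l)"

text \<open>Translates of the exceptional span lie on the cone, so on them the bilinear form of each quadric vanishes.  In
  particular their vectors are tangent to the quadric at each other.\<close>

lemma quadric_polarization:
  fixes s :: "nat \<Rightarrow> complex"
  assumes quadric: "\<And>x. x \<in> minuscule_cone r \<Longrightarrow> (\<Sum>j<n. s j * x (a j) * x (b j)) = 0"
    and r: "3 \<le> r" and g: "g \<in> G_group r" and p: "p \<in> exceptional_span r" "p' \<in> exceptional_span r"
  shows "(\<Sum>j<n. s j * (g p (a j) * g p' (b j) + g p' (a j) * g p (b j))) = 0"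
proof -
  have q0: "(\<Sum>j<n. s j * g q (a j) * g q (b j)) = 0" if "q \<in> exceptional_span r" for q
  proof (cases "q = (\<lambda>_. 0)")
    case True
    then show ?thesis by (simp add: G_group_zero[OF g])
  next
    case False
    then show ?thesis
      using quadric[OF minuscule_cone_G_group[OF g exceptional_span_cone[OF r that]]] by simp
  qed
  have add: "g (\<lambda>l. p l + 1 * p' l) = (\<lambda>l. g p l + 1 * g p' l)"
    by (rule G_group_linear[OF g])
  have "(\<Sum>j<n. s j * (g p (a j) * g p' (b j) + g p' (a j) * g p (b j))) =
    (\<Sum>j<n. s j * (g p (a j) + g p' (a j)) * (g p (b j) + g p' (b j))
      - s j * g p (a j) * g p (b j) - s j * g p' (a j) * g p' (b j))"
    by (intro sum.cong) (auto simp: algebra_simps)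
  also have "\<dots> = 0"
    using q0[OF exceptional_span_closed[OF p, of 1]] q0[OF p(1)] q0[OF p(2)]
    unfolding add by (simp add: sum_subtractf)
  finally show ?thesis .
qed

locale quadric_frames = framed_conics +
  fixes s :: "pic \<Rightarrow> nat \<Rightarrow> complex"
  assumes sign: "\<And>c j. c \<in> conics r \<Longrightarrow> j < r - 1 \<Longrightarrow> s c j = 1 \<or> s c j = - 1"
    and quadric: "\<And>c x. c \<in> conics r \<Longrightarrow> x \<in> minuscule_cone r \<Longrightarrow>
      (\<Sum>j<r - 1. s c j * x (A c j) * x (partner c (A c j))) = 0"
begin

text \<open>The relations \<open>\<Sum>\<^sub>F \<kappa>\<^sub>F o\<^sub>F U\<^sub>F\<^sup>*(\<Omega>\<^sub>r) = 0\<close>, with \<open>o\<^sub>F\<close> the orientation, at points and on tangent vectors taken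
  from one translate of the exceptional span.  Contrary to relations on the affine space of a chart, they are
  permuted by the Weyl group.\<close>

definition lin_rel :: "(pic \<Rightarrow> complex) \<Rightarrow> bool" where
  "lin_rel \<kappa> \<longleftrightarrow> (\<forall>g\<in>G_group r. \<forall>p\<in>exceptional_span r. \<forall>\<zeta>::nat \<Rightarrow> weight_vec. (\<forall>k. \<zeta> k \<in> exceptional_span r) \<longrightarrow>
     (\<forall>l\<in>lines r. g p l \<noteq> 0) \<longrightarrow>
     (\<Sum>c\<in>conics r. \<kappa> c * oriented_det r c (A c) (log_data (g p) (\<lambda>k. g (\<zeta> k)))) = 0)"

lemma lin_relD:
  assumes "lin_rel \<kappa>" "g \<in> G_group r" "p \<in> exceptional_span r" "\<And>k. \<zeta> k \<in> exceptional_span r"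
    "\<And>l. l \<in> lines r \<Longrightarrow> g p l \<noteq> 0"
  shows "(\<Sum>c\<in>conics r. \<kappa> c * oriented_det r c (A c) (log_data (g p) (\<lambda>k. g (\<zeta> k)))) = 0"
  using assms unfolding lin_rel_def by blast

lemma lin_rel_subtract_const:
  assumes "lin_rel \<kappa>"
  shows "lin_rel (\<lambda>c. \<kappa> c - a)"
  unfolding lin_rel_def
proof (intro ballI allI impI)
  fix g p and \<zeta> :: "nat \<Rightarrow> weight_vec"
  assume *: "g \<in> G_group r" "p \<in> exceptional_span r" "\<forall>k. \<zeta> k \<in> exceptional_span r" "\<forall>l\<in>lines r. g p l \<noteq> 0"
  let ?D = "\<lambda>c. oriented_det r c (A c) (log_data (g p) (\<lambda>k. g (\<zeta> k)))"
  have "(\<Sum>c\<in>conics r. (\<kappa> c - a) * ?D c) = (\<Sum>c\<in>conics r. \<kappa> c * ?D c) - a * hlog_sum (log_data (g p) (\<lambda>k. g (\<zeta> k)))"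
    by (simp add: hlog_sum_def algebra_simps sum_subtractf sum_distrib_left)
  also have "\<dots> = 0"
    using lin_relD[OF assms *(1,2)] *(3,4) by (simp add: hlog_sum_eq_0)
  finally show "(\<Sum>c\<in>conics r. (\<kappa> c - a) * ?D c) = 0" .
qed

text \<open>The Weyl group representative permutes the coordinates up to signs, which neither \<open>ln \<bar>x\<^sub>l\<bar>\<close> nor the logarithmic
  derivatives detect.\<close>

lemma lin_rel_reflection:
  assumes "lin_rel \<kappa>" "i < r"
  shows "lin_rel (\<lambda>c. \<kappa> (reflection r (simple_root i) c))"
  unfolding lin_rel_def
proof (intro ballI allI impI)
  fix g p and \<zeta> :: "nat \<Rightarrow> weight_vec"
  assume g: "g \<in> G_group r" and p: "p \<in> exceptional_span r" and z: "\<forall>k. \<zeta> k \<in> exceptional_span r"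
    and nz: "\<forall>l\<in>lines r. g p l \<noteq> 0"
  let ?s = "reflection r (simple_root i)" and ?w = "weyl_element r i"
  have root: "root r (simple_root i)" using simple_root[OF assms(2)] .
  let ?\<eta> = "\<lambda>l. if intersection_form r l (simple_root i) = 1 then - 1 else 1 :: complex"
  have w: "?w x l = ?\<eta> l * x (?s l)" if "l \<in> lines r" for x l
    using weyl_element_apply[OF that _ _ assms(2)] r by simp
  have wg: "?w \<circ> g \<in> G_group r" by (intro G_group_comp weyl_element_G_group assms(2) g)
  have nz': "(?w \<circ> g) p l \<noteq> 0" if "l \<in> lines r" for l
    using nz reflection_lines[OF root that] by (simp add: w that)
  have "(\<Sum>c\<in>conics r. \<kappa> c * oriented_det r c (A c) (log_data ((?w \<circ> g) p) (\<lambda>k. (?w \<circ> g) (\<zeta> k)))) = 0"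
    using z nz' by (intro lin_relD[OF assms(1) wg p]) auto
  moreover have "oriented_det r c (A c) (log_data ((?w \<circ> g) p) (\<lambda>k. (?w \<circ> g) (\<zeta> k))) =
      - oriented_det r (?s c) (A (?s c)) (log_data (g p) (\<lambda>k. g (\<zeta> k)))" if c: "c \<in> conics r" for c
  proof -
    have "pairdet r c (A c) (log_data ((?w \<circ> g) p) (\<lambda>k. (?w \<circ> g) (\<zeta> k))) =
        pairdet r c (A c) (\<lambda>k l. log_data (g p) (\<lambda>k. g (\<zeta> k)) k (?s l))"
      by (rule pairdet_cong[OF frame[OF c]]) (simp add: log_data_def w norm_mult)
    then show ?thesis
      unfolding oriented_det_reflection_frame[OF root c] by (simp add: oriented_det_def)
  qed
  ultimately have "(\<Sum>c\<in>conics r. \<kappa> c * oriented_det r (?s c) (A (?s c)) (log_data (g p) (\<lambda>k. g (\<zeta> k)))) = 0"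
    by (simp add: sum_negf)
  moreover have "(\<Sum>c\<in>conics r. \<kappa> (?s c) * oriented_det r c (A c) (log_data (g p) (\<lambda>k. g (\<zeta> k)))) =
      (\<Sum>c\<in>conics r. \<kappa> (?s (?s c)) * oriented_det r (?s c) (A (?s c)) (log_data (g p) (\<lambda>k. g (\<zeta> k))))"
    by (rule sum.reindex_bij_betw[OF bij_reflection_conics[OF root], symmetric])
  ultimately show "(\<Sum>c\<in>conics r. \<kappa> (?s c) * oriented_det r c (A c) (log_data (g p) (\<lambda>k. g (\<zeta> k)))) = 0"
    by (simp add: reflection_involution[OF root])
qed

end

section \<open>A degeneration separating adjacent conic classes\<close>

text \<open>The vector \<open>u\<close> is orthogonal to all rows of the matrix except the row of \<open>G 0\<close>: to the ones because the \<open>u\<^sub>j\<close> lie on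
  the quadric, to the other rows because the vectors are tangent to it.\<close>

lemma pairdet_cramer:
  fixes u :: "nat \<Rightarrow> complex"
  assumes "2 \<le> r" "j\<^sub>0 < r - 1"
    and "(\<Sum>j<r - 1. u j) = 0"
    and "\<And>k. 1 \<le> k \<Longrightarrow> k < r - 2 \<Longrightarrow> (\<Sum>j<r - 1. u j * (G k (a j) + G k (partner c (a j)))) = 0"
  shows "u j\<^sub>0 * pairdet r c a G = (\<Sum>j<r - 1. u j * (G 0 (a j) + G 0 (partner c (a j)))) * ((- 1) ^ (1 + j\<^sub>0) *
     mdet (r - 2) (\<lambda>i j. if i = 0 then 1 else G i (a (if j < j\<^sub>0 then j else Suc j))
       + G i (partner c (a (if j < j\<^sub>0 then j else Suc j)))))"
proof -
  let ?f = "\<lambda>k j. if k = 0 then 1 else G (k - 1) (a j) + G (k - 1) (partner c (a j))"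
  have r: "r - 1 = Suc (r - 2)" using assms(1) by simp
  show ?thesis
  proof (cases "r = 2")
    case True
    then show ?thesis using assms(2,3) by (simp add: pairdet_def mdet_leibniz)
  next
    case False
    have "u j\<^sub>0 * mdet (Suc (r - 2)) ?f = (\<Sum>j<r - 1. u j * (G 0 (a j) + G 0 (partner c (a j)))) * ((- 1) ^ (1 + j\<^sub>0) *
        mdet (r - 2) (\<lambda>i j. ?f (if i < 1 then i else Suc i) (if j < j\<^sub>0 then j else Suc j)))"
    proof (rule mdet_cramer)
      show "1 < Suc (r - 2)" "j\<^sub>0 < Suc (r - 2)" using assms(1,2) False by auto
      fix i assume i: "i < Suc (r - 2)"
      consider "i = 0" | "i = 1" | "2 \<le> i" by linarith
      then show "(\<Sum>j<Suc (r - 2). ?f i j * u j) = (if i = 1 then \<Sum>j<r - 1. u j * (G 0 (a j) + G 0 (partner c (a j))) else 0)"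
        unfolding r[symmetric]
      proof cases
        case 3
        then show "(\<Sum>j<r - 1. ?f i j * u j) = (if i = 1 then \<Sum>j<r - 1. u j * (G 0 (a j) + G 0 (partner c (a j))) else 0)"
          using assms(4)[of "i - 1"] i by (auto simp: mult.commute)
      qed (use assms(3) in \<open>auto simp: mult.commute\<close>)
    qed
    also have "mdet (r - 2) (\<lambda>i j. ?f (if i < 1 then i else Suc i) (if j < j\<^sub>0 then j else Suc j)) =
        mdet (r - 2) (\<lambda>i j. if i = 0 then 1 else G i (a (if j < j\<^sub>0 then j else Suc j))
          + G i (partner c (a (if j < j\<^sub>0 then j else Suc j))))"
      by (rule mdet_cong) auto
    finally show ?thesis unfolding pairdet_def r .
  qed
qed

text \<open>At \<open>a = 0\<close> this is \<open>t ln t \<rightarrow> 0\<close>; the factor 0 in the limit makes it independent of the value of \<open>ln 0\<close>.\<close>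

lemma tendsto_mult_ln_cmod:
  assumes "(f \<longlongrightarrow> a) F"
  shows "((\<lambda>x. f x * of_real (ln (cmod (f x)))) \<longlongrightarrow> a * of_real (ln (cmod a))) F"
proof (cases "a = 0")
  case False
  then show ?thesis using assms by (intro tendsto_intros) auto
next
  case True
  have "isCont (\<lambda>z::complex. z * of_real (ln (cmod z))) 0"
  proof -
    have "((\<lambda>t::real. t * ln t) \<longlongrightarrow> 0) (at_right 0)" by real_asymp
    moreover have "filterlim (\<lambda>z::complex. cmod z) (at_right 0) (at 0)"
      by (auto simp: filterlim_at intro!: tendsto_eq_intros eventually_at_filter[THEN iffD2])
    ultimately have "((\<lambda>z::complex. cmod z * ln (cmod z)) \<longlongrightarrow> 0) (at 0)"
      by (rule filterlim_compose)
    then have "((\<lambda>z::complex. norm (z * of_real (ln (cmod z)))) \<longlongrightarrow> 0) (at 0)"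
      by (subst (asm) tendsto_norm_zero_iff[symmetric]) (simp add: norm_mult abs_mult)
    then show ?thesis unfolding isCont_def by (simp add: tendsto_norm_zero_iff)
  qed
  then show ?thesis
    using isCont_tendsto_compose[of a "\<lambda>z::complex. z * of_real (ln (cmod z))" f F] assms True by simp
qed

lemma conic_intersection_line:
  assumes "c \<in> conics r" "l \<in> lines r" "partner c l \<in> lines r"
  shows "intersection_form r c l = 0"
  using assms intersection_form_commute[of r l c]
  by (simp add: conics_def lines_def partner_def intersection_form_diff)

lemma card_chain:
  assumes "3 \<le> r"
  shows "finite (chain r)" "card (chain r) = r - 1"
proof -
  have "partner ruling (exceptional_class 2) \<noteq> exceptional_class j" if "j \<in> {3..r}" for j
  proof
    assume "partner ruling (exceptional_class 2) = exceptional_class j"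
    then have "partner ruling (exceptional_class 2) 0 = exceptional_class j 0" by simp
    then show False using that by (simp add: partner_def ruling_def exceptional_class_def)
  qed
  then have "partner ruling (exceptional_class 2) \<notin> exceptional_class ` {3..r}" by blast
  moreover have "card (exceptional_class ` {3..r}) = r - 2"
    by (subst card_image) (auto simp: inj_on_def exceptional_class_inj)
  ultimately show "finite (chain r)" "card (chain r) = r - 1"
    using assms by (auto simp: chain_def)
qed

text \<open>The chain consists of \<open>r - 1\<close> lines, and the lines of a pair of \<open>c\<close> are orthogonal to \<open>c\<close>.  If at most one of the
  \<open>r - 1\<close> pairs avoided the chain, then \<open>c\<close> would be orthogonal to all lines of the chain, or to all but one.\<close>

lemma two_columns_off_chain:
  assumes r: "4 \<le> r" "r \<le> 7" and c: "c \<in> conics r" "conic_frame r c a"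
    and ne: "c \<noteq> ruling" "c \<noteq> reflection r (simple_root 1) ruling"
  obtains j0 j1 where "j0 < r - 1" "j1 < r - 1" "j0 \<noteq> j1"
    "a j0 \<notin> chain r" "partner c (a j0) \<notin> chain r" "a j1 \<notin> chain r" "partner c (a j1) \<notin> chain r"
proof -
  define S where "S = {j. j < r - 1 \<and> (a j \<in> chain r \<or> partner c (a j) \<in> chain r)}"
  have fin: "finite S" "S \<subseteq> {..<r - 1}" by (auto simp: S_def)
  have "card S < r - 2"
  proof (rule ccontr)
    assume big: "\<not> card S < r - 2"
    define f where "f j = (if a j \<in> chain r then a j else partner c (a j))" for j
    have inj: "inj_on f S"
    proof (rule inj_onI)
      fix i j assume ij: "i \<in> S" "j \<in> S" "f i = f j"
      then have "a i = a j \<or> a i = partner c (a j)"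
        unfolding f_def by (metis partner_partner)
      then show "i = j" using ij conic_frame_inj[OF c(2)] by (auto simp: S_def)
    qed
    have sub: "f ` S \<subseteq> chain r" by (auto simp: S_def f_def)
    have orth: "intersection_form r c l = 0" if l: "l \<in> f ` S" for l
    proof -
      obtain j where j: "j < r - 1" "l = a j \<or> l = partner c (a j)" using l unfolding S_def f_def by fastforce
      then show ?thesis
        using conic_frame_lines[OF c(2) j(1)] by (intro conic_intersection_line[OF c(1)]) auto
    qed
    have "card (chain r - f ` S) = card (chain r) - card (f ` S)"
      using sub fin(1) by (intro card_Diff_subset) auto
    then have "card (chain r - f ` S) \<le> 1"
      using big card_chain[of r] r by (simp add: card_image[OF inj])
    moreover have "finite (chain r - f ` S)" using card_chain[of r] r by simp
    ultimately have "\<exists>x. chain r - f ` S \<subseteq> {x}"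
      by (metis card_0_eq card_1_singletonE empty_subsetI le_Suc_eq le_zero_eq One_nat_def order_refl)
    then obtain x where "chain r - f ` S \<subseteq> {x}" by blast
    then have "\<forall>l\<in>chain r - {x}. intersection_form r c l = 0" using orth by blast
    from conic_orthogonal_to_chain[OF c(1) r this] show False using ne by blast
  qed
  then have "2 \<le> card ({..<r - 1} - S)"
    using fin r by (simp add: card_Diff_subset)
  then obtain j0 j1 where "j0 \<in> {..<r - 1} - S" "j1 \<in> {..<r - 1} - S" "j0 \<noteq> j1"
    by (metis card_le_Suc0_iff_eq finite_Diff finite_lessThan not_less_eq_eq numeral_2_eq_2)
  then show ?thesis by (intro that[of j0 j1]) (auto simp: S_def)
qed

lemma tendsto_sum_mult_ln_cmod:
  assumes "\<And>j. j < n \<Longrightarrow> ((\<lambda>x. f x j) \<longlongrightarrow> a j) F"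
  shows "((\<lambda>x. \<Sum>j<n. f x j * of_real (ln (cmod (f x j)))) \<longlongrightarrow> (\<Sum>j<n. a j * of_real (ln (cmod (a j))))) F"
  using assms by (intro tendsto_sum tendsto_mult_ln_cmod) auto

context quadric_frames
begin

lemma ruling_conic': "ruling \<in> conics r"
  using r ruling_conic[of r] by simp

lemma ruling_quadric:
  obtains s' where "\<And>j. j < r - 1 \<Longrightarrow> s' j = 1 \<or> s' j = (- 1 :: complex)"
    and "\<And>x. x \<in> minuscule_cone r \<Longrightarrow>
      (\<Sum>j<r - 1. s' j * x (ruling_frame j) * x (partner ruling (ruling_frame j))) = 0"
proof -
  have cr: "conic_frame r ruling ruling_frame" using r by (intro conic_frame_ruling) simp
  obtain p where p: "p permutes {0..<r - 1}"
    "\<And>j. j < r - 1 \<Longrightarrow> ruling_frame j = A ruling (p j) \<or> ruling_frame j = partner ruling (A ruling (p j))"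
    using conic_frame_change[OF frame[OF ruling_conic'] cr] by blast
  show ?thesis
  proof (rule that[of "\<lambda>j. s ruling (p j)"])
    fix j assume "j < r - 1"
    then show "s ruling (p j) = 1 \<or> s ruling (p j) = - 1"
      using sign[OF ruling_conic'] permutes_in_image[OF p(1), of j] by auto
  next
    fix x assume x: "x \<in> minuscule_cone r"
    have "(\<Sum>j\<in>{0..<r - 1}. s ruling (p j) * x (ruling_frame j) * x (partner ruling (ruling_frame j))) =
        (\<Sum>j\<in>{0..<r - 1}. s ruling (p j) * x (A ruling (p j)) * x (partner ruling (A ruling (p j))))"
    proof (rule sum.cong)
      fix j assume "j \<in> {0..<r - 1}"
      then have "ruling_frame j = A ruling (p j) \<or> ruling_frame j = partner ruling (A ruling (p j))"
        using p(2) by simp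
      then show "s ruling (p j) * x (ruling_frame j) * x (partner ruling (ruling_frame j)) =
          s ruling (p j) * x (A ruling (p j)) * x (partner ruling (A ruling (p j)))"
        by (elim disjE) simp_all
    qed simp
    also have "\<dots> = (\<Sum>j\<in>{0..<r - 1}. s ruling j * x (A ruling j) * x (partner ruling (A ruling j)))"
      using sum.permute[OF p(1), of "\<lambda>j. s ruling j * x (A ruling j) * x (partner ruling (A ruling j))"]
      by (simp add: o_def)
    finally show "(\<Sum>j<r - 1. s ruling (p j) * x (ruling_frame j) * x (partner ruling (ruling_frame j))) = 0"
      using quadric[OF ruling_conic' x] by (simp add: atLeast0LessThan)
  qed
qed

text \<open>The point \<open>X t = g (e + t p)\<close> degenerates to \<open>g e\<close>, where \<open>e\<close> is the weight vector of \<open>E\<^sub>2\<close> and \<open>g\<close> a generic raising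
  element: exactly the chain coordinates of \<open>g e\<close> vanish.  All pairs of \<open>H - E\<^sub>1\<close> meet the chain, so after division
  by \<open>t\<close> its coordinates \<open>u\<^sub>j\<close> have a limit on the hyperplane \<open>\<Sum> u\<^sub>j = 0\<close>, which can be prescribed;
  \<open>(-(r - 2), 1, \<dots>, 1)\<close> gives \<open>\<Sum> u\<^sub>j ln \<bar>u\<^sub>j\<bar> = - (r - 2) ln (r - 2)\<close>.  The other terms tend to 0.\<close>

lemma lin_rel_adjacent:
  assumes "lin_rel \<kappa>"
  shows "\<kappa> ruling = \<kappa> (reflection r (simple_root 1) ruling)"
proof -
  let ?E = exceptional_class and ?R = "partner ruling" and ?c' = "reflection r (simple_root 1) ruling"
  let ?F = "at_right (0::real)"
  \<comment> \<open>Without its constant part the relation has no term for \<open>H - E\<^sub>2\<close>, all of whose pairs meet the chain as well.\<close>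
  define \<kappa>' where "\<kappa>' c = \<kappa> c - \<kappa> ?c'" for c
  have rel: "lin_rel \<kappa>'" unfolding \<kappa>'_def by (rule lin_rel_subtract_const[OF assms])
  have r3: "3 \<le> r" using r by simp
  obtain g where g: "g \<in> raising r" and gen: "\<And>l. l \<in> lines r \<Longrightarrow> l \<notin> chain r \<Longrightarrow> g (weight_vector (?E 2)) l \<noteq> 0"
    using raising_generic[OF r] by blast
  note gG = raising_G_group[OF g]
  define e where "e = weight_vector (?E 2)"
  have e: "e \<in> exceptional_span r" unfolding e_def using r by (intro weight_vector_span) auto
  define x0 where "x0 = g e"
  have x0_gen: "x0 l \<noteq> 0" if "l \<in> lines r" "l \<notin> chain r" for l
    using gen[OF that] by (simp add: x0_def e_def)
  have E_notin: "?E k \<noteq> ?R (?E i)" if "k \<ge> 1" "i \<ge> 1" for k i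
  proof
    assume "?E k = ?R (?E i)"
    then have "?E k 0 = ?R (?E i) 0" by simp
    then show False using that by (simp add: partner_def ruling_def exceptional_class_def)
  qed
  have R_inj: "?R l = ?R l' \<longleftrightarrow> l = l'" for l l' by (metis partner_partner)
  have x0_chain: "x0 l = 0" if "l \<in> chain r" for l
    unfolding x0_def
  proof (rule raising_chain_zero[OF g r3 _ that])
    fix l assume "l \<in> chain r"
    then have "l \<noteq> ?E 2" using E_notin[of 2 2] by (auto simp: chain_def exceptional_class_inj)
    then show "e l = 0" by (simp add: e_def weight_vector_def)
  qed
  have E2: "?E 2 \<in> lines r" "?E 2 \<notin> chain r"
    using r E_notin[of 2 2] by (auto simp: chain_def exceptional_class_inj intro: exceptional_class_line)
  have Rk: "?R (?E k) \<in> lines r" "?R (?E k) \<notin> chain r" if "k \<in> {3..r}" for k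
  proof -
    show "?R (?E k) \<in> lines r" using that by (intro partner_ruling_line) auto
    show "?R (?E k) \<notin> chain r"
      using that E_notin[of _ k] by (auto simp: chain_def R_inj exceptional_class_inj) (metis One_nat_def Suc_le_eq E_notin atLeastAtMost_iff le_trans one_le_numeral that)
  qed
  obtain s' where s': "\<And>j. j < r - 1 \<Longrightarrow> s' j = 1 \<or> s' j = (- 1 :: complex)"
    "\<And>x. x \<in> minuscule_cone r \<Longrightarrow> (\<Sum>j<r - 1. s' j * x (ruling_frame j) * x (?R (ruling_frame j))) = 0"
    using ruling_quadric by blast
  have span_ex: "\<exists>p\<in>exceptional_span r. \<forall>k\<in>{3..r}. g p (?E k) = y k" for y
  proof -
    obtain z where z: "\<And>x. \<forall>j\<in>{3..r}. x (?E j) = z j \<Longrightarrow> \<forall>j\<in>{3..r}. g x (?E j) = y j"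
      using raising_surjective[OF g r3, of y] by blast
    define p where "p l = (if \<exists>j\<in>{3..r}. l = ?E j then z (THE j. l = ?E j) else 0)" for l
    have "\<forall>j\<in>{3..r}. p (?E j) = z j" by (auto simp: p_def exceptional_class_inj)
    moreover have "p \<in> exceptional_span r" by (auto simp: p_def exceptional_span_def split: if_splits)
    ultimately show ?thesis using z by blast
  qed
  \<comment> \<open>With this velocity of the coordinate of \<open>E\<^sub>k\<close>, \<open>u\<^sub>k\<^sub>-\<^sub>2 / t\<close> tends to 1.\<close>
  define y where "y k = 1 / (s' (k - 2) * x0 (?R (?E k)))" for k
  obtain p1 where p1: "p1 \<in> exceptional_span r" "\<And>k. k \<in> {3..r} \<Longrightarrow> g p1 (?E k) = y k"
    using span_ex[of y] by blast
  \<comment> \<open>Tangent vectors whose logarithmic derivatives, in the limit, are unit vectors on the columns of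
    \<open>E\<^sub>3, \<dots>, E\<^sub>r\<close>.  There are \<open>r - 3\<close> of them for \<open>r - 2\<close> columns, whence the shift that skips \<open>E\<^sub>3\<close>.\<close>
  have "\<forall>i. \<exists>p. p \<in> exceptional_span r \<and> (\<forall>k\<in>{3..r}. g p (?E k) = (if k = i + 4 then y k else 0))"
  proof
    fix i
    show "\<exists>p. p \<in> exceptional_span r \<and> (\<forall>k\<in>{3..r}. g p (?E k) = (if k = i + 4 then y k else 0))"
      using span_ex[of "\<lambda>k. if k = i + 4 then y k else 0"] by blast
  qed
  from choice[OF this] obtain \<zeta> where \<zeta>: "\<And>i. \<zeta> i \<in> exceptional_span r"
    "\<And>i k. k \<in> {3..r} \<Longrightarrow> g (\<zeta> i) (?E k) = (if k = i + 4 then y k else 0)"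
    by blast
  define x1 where "x1 = g p1"
  define W where "W i = g (\<zeta> i)" for i
  define X where "X t l = x0 l + of_real t * x1 l" for t :: real and l
  \<comment> \<open>The factor \<open>t\<close> keeps the logarithmic derivatives of the chain coordinates bounded.\<close>
  define \<Xi> where "\<Xi> t k l = of_real t * W k l" for t :: real and k l
  define G where "G t = log_data (X t) (\<Xi> t)" for t
  have y_nz: "y k \<noteq> 0" if "k \<in> {3..r}" for k
  proof -
    have "3 \<le> k" "k \<le> r" using that by auto
    then have "k - 2 < r - 1" by linarith
    then show ?thesis using s'(1)[of "k - 2"] x0_gen[OF Rk[OF that]] by (auto simp: y_def)
  qed
  have X_image: "X t = g (\<lambda>l. e l + of_real t * p1 l)" for t
    unfolding X_def x0_def x1_def by (rule G_group_linear[OF gG, symmetric])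
  have X_span: "(\<lambda>l. e l + of_real t * p1 l) \<in> exceptional_span r" for t :: real
    by (rule exceptional_span_closed[OF e p1(1)])
  have \<Xi>_image: "\<Xi> t k = g (scale (of_real t) (\<zeta> k))" for t k
    unfolding G_group_scale[OF gG] by (simp add: \<Xi>_def W_def scale_def fun_eq_iff)
  have \<Xi>_span: "scale (of_real t) (\<zeta> k) \<in> exceptional_span r" for t k
    using \<zeta>(1)[of k] by (auto simp: exceptional_span_def scale_def)
  have x1E: "x1 (?E k) = y k" if "k \<in> {3..r}" for k
    using p1(2)[OF that] by (simp add: x1_def)
  have X_cone: "X t \<in> minuscule_cone r" if "t > 0" for t
  proof -
    have "(\<lambda>l. e l + of_real t * p1 l) \<noteq> (\<lambda>_. 0)"
    proof
      assume "(\<lambda>l. e l + of_real t * p1 l) = (\<lambda>_. 0)"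
      then have "X t (?E 3) = 0" unfolding X_image by (simp add: G_group_zero[OF gG])
      moreover have "x0 (?E 3) = 0" using r by (intro x0_chain) (auto simp: chain_def)
      ultimately show False using that x1E[of 3] y_nz[of 3] r by (simp add: X_def)
    qed
    then show ?thesis
      unfolding X_image by (intro minuscule_cone_G_group[OF gG] exceptional_span_cone[OF r3 X_span])
  qed
  define m where "m = ?R (?E 2)"
  have m: "m \<in> chain r" by (simp add: m_def chain_def)
  have b0: "ruling_frame 0 = ?E 2" by (simp add: ruling_frame_def numeral_2_eq_2)
  have bj: "ruling_frame j = ?E (j + 2)" for j by (simp add: ruling_frame_def)
  have unit: "s' j * x1 (ruling_frame j) * x0 (?R (ruling_frame j)) = 1" if "0 < j" "j < r - 1" for j
  proof -
    have k: "j + 2 \<in> {3..r}" using that by auto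
    have "s' j \<noteq> 0" using s'(1)[OF that(2)] by auto
    then show ?thesis
      using x1E[OF k] x0_gen[OF Rk[OF k]] unfolding bj y_def by simp
  qed
  have split: "(\<Sum>j<r - 1. f j) = f 0 + (\<Sum>j\<in>{1..<r - 1}. f j)" for f :: "nat \<Rightarrow> complex"
  proof -
    have "{..<r - 1} = insert 0 {1..<r - 1}" using r by auto
    then show ?thesis by simp
  qed
  \<comment> \<open>The quadric determines the velocity of the last chain coordinate, that of \<open>H - E\<^sub>1 - E\<^sub>2\<close>.\<close>
  have first: "s' 0 * x0 (?E 2) * x1 m = - of_nat (r - 2)"
  proof -
    have "(\<Sum>j<r - 1. s' j * (x0 (ruling_frame j) * x1 (?R (ruling_frame j)) + x1 (ruling_frame j) * x0 (?R (ruling_frame j)))) = 0"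
      unfolding x0_def x1_def by (rule quadric_polarization[OF s'(2) r3 gG e p1(1)])
    moreover have "(\<Sum>j\<in>{1..<r - 1}. s' j * (x0 (ruling_frame j) * x1 (?R (ruling_frame j)) + x1 (ruling_frame j) * x0 (?R (ruling_frame j))))
        = (\<Sum>j\<in>{1..<r - 1}. 1)"
    proof (rule sum.cong)
      fix j assume j: "j \<in> {1..<r - 1}"
      then have "x0 (ruling_frame j) = 0" by (intro x0_chain) (auto simp: bj chain_def)
      then show "s' j * (x0 (ruling_frame j) * x1 (?R (ruling_frame j)) + x1 (ruling_frame j) * x0 (?R (ruling_frame j))) = 1"
        using unit[of j] j by (simp add: mult.assoc)
    qed simp
    ultimately show ?thesis
      unfolding split b0 using x0_chain[OF m] by (simp add: m_def add_eq_0_iff2 algebra_simps numeral_2_eq_2)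
  qed
  have x1_chain: "x1 l \<noteq> 0" if "l \<in> chain r" for l
  proof -
    have "r - 2 \<noteq> 0" using r by simp
    then have "- of_nat (r - 2) \<noteq> (0 :: complex)" by (simp only: neg_equal_0_iff_equal of_nat_eq_0_iff not_False_eq_True)
    then have "x1 m \<noteq> 0" unfolding first[symmetric] by auto
    then show ?thesis using that x1E y_nz by (auto simp: chain_def m_def)
  qed
  have X_lim: "((\<lambda>t. X t l) \<longlongrightarrow> x0 l) ?F" for l
    unfolding X_def by (auto intro!: tendsto_eq_intros)
  have t_pos: "\<forall>\<^sub>F t in ?F. t > 0" by (simp add: eventually_at_right_less)
  have ev: "\<forall>\<^sub>F t in ?F. t > 0 \<and> (\<forall>l\<in>lines r. X t l \<noteq> 0)"
  proof (intro eventually_conj t_pos eventually_ball_finite finite_lines r ballI)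
    fix l assume l: "l \<in> lines r"
    show "\<forall>\<^sub>F t in ?F. X t l \<noteq> 0"
    proof (cases "l \<in> chain r")
      case True
      show ?thesis
        using t_pos by eventually_elim (simp add: X_def x0_chain[OF True] x1_chain[OF True])
    next
      case False
      then show ?thesis using tendsto_imp_eventually_ne[OF X_lim x0_gen[OF l]] by blast
    qed
  qed
  define Lim where "Lim k l = (if l \<in> chain r then W (k - 1) l / x1 l else 0)" for k l
  have G_lim: "((\<lambda>t. G t k l) \<longlongrightarrow> Lim k l) ?F" if "l \<in> lines r" "1 \<le> k" for k l
  proof (cases "l \<in> chain r")
    case True
    have "\<forall>\<^sub>F t in ?F. G t k l = Lim k l"
      using t_pos by eventually_elim
        (use True that x0_chain[OF True] in \<open>simp add: G_def log_data_def X_def \<Xi>_def Lim_def\<close>)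
    then show ?thesis by (rule tendsto_eventually)
  next
    case False
    have "((\<lambda>t. of_real t * W (k - 1) l / X t l) \<longlongrightarrow> 0 * W (k - 1) l / x0 l) ?F"
      using x0_gen[OF that(1) False] by (intro tendsto_intros X_lim) (auto intro!: tendsto_eq_intros)
    then show ?thesis using that False by (simp add: G_def log_data_def \<Xi>_def Lim_def)
  qed
  have ortho: "(\<Sum>j<r - 1. \<sigma> j * X t (a j) * X t (partner c (a j)) * (G t k (a j) + G t k (partner c (a j)))) = 0"
    if Q: "\<And>x. x \<in> minuscule_cone r \<Longrightarrow> (\<Sum>j<r - 1. \<sigma> j * x (a j) * x (partner c (a j))) = 0"
      and a: "conic_frame r c a" and t: "\<forall>l\<in>lines r. X t l \<noteq> 0" and k: "1 \<le> k" for \<sigma> a c t k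
  proof -
    have "(\<Sum>j<r - 1. \<sigma> j * X t (a j) * X t (partner c (a j)) * (G t k (a j) + G t k (partner c (a j)))) =
        (\<Sum>j<r - 1. \<sigma> j * (X t (a j) * \<Xi> t (k - 1) (partner c (a j)) + \<Xi> t (k - 1) (a j) * X t (partner c (a j))))"
    proof (rule sum.cong)
      fix j assume "j \<in> {..<r - 1}"
      then have "X t (a j) \<noteq> 0" "X t (partner c (a j)) \<noteq> 0"
        using conic_frame_lines[OF a] t by auto
      then show "\<sigma> j * X t (a j) * X t (partner c (a j)) * (G t k (a j) + G t k (partner c (a j))) =
          \<sigma> j * (X t (a j) * \<Xi> t (k - 1) (partner c (a j)) + \<Xi> t (k - 1) (a j) * X t (partner c (a j)))"
        using k by (simp add: G_def log_data_def field_simps)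
    qed simp
    also have "\<dots> = 0"
      unfolding X_image \<Xi>_image by (rule quadric_polarization[OF Q r3 gG X_span \<Xi>_span])
    finally show ?thesis .
  qed
  have logs: "G t 0 (a j) + G t 0 (partner c (a j)) = of_real (ln (cmod (\<sigma> j * X t (a j) * X t (partner c (a j)))))"
    if "conic_frame r c a" "\<forall>l\<in>lines r. X t l \<noteq> 0" "j < r - 1" "\<sigma> j = 1 \<or> \<sigma> j = - 1" for \<sigma> :: "nat \<Rightarrow> complex" and a c t j
  proof -
    have "X t (a j) \<noteq> 0" "X t (partner c (a j)) \<noteq> 0" "cmod (\<sigma> j) = 1"
      using conic_frame_lines[OF that(1)] that by auto
    then show ?thesis by (simp add: G_def log_data_def norm_mult ln_mult)
  qed
  \<comment> \<open>The other conics contribute nothing in the limit.\<close>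
  have other: "((\<lambda>t. pairdet r c (A c) (G t)) \<longlongrightarrow> 0) ?F"
    if c: "c \<in> conics r" and ne: "c \<noteq> ruling" "c \<noteq> ?c'" for c
  proof -
    let ?a = "A c" and ?b = "\<lambda>j. partner c (A c j)"
    note fr = frame[OF c]
    note fl = conic_frame_lines[OF fr]
    obtain j0 j1 where j: "j0 < r - 1" "j1 < r - 1" "j0 \<noteq> j1"
      "?a j0 \<notin> chain r" "?b j0 \<notin> chain r" "?a j1 \<notin> chain r" "?b j1 \<notin> chain r"
      using two_columns_off_chain[OF r c fr ne] by blast
    define u where "u t j = s c j * X t (?a j) * X t (?b j)" for t j
    define v where "v j = s c j * x0 (?a j) * x0 (?b j)" for j
    define M where "M t = mdet (r - 2) (\<lambda>i j. if i = 0 then 1 else G t i (?a (if j < j0 then j else Suc j))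
       + G t i (?b (if j < j0 then j else Suc j)))" for t
    define M0 where "M0 = mdet (r - 2) (\<lambda>i j. if i = 0 then 1 else Lim i (?a (if j < j0 then j else Suc j))
       + Lim i (?b (if j < j0 then j else Suc j)))"
    have u_lim: "((\<lambda>t. u t j) \<longlongrightarrow> v j) ?F" for j
      unfolding u_def v_def by (intro tendsto_intros X_lim)
    have M_lim: "(M \<longlongrightarrow> M0) ?F"
      unfolding M_def M0_def using fl by (intro tendsto_mdet) (auto intro!: tendsto_intros G_lim)
    have eq: "\<forall>\<^sub>F t in ?F. u t j0 * pairdet r c ?a (G t) =
        (\<Sum>j<r - 1. u t j * of_real (ln (cmod (u t j)))) * ((- 1) ^ (1 + j0) * M t)"
      using ev
    proof eventually_elim
      case (elim t)
      then have nz: "\<forall>l\<in>lines r. X t l \<noteq> 0" and pos: "t > 0" by auto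
      have "u t j0 * pairdet r c ?a (G t) = (\<Sum>j<r - 1. u t j * (G t 0 (?a j) + G t 0 (?b j))) * ((- 1) ^ (1 + j0) * M t)"
        unfolding M_def
      proof (rule pairdet_cramer)
        show "(\<Sum>j<r - 1. u t j) = 0" unfolding u_def by (rule quadric[OF c X_cone[OF pos]])
        show "(\<Sum>j<r - 1. u t j * (G t k (?a j) + G t k (?b j))) = 0" if "1 \<le> k" for k
          unfolding u_def by (rule ortho[OF quadric[OF c] fr nz that])
      qed (use r j in auto)
      also have "(\<Sum>j<r - 1. u t j * (G t 0 (?a j) + G t 0 (?b j))) = (\<Sum>j<r - 1. u t j * of_real (ln (cmod (u t j))))"
        unfolding u_def using logs[OF fr nz _ sign[OF c]] by (intro sum.cong) auto
      finally show ?case .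
    qed
    have "((\<lambda>t. (\<Sum>j<r - 1. u t j * of_real (ln (cmod (u t j)))) * ((- 1) ^ (1 + j0) * M t)) \<longlongrightarrow>
        (\<Sum>j<r - 1. v j * of_real (ln (cmod (v j)))) * ((- 1) ^ (1 + j0) * M0)) ?F"
      by (intro tendsto_mult tendsto_const tendsto_sum_mult_ln_cmod u_lim M_lim)
    moreover have "(\<Sum>j<r - 1. v j * of_real (ln (cmod (v j)))) * ((- 1) ^ (1 + j0) * M0) = 0"
    proof (cases "\<exists>j2<r - 1. j2 \<noteq> j0 \<and> j2 \<noteq> j1 \<and> ?a j2 \<notin> chain r \<and> ?b j2 \<notin> chain r")
      \<comment> \<open>A third pair off the chain gives two columns \<open>(1, 0, \<dots>, 0)\<close> in the minor.\<close>
      case True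
      then obtain j2 where j2: "j2 < r - 1" "j2 \<noteq> j0" "j2 \<noteq> j1" "?a j2 \<notin> chain r" "?b j2 \<notin> chain r" by blast
      define d where "d j = (if j < j0 then j else j - 1)" for j
      have d: "(if d j < j0 then d j else Suc (d j)) = j" "d j < r - 2" if "j \<noteq> j0" "j < r - 1" for j
        using that j(1) by (auto simp: d_def)
      have "d j1 \<noteq> d j2" using d(1)[of j1] d(1)[of j2] j j2 by metis
      then have "M0 = 0"
        unfolding M0_def using j j2 d(2)[of j1] d(2)[of j2] d(1)[of j1] d(1)[of j2]
        by (intro mdet_equal_columns[of "d j1" _ "d j2"]) (auto simp: Lim_def)
      then show ?thesis by simp
    next
      \<comment> \<open>Only two \<open>v\<^sub>j\<close> are non-zero.  They are opposite, so their terms \<open>v\<^sub>j ln \<bar>v\<^sub>j\<bar>\<close> cancel.\<close>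
      case False
      have v0: "v j = 0" if "j < r - 1" "j \<noteq> j0" "j \<noteq> j1" for j
        using False that x0_chain by (auto simp: v_def)
      have two: "(\<Sum>j<r - 1. f j) = f j0 + f j1" if "\<And>j. j < r - 1 \<Longrightarrow> j \<noteq> j0 \<Longrightarrow> j \<noteq> j1 \<Longrightarrow> f j = 0" for f :: "nat \<Rightarrow> complex"
      proof -
        have "(\<Sum>j<r - 1. f j) = (\<Sum>j\<in>{j0, j1}. f j)"
          using that j by (intro sum.mono_neutral_right) auto
        then show ?thesis using j(3) by simp
      qed
      have "(\<Sum>j<r - 1. v j) = 0"
      proof (rule tendsto_unique[OF _ tendsto_sum[OF u_lim]])
        show "((\<lambda>t. \<Sum>j<r - 1. u t j) \<longlongrightarrow> 0) ?F"
          using t_pos quadric[OF c X_cone] unfolding u_def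
          by (intro tendsto_eventually) (auto elim: eventually_mono)
      qed simp
      then have "v j1 = - v j0" using two[of v] v0 by (simp add: add_eq_0_iff)
      then show ?thesis using two[of "\<lambda>j. v j * of_real (ln (cmod (v j)))"] v0 by simp
    qed
    ultimately have "((\<lambda>t. u t j0 * pairdet r c ?a (G t)) \<longlongrightarrow> 0) ?F"
      by (simp only: tendsto_cong[OF eq])
    moreover have "v j0 \<noteq> 0"
      using sign[OF c j(1)] x0_gen fl[OF j(1)] j by (auto simp: v_def)
    ultimately have "((\<lambda>t. u t j0 * pairdet r c ?a (G t) / u t j0) \<longlongrightarrow> 0 / v j0) ?F"
      by (intro tendsto_divide u_lim)
    moreover have "\<forall>\<^sub>F t in ?F. u t j0 * pairdet r c ?a (G t) / u t j0 = pairdet r c ?a (G t)"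
      using tendsto_imp_eventually_ne[OF u_lim \<open>v j0 \<noteq> 0\<close>] by eventually_elim simp
    ultimately show ?thesis by (simp add: tendsto_cong)
  qed
  \<comment> \<open>The ruling contributes a non-zero limit.\<close>
  have main: "((\<lambda>t. pairdet r ruling ruling_frame (G t)) \<longlongrightarrow> - of_real (ln (real (r - 2)))) ?F"
  proof -
    let ?b = "\<lambda>j. ?R (ruling_frame j)"
    have fr: "conic_frame r ruling ruling_frame" using r by (intro conic_frame_ruling) simp
    note fl = conic_frame_lines[OF fr]
    define u where "u t j = s' j * X t (ruling_frame j) * X t (?b j) / of_real t" for t j
    define v where "v j = (if j = 0 then - of_nat (r - 2) else 1 :: complex)" for j :: nat
    define M where "M t = mdet (r - 2) (\<lambda>i j. if i = 0 then 1 else G t i (ruling_frame (Suc j)) + G t i (?b (Suc j)))" for t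
    have u_lim: "((\<lambda>t. u t j) \<longlongrightarrow> v j) ?F" if j: "j < r - 1" for j
    proof (cases "j = 0")
      case True
      have "((\<lambda>t. s' 0 * X t (?E 2) * x1 m) \<longlongrightarrow> s' 0 * x0 (?E 2) * x1 m) ?F"
        by (intro tendsto_intros X_lim)
      moreover have "\<forall>\<^sub>F t in ?F. s' 0 * X t (?E 2) * x1 m = u t 0"
        using t_pos by eventually_elim
          (simp add: u_def b0 m_def[symmetric] X_def[of _ m] x0_chain[OF m])
      ultimately show ?thesis using True first by (simp add: v_def tendsto_cong)
    next
      case False
      then have ch: "ruling_frame j \<in> chain r" using j by (auto simp: bj chain_def)
      have "((\<lambda>t. s' j * x1 (ruling_frame j) * X t (?b j)) \<longlongrightarrow> s' j * x1 (ruling_frame j) * x0 (?b j)) ?F"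
        by (intro tendsto_intros X_lim)
      moreover have "\<forall>\<^sub>F t in ?F. s' j * x1 (ruling_frame j) * X t (?b j) = u t j"
        using t_pos by eventually_elim
          (simp add: u_def X_def[of _ "ruling_frame j"] x0_chain[OF ch])
      ultimately show ?thesis using unit[of j] False j by (simp add: v_def tendsto_cong)
    qed
    have M_lim: "(M \<longlongrightarrow> 1) ?F"
    proof -
      have "(M \<longlongrightarrow> mdet (r - 2) (\<lambda>i j. if i = 0 then 1 else Lim i (ruling_frame (Suc j)) + Lim i (?b (Suc j)))) ?F"
        unfolding M_def using fl by (intro tendsto_mdet) (auto intro!: tendsto_intros G_lim)
      also have "mdet (r - 2) (\<lambda>i j. if i = 0 then 1 else Lim i (ruling_frame (Suc j)) + Lim i (?b (Suc j))) =
          mdet (r - 2) (\<lambda>i j. if i = 0 then 1 else if i = j then 1 else 0)"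
      proof (rule mdet_cong)
        fix i j assume ij: "i < r - 2" "j < r - 2"
        then have k: "j + 3 \<in> {3..r}" by auto
        have "ruling_frame (Suc j) = ?E (j + 3)" by (simp add: ruling_frame_def eval_nat_numeral)
        moreover have "?E (j + 3) \<in> chain r" using k by (simp add: chain_def)
        ultimately show "(if i = 0 then 1 else Lim i (ruling_frame (Suc j)) + Lim i (?b (Suc j))) =
            (if i = 0 then 1 else if i = j then 1 else 0)"
          using Rk[OF k] \<zeta>(2)[OF k, of "i - 1"] x1E[OF k] y_nz[OF k]
          by (auto simp: Lim_def W_def)
      qed
      also have "\<dots> = 1" by (subst mdet_upper_triangular, force, rule prod.neutral) auto
      finally show ?thesis .
    qed
    have eq: "\<forall>\<^sub>F t in ?F. u t 0 * pairdet r ruling ruling_frame (G t) =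
        (\<Sum>j<r - 1. u t j * of_real (ln (cmod (u t j)))) * (- M t)"
      using ev
    proof eventually_elim
      case (elim t)
      then have nz: "\<forall>l\<in>lines r. X t l \<noteq> 0" and pos: "t > 0" by auto
      have sum0: "(\<Sum>j<r - 1. u t j) = 0"
        using s'(2)[OF X_cone[OF pos]] by (simp add: u_def sum_divide_distrib[symmetric])
      have "u t 0 * pairdet r ruling ruling_frame (G t) =
          (\<Sum>j<r - 1. u t j * (G t 0 (ruling_frame j) + G t 0 (?b j))) * ((- 1) ^ (1 + 0) *
             mdet (r - 2) (\<lambda>i j. if i = 0 then 1 else G t i (ruling_frame (if j < 0 then j else Suc j))
               + G t i (?R (ruling_frame (if j < 0 then j else Suc j)))))" (is "_ = ?h * (_ * ?minor)")
      proof (rule pairdet_cramer)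
        show "(\<Sum>j<r - 1. u t j * (G t k (ruling_frame j) + G t k (?b j))) = 0" if "1 \<le> k" for k
          using ortho[OF s'(2) fr nz that] pos
          by (simp add: u_def sum_divide_distrib[symmetric])
      qed (use r sum0 in auto)
      \<comment> \<open>The division by \<open>t\<close> adds \<open>ln t\<close> to all the logarithms, which drops out because of \<open>\<Sum> u\<^sub>j = 0\<close>.\<close>
      also have "(\<Sum>j<r - 1. u t j * (G t 0 (ruling_frame j) + G t 0 (?b j))) =
          (\<Sum>j<r - 1. u t j * (of_real (ln (cmod (u t j))) + of_real (ln t)))"
      proof (rule sum.cong)
        fix j assume "j \<in> {..<r - 1}"
        then have j: "j < r - 1" by simp
        have q: "s' j * X t (ruling_frame j) * X t (?b j) = u t j * of_real t"
          using pos by (simp add: u_def)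
        have "u t j \<noteq> 0" using nz fl[OF j] s'(1)[OF j] pos by (auto simp: u_def)
        then have "G t 0 (ruling_frame j) + G t 0 (?b j) = of_real (ln (cmod (u t j))) + of_real (ln t)"
          unfolding logs[where \<sigma> = s', OF fr nz j s'(1)[OF j]] q using pos by (simp add: norm_mult ln_mult)
        then show "u t j * (G t 0 (ruling_frame j) + G t 0 (?b j)) =
            u t j * (of_real (ln (cmod (u t j))) + of_real (ln t))" by simp
      qed simp
      also have "\<dots> = (\<Sum>j<r - 1. u t j * of_real (ln (cmod (u t j))))"
        using sum0 by (simp add: distrib_left sum.distrib sum_distrib_right[symmetric])
      finally have "u t 0 * pairdet r ruling ruling_frame (G t) =
          (\<Sum>j<r - 1. u t j * of_real (ln (cmod (u t j)))) * ((- 1) ^ (1 + 0) * ?minor)" .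
      moreover have "?minor = M t" unfolding M_def by (rule mdet_cong) auto
      ultimately show ?case by simp
    qed
    have "((\<lambda>t. (\<Sum>j<r - 1. u t j * of_real (ln (cmod (u t j)))) * (- M t)) \<longlongrightarrow>
        (\<Sum>j<r - 1. v j * of_real (ln (cmod (v j)))) * (- 1)) ?F"
      by (intro tendsto_mult tendsto_minus tendsto_sum_mult_ln_cmod u_lim M_lim)
    moreover have "(\<Sum>j<r - 1. v j * of_real (ln (cmod (v j)))) = - of_nat (r - 2) * of_real (ln (real (r - 2)))"
      unfolding split by (simp add: v_def)
    ultimately have "((\<lambda>t. u t 0 * pairdet r ruling ruling_frame (G t)) \<longlongrightarrow> of_nat (r - 2) * of_real (ln (real (r - 2)))) ?F"
      by (simp only: tendsto_cong[OF eq] minus_mult_minus mult_minus_left mult_minus_right minus_minus mult_1_right)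
    moreover have v0: "v 0 \<noteq> 0"
    proof -
      have "r - 2 \<noteq> 0" using r by simp
      then show ?thesis
        unfolding v_def by (simp only: refl if_True neg_equal_0_iff_equal of_nat_eq_0_iff not_False_eq_True)
    qed
    moreover have u0: "((\<lambda>t. u t 0) \<longlongrightarrow> v 0) ?F" using r by (intro u_lim) simp
    ultimately have "((\<lambda>t. u t 0 * pairdet r ruling ruling_frame (G t) / u t 0) \<longlongrightarrow>
        of_nat (r - 2) * of_real (ln (real (r - 2))) / v 0) ?F"
      by (intro tendsto_divide)
    moreover have "\<forall>\<^sub>F t in ?F. u t 0 * pairdet r ruling ruling_frame (G t) / u t 0 = pairdet r ruling ruling_frame (G t)"
      using tendsto_imp_eventually_ne[OF u0 v0] by eventually_elim simp
    moreover have "of_nat (r - 2) * of_real (ln (real (r - 2))) / v 0 = - complex_of_real (ln (real (r - 2)))"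
    proof -
      have "x * z / - x = - z" if "- x \<noteq> 0" for x z :: complex using that by simp
      then show ?thesis using v0 unfolding v_def if_True simp_thms by blast
    qed
    ultimately show ?thesis by (simp add: tendsto_cong)
  qed
  define w where "w = (of_int (orientation r ruling ruling_frame) :: complex)"
  have "oriented_frame r ruling ruling_frame" using r by (intro oriented_frame_ruling) simp
  from orientation_unit[OF this] have w: "w \<noteq> 0" by (auto simp: w_def)
  define lim where "lim c = (if c = ruling then \<kappa>' ruling * (w * - of_real (ln (real (r - 2)))) else 0)" for c
  have term_lim: "((\<lambda>t. \<kappa>' c * oriented_det r c (A c) (G t)) \<longlongrightarrow> lim c) ?F" if c: "c \<in> conics r" for c
  proof -
    consider "c = ruling" | "c \<noteq> ruling" "c = ?c'" | "c \<noteq> ruling" "c \<noteq> ?c'" by blast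
    then show ?thesis
    proof cases
      case 1
      have od: "oriented_det r ruling (A ruling) (G t) = w * pairdet r ruling ruling_frame (G t)" for t
        using oriented_det_frame_independent[OF r ruling_conic' frame[OF ruling_conic'] conic_frame_ruling] r
        by (simp add: oriented_det_def w_def)
      have "((\<lambda>t. \<kappa>' ruling * (w * pairdet r ruling ruling_frame (G t))) \<longlongrightarrow>
          \<kappa>' ruling * (w * - of_real (ln (real (r - 2))))) ?F"
        by (intro tendsto_mult tendsto_const main)
      then show ?thesis by (simp only: 1 lim_def od if_True simp_thms)
    next
      case 2
      then show ?thesis by (simp add: \<kappa>'_def lim_def)
    next
      case 3
      have "((\<lambda>t. \<kappa>' c * (of_int (orientation r c (A c)) * pairdet r c (A c) (G t))) \<longlongrightarrow>
          \<kappa>' c * (of_int (orientation r c (A c)) * 0)) ?F"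
        by (intro tendsto_intros other[OF c 3])
      then show ?thesis using 3 by (simp add: lim_def oriented_det_def)
    qed
  qed
  have "((\<lambda>t. \<Sum>c\<in>conics r. \<kappa>' c * oriented_det r c (A c) (G t)) \<longlongrightarrow> (\<Sum>c\<in>conics r. lim c)) ?F"
    by (intro tendsto_sum term_lim)
  moreover have "\<forall>\<^sub>F t in ?F. (\<Sum>c\<in>conics r. \<kappa>' c * oriented_det r c (A c) (G t)) = 0"
    using ev
  proof eventually_elim
    case (elim t)
    have "G t = log_data (g (\<lambda>l. e l + of_real t * p1 l)) (\<lambda>k. g (scale (of_real t) (\<zeta> k)))"
      unfolding G_def X_image[symmetric] \<Xi>_image[symmetric] ..
    moreover have "g (\<lambda>l. e l + of_real t * p1 l) l \<noteq> 0" if "l \<in> lines r" for l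
      using elim that unfolding X_image[symmetric] by blast
    ultimately show ?case
      using lin_relD[OF rel gG X_span[of t], of "\<lambda>k. scale (of_real t) (\<zeta> k)"] \<Xi>_span by simp
  qed
  then have "((\<lambda>t. \<Sum>c\<in>conics r. \<kappa>' c * oriented_det r c (A c) (G t)) \<longlongrightarrow> 0) ?F"
    by (rule tendsto_eventually)
  ultimately have "(\<Sum>c\<in>conics r. lim c) = 0"
    by (rule tendsto_unique[OF trivial_limit_at_right_real])
  then have "\<kappa>' ruling * (w * - of_real (ln (real (r - 2)))) = 0"
    using finite_conics[OF r(2)] ruling_conic' by (simp add: lim_def)
  moreover have "ln (real (r - 2)) \<noteq> 0" using r by simp
  ultimately have "\<kappa>' ruling = 0" using w by simp
  then show ?thesis by (simp add: \<kappa>'_def)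
qed

theorem lin_rel_constant:
  assumes "lin_rel \<kappa>" "c \<in> conics r"
  shows "\<kappa> c = \<kappa> ruling"
proof -
  have "\<forall>\<kappa>. lin_rel \<kappa> \<longrightarrow> \<kappa> c = \<kappa> ruling"
  proof (rule conic_induct[OF assms(2) r, where P = "\<lambda>c. \<forall>\<kappa>. lin_rel \<kappa> \<longrightarrow> \<kappa> c = \<kappa> ruling"])
    fix c i assume i: "i < r" and IH: "\<forall>\<kappa>. lin_rel \<kappa> \<longrightarrow> \<kappa> c = \<kappa> ruling"
    show "\<forall>\<kappa>. lin_rel \<kappa> \<longrightarrow> \<kappa> (reflection r (simple_root i) c) = \<kappa> ruling"
    proof (intro allI impI)
      fix \<kappa> assume \<kappa>: "lin_rel \<kappa>"
      have "\<kappa> (reflection r (simple_root i) c) = \<kappa> (reflection r (simple_root i) ruling)"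
        using IH lin_rel_reflection[OF \<kappa> i] by blast
      also have "\<dots> = \<kappa> ruling"
      proof (cases "i = 1")
        case True
        then show ?thesis using lin_rel_adjacent[OF \<kappa>] by simp
      next
        case False
        \<comment> \<open>All the other simple reflections fix \<open>H - E\<^sub>1\<close>.\<close>
        have "intersection_form r ruling (simple_root i) = 0"
          using i r False by (cases "i = 0") (auto simp: intersection_simple_root intersection_simple_root_0 ruling_def)
        then show ?thesis by (simp add: reflection_def)
      qed
      finally show "\<kappa> (reflection r (simple_root i) c) = \<kappa> ruling" .
    qed
  qed simp
  then show ?thesis using assms(1) by blast
qed

end

section \<open>The form as a determinant\<close>

lemma remove1_upt_nth:
  assumes "j < n" "i < n - 1"
  shows "remove1 (Suc j) [1..<Suc n] ! i = Suc (if i < j then i else Suc i)"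
proof -
  have "[1..<Suc n] = [1..<Suc j] @ Suc j # [Suc (Suc j)..<Suc n]"
    using assms(1) upt_add_eq_append[of 1 "Suc j" "n - j"] by (simp add: upt_conv_Cons)
  then have "remove1 (Suc j) [1..<Suc n] = [1..<Suc j] @ [Suc (Suc j)..<Suc n]"
    by (simp add: remove1_append)
  then show ?thesis using assms by (auto simp: nth_append simp del: upt_Suc)
qed

lemma wedge_mdet:
  assumes "length \<alpha>s = n"
  shows "wedge \<alpha>s x v = mdet n (\<lambda>i j. (\<alpha>s ! j) x (v i))"
proof -
  have "wedge \<alpha>s x v = mdet n (\<lambda>j i. (\<alpha>s ! j) x (v i))"
    unfolding wedge_def mdet_leibniz using assms by (simp add: atLeast0LessThan)
  then show ?thesis by (simp add: mdet_transpose[of n "\<lambda>i j. (\<alpha>s ! j) x (v i)"])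
qed

text \<open>With \<open>g\<close> and \<open>\<theta>\<close> the logarithms and logarithmic derivatives of homogeneous coordinates, subtracting column 0 from the
  others removes the row of ones and leaves those of the ratios.  The expansion along the row of logarithms is the
  definition of \<open>\<Omega>\<^sub>r\<close>.\<close>

lemma Omega_mdet:
  assumes r: "4 \<le> r"
    and g: "\<And>j. 1 \<le> j \<Longrightarrow> j \<le> r - 2 \<Longrightarrow> of_real (ln (cmod (L_fun r lab j U))) = g j - g 0"
    and \<theta>: "\<And>i j. i < r - 3 \<Longrightarrow> 1 \<le> j \<Longrightarrow> j \<le> r - 2 \<Longrightarrow> dln (L_fun r lab j) U (V i) = \<theta> i j - \<theta> i 0"
  shows "Omega r lab U V = mdet (r - 1) (\<lambda>k j. if k = 0 then 1 else if k = 1 then g j else \<theta> (k - 2) j)"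
proof -
  define n where "n = r - 3"
  have n: "r - 1 = Suc (Suc n)" "r - 2 = Suc n" "r - 3 = n" using r by (auto simp: n_def)
  have "mdet (r - 1) (\<lambda>k j. if k = 0 then 1 else if k = 1 then g j else \<theta> (k - 2) j) =
      mdet (Suc n) (\<lambda>k j. if k = 0 then g (Suc j) - g 0 else \<theta> (k - 1) (Suc j) - \<theta> (k - 1) 0)"
    unfolding n by (subst mdet_pivot) (auto intro!: mdet_cong simp: numeral_2_eq_2)
  also have "\<dots> = (\<Sum>j<Suc n. (- 1) ^ j * (g (Suc j) - g 0) *
      mdet n (\<lambda>i j'. \<theta> i (Suc (if j' < j then j' else Suc j')) - \<theta> i 0))"
    unfolding mdet_laplace_row_0 by simp
  also have "\<dots> = (\<Sum>j<Suc n. (- 1) ^ j * of_real (ln (cmod (L_fun r lab (Suc j) U))) *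
      wedge (map (\<lambda>j. dln (L_fun r lab j)) (remove1 (Suc j) [1..<r - 1])) U V)"
  proof (rule sum.cong)
    fix j assume j: "j \<in> {..<Suc n}"
    have len: "length (remove1 (Suc j) [1..<r - 1]) = n"
      unfolding n using j by (simp add: length_remove1 del: upt_Suc)
    have "wedge (map (\<lambda>j. dln (L_fun r lab j)) (remove1 (Suc j) [1..<r - 1])) U V =
        mdet n (\<lambda>i j'. \<theta> i (Suc (if j' < j then j' else Suc j')) - \<theta> i 0)"
    proof (subst wedge_mdet[of _ n], simp only: length_map len, rule mdet_cong)
      fix i j' assume i: "i < n" "j' < n"
      have "remove1 (Suc j) [1..<r - 1] ! j' = Suc (if j' < j then j' else Suc j')"
        unfolding n using remove1_upt_nth[of j "Suc n" j'] i j by simp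
      then show "(map (\<lambda>j. dln (L_fun r lab j)) (remove1 (Suc j) [1..<r - 1]) ! j') U (V i) =
          \<theta> i (Suc (if j' < j then j' else Suc j')) - \<theta> i 0"
        using i j len \<theta>[of i "Suc (if j' < j then j' else Suc j')"] by (simp add: n del: upt_Suc)
    qed
    moreover have "of_real (ln (cmod (L_fun r lab (Suc j) U))) = g (Suc j) - g 0"
      using j by (intro g) (auto simp: n)
    ultimately show "(- 1) ^ j * (g (Suc j) - g 0) *
        mdet n (\<lambda>i j'. \<theta> i (Suc (if j' < j then j' else Suc j')) - \<theta> i 0) =
      (- 1) ^ j * of_real (ln (cmod (L_fun r lab (Suc j) U))) *
        wedge (map (\<lambda>j. dln (L_fun r lab j)) (remove1 (Suc j) [1..<r - 1])) U V"
      by simp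
  qed simp
  also have "\<dots> = Omega r lab U V"
    unfolding Omega_def n
    by (rule sum.reindex_bij_witness[of _ "\<lambda>i. i - 1" Suc]) auto
  finally show ?thesis ..
qed

definition L_linear :: "nat \<Rightarrow> ('m::finite \<Rightarrow> nat) \<Rightarrow> nat \<Rightarrow> complex^'m \<Rightarrow> complex" where
  "L_linear r lab i v = (if i = r - 2 then \<Sum>k\<in>UNIV. v $ k else v $ inv_into UNIV lab i)"

lemma bounded_linear_L_linear: "bounded_linear (L_linear r lab i)"
  unfolding L_linear_def
  by (cases "i = r - 2") (auto intro!: bounded_linear_intros bounded_linear_sum bounded_linear_vec_nth)

lemma L_fun_has_derivative:
  "(L_fun r lab i has_derivative L_linear r lab i) (at u)"
proof (cases "i = r - 2")
  case True
  then have "L_fun r lab i = (\<lambda>u. 1 + L_linear r lab i u)" by (auto simp: L_fun_def L_linear_def)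
  moreover have "((\<lambda>u. 1 + L_linear r lab i u) has_derivative (\<lambda>v. 0 + L_linear r lab i v)) (at u)"
    by (intro has_derivative_add has_derivative_const bounded_linear_imp_has_derivative bounded_linear_L_linear)
  ultimately show ?thesis by simp
next
  case False
  then have "L_fun r lab i = L_linear r lab i" by (auto simp: L_fun_def L_linear_def)
  then show ?thesis by (simp add: bounded_linear_imp_has_derivative bounded_linear_L_linear)
qed

lemma dln_L_fun: "dln (L_fun r lab i) u v = L_linear r lab i v / L_fun r lab i u"
  unfolding dln_def using frechet_derivative_at[OF L_fun_has_derivative[of r lab i u]] by metis

lemma sum_labels:
  fixes f :: "nat \<Rightarrow> complex"
  assumes "bij_betw lab UNIV {1..r - 3}" "4 \<le> r"
  shows "(\<Sum>k\<in>UNIV. f (lab k)) = (\<Sum>j<r - 1. f j) - f 0 - f (r - 2)"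
proof -
  have "(\<Sum>k\<in>UNIV. f (lab k)) = (\<Sum>j\<in>{1..r - 3}. f j)"
    by (rule sum.reindex_bij_betw[OF assms(1)])
  moreover have "{..<r - 1} = insert 0 (insert (r - 2) {1..r - 3})" using assms(2) by auto
  moreover have "r - 2 \<notin> {1..r - 3}" "0 \<notin> insert (r - 2) {1..r - 3}" using assms(2) by auto
  ultimately show ?thesis by simp
qed

definition ratio_point :: "('m::finite \<Rightarrow> nat) \<Rightarrow> (nat \<Rightarrow> complex) \<Rightarrow> complex^'m" where
  "ratio_point lab u = (\<chi> k. u (lab k) / u 0)"

text \<open>The image of the tangent vector with logarithmic derivatives \<open>\<theta> j\<close> of the homogeneous coordinates under
  the map to the chart.\<close>

definition ratio_tangent :: "('m::finite \<Rightarrow> nat) \<Rightarrow> (nat \<Rightarrow> complex) \<Rightarrow> (nat \<Rightarrow> complex) \<Rightarrow> complex^'m" where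
  "ratio_tangent lab u \<theta> = (\<chi> k. u (lab k) / u 0 * (\<theta> (lab k) - \<theta> 0))"

text \<open>The last linear form \<open>1 + \<Sum> u\<^sub>i / u\<^sub>0\<close> is \<open>- u\<^sub>r\<^sub>-\<^sub>2 / u\<^sub>0\<close> because the coordinates have sum 0.  The logarithms of
  absolute values and the logarithmic derivatives are blind to the sign.\<close>

lemma L_fun_ratio_point:
  assumes lab: "bij_betw lab UNIV {1..r - 3}" and r: "4 \<le> r" and u0: "u 0 \<noteq> 0"
    and sum: "(\<Sum>j<r - 1. u j) = 0" and i: "1 \<le> i" "i \<le> r - 2"
  shows "L_fun r lab i (ratio_point lab u) = (if i = r - 2 then - 1 else 1) * (u i / u 0)"
proof (cases "i = r - 2")
  case True
  have "(\<Sum>k\<in>UNIV. u (lab k) / u 0) = (- u 0 - u (r - 2)) / u 0"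
    unfolding sum_divide_distrib[symmetric] using sum_labels[OF lab r, of u] sum by simp
  then have "1 + (\<Sum>k\<in>UNIV. u (lab k) / u 0) = - (u (r - 2) / u 0)"
    using u0 by (simp add: diff_divide_distrib)
  then show ?thesis using True by (simp add: L_fun_def ratio_point_def)
next
  case False
  then have "i \<in> lab ` UNIV" using i lab unfolding bij_betw_def by auto
  then have "lab (inv_into UNIV lab i) = i" by (rule f_inv_into_f)
  then show ?thesis using False by (simp add: L_fun_def ratio_point_def)
qed

lemma Omega_ratio:
  assumes lab: "bij_betw lab UNIV {1..r - 3}" and r: "4 \<le> r"
    and u: "\<And>j. j < r - 1 \<Longrightarrow> u j \<noteq> 0" and sum: "(\<Sum>j<r - 1. u j) = 0"
    and tangent: "\<And>i. i < r - 3 \<Longrightarrow> (\<Sum>j<r - 1. u j * \<theta> i j) = 0"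
  shows "Omega r lab (ratio_point lab u) (\<lambda>i. ratio_tangent lab u (\<theta> i)) =
    mdet (r - 1) (\<lambda>k j. if k = 0 then 1 else if k = 1 then of_real (ln (cmod (u j))) else \<theta> (k - 2) j)"
proof (rule Omega_mdet[OF r])
  have u0: "u 0 \<noteq> 0" using u r by simp
  note L = L_fun_ratio_point[OF lab r u0 sum]
  fix j assume j: "1 \<le> j" "j \<le> r - 2"
  then have uj: "u j \<noteq> 0" using u r by simp
  have "cmod (L_fun r lab j (ratio_point lab u)) = cmod (u j) / cmod (u 0)"
    unfolding L[OF j] by (simp add: norm_mult norm_divide)
  then show "of_real (ln (cmod (L_fun r lab j (ratio_point lab u)))) =
      complex_of_real (ln (cmod (u j))) - of_real (ln (cmod (u 0)))"
    using u0 uj by (simp add: ln_div)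
  fix i assume i: "i < r - 3"
  show "dln (L_fun r lab j) (ratio_point lab u) (ratio_tangent lab u (\<theta> i)) = \<theta> i j - \<theta> i 0"
  proof (cases "j = r - 2")
    case True
    have "L_linear r lab j (ratio_tangent lab u (\<theta> i)) = (\<Sum>k\<in>UNIV. u (lab k) * (\<theta> i (lab k) - \<theta> i 0)) / u 0"
      using True by (simp add: L_linear_def ratio_tangent_def sum_divide_distrib)
    also have "(\<Sum>k\<in>UNIV. u (lab k) * (\<theta> i (lab k) - \<theta> i 0)) =
        (\<Sum>j<r - 1. u j * (\<theta> i j - \<theta> i 0)) - u (r - 2) * (\<theta> i (r - 2) - \<theta> i 0)"
      using sum_labels[OF lab r, of "\<lambda>j. u j * (\<theta> i j - \<theta> i 0)"] by simp
    also have "(\<Sum>j<r - 1. u j * (\<theta> i j - \<theta> i 0)) = 0"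
      using tangent[OF i] sum by (simp add: right_diff_distrib sum_subtractf sum_distrib_right[symmetric])
    finally show ?thesis
      unfolding dln_L_fun L[OF j] using True u0 uj by (simp add: field_simps)
  next
    case False
    then have "j \<in> lab ` UNIV" using j lab unfolding bij_betw_def by auto
    then have "lab (inv_into UNIV lab j) = j" by (rule f_inv_into_f)
    then have "L_linear r lab j (ratio_tangent lab u (\<theta> i)) = u j / u 0 * (\<theta> i j - \<theta> i 0)"
      using False by (simp add: L_linear_def ratio_tangent_def)
    then show ?thesis
      unfolding dln_L_fun L[OF j] using False u0 uj by simp
  qed
qed

lemma has_derivative_vec_lambda:
  fixes f :: "'m::finite \<Rightarrow> 'a::real_normed_vector \<Rightarrow> complex"
  assumes "\<And>k. (f k has_derivative f' k) (at x within S)"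
  shows "((\<lambda>x. \<chi> k. f k x) has_derivative (\<lambda>h. \<chi> k. f' k h)) (at x within S)"
proof -
  have vec: "(\<chi> k. g k) = (\<Sum>k\<in>UNIV. axis k (g k))" for g :: "'m \<Rightarrow> complex"
    by (simp add: Finite_Cartesian_Product.vec_eq_iff axis_def sum_component)
  have "linear (axis k :: complex \<Rightarrow> complex^'m)" for k
    by (rule linearI) (simp_all add: Finite_Cartesian_Product.vec_eq_iff axis_def)
  then have "bounded_linear (axis k :: complex \<Rightarrow> complex^'m)" for k
    by (simp add: linear_conv_bounded_linear)
  then have "((\<lambda>x. axis k (f k x)) has_derivative (\<lambda>h. axis k (f' k h))) (at x within S)" for k
    by (rule bounded_linear.has_derivative[OF _ assms])
  then have "((\<lambda>x. \<Sum>k\<in>UNIV. axis k (f k x)) has_derivative (\<lambda>h. \<Sum>k\<in>UNIV. axis k (f' k h))) (at x within S)"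
    by (rule has_derivative_sum)
  then show ?thesis by (simp only: vec)
qed

lemma ratio_has_derivative:
  fixes x :: "'a::real_normed_vector \<Rightarrow> weight_vec" and lab :: "'m::finite \<Rightarrow> nat"
  assumes x: "\<And>j. j < r - 1 \<Longrightarrow> ((\<lambda>y. x y (a j)) has_derivative (\<lambda>h. \<xi> h (a j))) (at y)"
    "\<And>j. j < r - 1 \<Longrightarrow> ((\<lambda>y. x y (partner c (a j))) has_derivative (\<lambda>h. \<xi> h (partner c (a j)))) (at y)"
    and nz: "\<And>j. j < r - 1 \<Longrightarrow> x y (a j) \<noteq> 0 \<and> x y (partner c (a j)) \<noteq> 0 \<and> s j \<noteq> 0"
    and lab: "bij_betw lab UNIV {1..r - 3}" and r: "4 \<le> r"
  shows "((\<lambda>y. ratio_point lab (\<lambda>j. face_coord c a s j (x y))) has_derivative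
    (\<lambda>h. ratio_tangent lab (\<lambda>j. face_coord c a s j (x y))
      (\<lambda>j. \<xi> h (a j) / x y (a j) + \<xi> h (partner c (a j)) / x y (partner c (a j))))) (at y)"
  unfolding ratio_point_def ratio_tangent_def
proof (rule has_derivative_vec_lambda)
  fix k
  have "lab k \<in> {1..r - 3}" using lab by (auto simp: bij_betw_def)
  then have k: "lab k < r - 1" using r by auto
  have 0: "0 < r - 1" using r by simp
  note dk = x(1)[OF k] x(2)[OF k] and d0 = x(1)[OF 0] x(2)[OF 0]
  let ?u = "\<lambda>j y. s j * x y (a j) * x y (partner c (a j))"
  let ?du = "\<lambda>j h. s j * (x y (a j) * \<xi> h (partner c (a j)) + \<xi> h (a j) * x y (partner c (a j)))"
  have u: "(?u j has_derivative ?du j) (at y)" if "j < r - 1" for j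
    unfolding mult.assoc by (intro has_derivative_mult_right has_derivative_mult x that)
  have nz0: "?u 0 y \<noteq> 0" using nz[OF 0] by simp
  have "((\<lambda>y. ?u (lab k) y / ?u 0 y) has_derivative
      (\<lambda>h. (?du (lab k) h * ?u 0 y - ?u (lab k) y * ?du 0 h) / (?u 0 y * ?u 0 y))) (at y)"
    by (rule has_derivative_divide'[OF u[OF k] u[OF 0] nz0])
  moreover have "(?du (lab k) h * ?u 0 y - ?u (lab k) y * ?du 0 h) / (?u 0 y * ?u 0 y) =
      ?u (lab k) y / ?u 0 y * (\<xi> h (a (lab k)) / x y (a (lab k)) + \<xi> h (partner c (a (lab k))) / x y (partner c (a (lab k)))
        - (\<xi> h (a 0) / x y (a 0) + \<xi> h (partner c (a 0)) / x y (partner c (a 0))))" for h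
  proof -
    have du: "?du j h = ?u j y * (\<xi> h (a j) / x y (a j) + \<xi> h (partner c (a j)) / x y (partner c (a j)))" if "j < r - 1" for j
      using nz[OF that] by (simp add: field_simps)
    show ?thesis unfolding du[OF k] du[OF 0] using nz0 by (simp add: field_simps)
  qed
  ultimately show "((\<lambda>y. face_coord c a s (lab k) (x y) / face_coord c a s 0 (x y)) has_derivative
      (\<lambda>h. face_coord c a s (lab k) (x y) / face_coord c a s 0 (x y) *
        (\<xi> h (a (lab k)) / x y (a (lab k)) + \<xi> h (partner c (a (lab k))) / x y (partner c (a (lab k)))
        - (\<xi> h (a 0) / x y (a 0) + \<xi> h (partner c (a 0)) / x y (partner c (a 0)))))) (at y)"
    unfolding face_coord_def by simp
qed

lemma Omega_log_data:
  fixes \<xi> :: "nat \<Rightarrow> weight_vec"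
  assumes lab: "bij_betw lab UNIV {1..r - 3}" and r: "4 \<le> r"
    and nz: "\<And>j. j < r - 1 \<Longrightarrow> x (a j) \<noteq> 0 \<and> x (partner c (a j)) \<noteq> 0 \<and> (s j = 1 \<or> s j = - 1)"
    and quadric: "(\<Sum>j<r - 1. s j * x (a j) * x (partner c (a j))) = 0"
    and tangent: "\<And>i. i < r - 3 \<Longrightarrow> (\<Sum>j<r - 1. s j * (x (a j) * \<xi> i (partner c (a j)) + \<xi> i (a j) * x (partner c (a j)))) = 0"
  shows "Omega r lab (ratio_point lab (\<lambda>j. face_coord c a s j x))
      (\<lambda>i. ratio_tangent lab (\<lambda>j. face_coord c a s j x)
        (\<lambda>j. \<xi> i (a j) / x (a j) + \<xi> i (partner c (a j)) / x (partner c (a j)))) =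
    pairdet r c a (log_data x \<xi>)"
proof -
  let ?u = "\<lambda>j. face_coord c a s j x"
  let ?\<theta> = "\<lambda>i j. \<xi> i (a j) / x (a j) + \<xi> i (partner c (a j)) / x (partner c (a j))"
  have "Omega r lab (ratio_point lab ?u) (\<lambda>i. ratio_tangent lab ?u (?\<theta> i)) =
    mdet (r - 1) (\<lambda>k j. if k = 0 then 1 else if k = 1 then of_real (ln (cmod (?u j))) else ?\<theta> (k - 2) j)"
  proof (rule Omega_ratio[OF lab r])
    show "?u j \<noteq> 0" if "j < r - 1" for j using nz[OF that] by (auto simp: face_coord_def)
    show "(\<Sum>j<r - 1. ?u j) = 0" using quadric by (simp add: face_coord_def)
    show "(\<Sum>j<r - 1. ?u j * ?\<theta> i j) = 0" if i: "i < r - 3" for i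
    proof -
      have "(\<Sum>j<r - 1. ?u j * ?\<theta> i j) =
          (\<Sum>j<r - 1. s j * (x (a j) * \<xi> i (partner c (a j)) + \<xi> i (a j) * x (partner c (a j))))"
      proof (rule sum.cong)
        fix j assume "j \<in> {..<r - 1}"
        then have "x (a j) \<noteq> 0" "x (partner c (a j)) \<noteq> 0" using nz by auto
        then show "?u j * ?\<theta> i j = s j * (x (a j) * \<xi> i (partner c (a j)) + \<xi> i (a j) * x (partner c (a j)))"
          by (simp add: face_coord_def field_simps)
      qed simp
      then show ?thesis using tangent[OF i] by simp
    qed
  qed
  also have "\<dots> = pairdet r c a (log_data x \<xi>)"
    unfolding pairdet_def
  proof (rule mdet_cong)
    fix k j assume "j < r - 1"
    then have "x (a j) \<noteq> 0" "x (partner c (a j)) \<noteq> 0" "cmod (s j) = 1" using nz[of j] by auto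
    then show "(if k = 0 then 1 else if k = 1 then of_real (ln (cmod (?u j))) else ?\<theta> (k - 2) j) =
        (if k = 0 then 1 else log_data x \<xi> (k - 1) (a j) + log_data x \<xi> (k - 1) (partner c (a j)))"
      by (auto simp: log_data_def face_coord_def norm_mult ln_mult numeral_2_eq_2)
  qed
  finally show ?thesis .
qed

section \<open>Polynomials on the affine space and on the cone\<close>

lemma affine_polynomial_differentiable:
  assumes "f \<in> affine_polynomials"
  shows "f differentiable (at y)"
  using assms
proof induction
  case (generator f)
  then obtain k where "f = (\<lambda>y. y $ k)" by auto
  then show ?case
    by (simp add: bounded_linear_imp_differentiable bounded_linear_vec_nth)
qed auto

lemma affine_polynomial_line:
  assumes "f \<in> affine_polynomials"
  shows "poly_curve (\<lambda>s. f (y + s *s w))"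
  using assms
proof induction
  case (generator f)
  then obtain k where "f = (\<lambda>y. y $ k)" by auto
  then show ?case
    by (simp add: poly_curve_add poly_curve_mult poly_curve_id poly_curve_const)
qed (auto intro: poly_curve_add poly_curve_mult poly_curve_const)

lemma poly_curve_zero:
  assumes "poly_curve f" "poly_curve q" "q s1 \<noteq> 0" "\<And>s. q s \<noteq> 0 \<Longrightarrow> f s = 0"
  shows "f s0 = 0"
proof -
  have "\<forall>\<^sub>F s in at s0. f s = 0"
    using poly_curve_eventually_nonzero[OF assms(2,3)] by eventually_elim (rule assms(4))
  then have "(f \<longlongrightarrow> 0) (at s0)" by (rule tendsto_eventually)
  moreover have "(f \<longlongrightarrow> f s0) (at s0)"
    using poly_curve_isCont[OF assms(1)] by (simp add: isCont_def)
  ultimately show ?thesis using tendsto_unique[of "at s0" f] by auto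
qed

text \<open>Restriction to a line through the two points reduces this to polynomials in one variable.\<close>

lemma affine_polynomial_zero:
  assumes "f \<in> affine_polynomials" "q \<in> affine_polynomials" "q y1 \<noteq> 0" "\<And>y. q y \<noteq> 0 \<Longrightarrow> f y = 0"
  shows "f y = 0"
proof -
  note line = affine_polynomial_line[where y = y and w = "y1 - y"]
  have "f (y + 0 *s (y1 - y)) = 0"
    by (rule poly_curve_zero[OF line[OF assms(1)] line[OF assms(2)], of 1]) (use assms(3,4) in auto)
  then show ?thesis by simp
qed

lemma affine_polynomial_sum:
  "(\<And>j. j \<in> S \<Longrightarrow> f j \<in> polynomial_algebra X) \<Longrightarrow> (\<lambda>y. \<Sum>j\<in>S. f j y) \<in> polynomial_algebra X"
proof (induction S rule: infinite_finite_induct)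
  case (insert x S)
  then show ?case by (auto intro: polynomial_algebra.add)
qed (auto intro: polynomial_algebra.const)

lemma weight_polynomial_curve:
  assumes "f \<in> weight_polynomials r" "\<And>l. poly_curve (\<lambda>s. x s l)"
  shows "poly_curve (\<lambda>s. f (x s))"
  using assms(1)
proof induction
  case (generator f)
  then show ?case using assms(2) by auto
qed (auto intro: poly_curve_add poly_curve_mult poly_curve_const)

section \<open>Torus orbits\<close>

text \<open>A torus element scales the coordinate of \<open>l\<close> by a character of \<open>l\<close>, and \<open>l + (c - l)\<close> does not depend on \<open>l\<close>.  Hence
  the face maps are constant on torus orbits.\<close>

lemma torus_orbit_pairs:
  assumes "x' \<in> torus_orbit r x"
  obtains \<kappa> where "\<kappa> \<noteq> 0" "\<And>l. l \<in> lines r \<Longrightarrow> partner c l \<in> lines r \<Longrightarrow>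
    x' l * x' (partner c l) = \<kappa> * (x l * x (partner c l))"
proof -
  obtain d t where x': "x' = scale d (torus_element r t x)" and d: "d \<noteq> 0" and t: "\<forall>i<r. t i \<noteq> 0"
    using assms by (auto simp: torus_orbit_def cartan_torus_def)
  define ch where "ch l = (\<Prod>i<r. t i powi (- intersection_form r l (simple_root i)))" for l
  have ch: "ch l * ch (partner c l) = ch c" for l
    unfolding ch_def prod.distrib[symmetric]
    using t by (intro prod.cong refl) (auto simp: partner_def intersection_form_diff power_int_add[symmetric])
  have "ch c \<noteq> 0" using t by (auto simp: ch_def)
  moreover have "x' l * x' (partner c l) = d * d * ch c * (x l * x (partner c l))"
    if "l \<in> lines r" "partner c l \<in> lines r" for l
    using that by (simp add: x' scale_def torus_element_def ch_def[symmetric] ch[of l, symmetric])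
  ultimately show ?thesis using d by (intro that[of "d * d * ch c"]) auto
qed

lemma torus_orbit_refl:
  assumes "\<And>l. l \<notin> lines r \<Longrightarrow> x l = 0"
  shows "x \<in> torus_orbit r x"
proof -
  have "torus_element r (\<lambda>_. 1) x = x"
    using assms by (auto simp: torus_element_def)
  moreover have "torus_element r (\<lambda>_. 1) \<in> cartan_torus r"
    by (auto simp: cartan_torus_def)
  ultimately have "x = scale 1 (torus_element r (\<lambda>_. 1) x) \<and> (1::complex) \<noteq> 0 \<and> torus_element r (\<lambda>_. 1) \<in> cartan_torus r"
    by (simp add: scale_def)
  then show ?thesis unfolding torus_orbit_def by blast
qed

section \<open>Smoothness of the form\<close>

lemma C_k_on_cong:
  assumes "open S" "\<And>x. x \<in> S \<Longrightarrow> f x = g x"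
  shows "C_k_on n S f \<longleftrightarrow> C_k_on n S g"
  using assms(2)
proof (induction n arbitrary: f g)
  case 0
  then show ?case by (simp cong: continuous_on_cong)
next
  case (Suc n)
  have tr: "(f has_derivative f') (at x) \<longleftrightarrow> (g has_derivative f') (at x)" if "x \<in> S" for f' x
  proof
    assume "(f has_derivative f') (at x)"
    then show "(g has_derivative f') (at x)"
      by (rule has_derivative_transform_within_open[OF _ assms(1) that Suc.prems])
  next
    assume "(g has_derivative f') (at x)"
    then show "(f has_derivative f') (at x)"
      by (rule has_derivative_transform_within_open[OF _ assms(1) that Suc.prems[symmetric]])
  qed
  then have "frechet_derivative f (at x) = frechet_derivative g (at x)" if "x \<in> S" for x
    using that by (simp add: frechet_derivative_def)
  then have "C_k_on n S (\<lambda>x. frechet_derivative f (at x) v) \<longleftrightarrow> C_k_on n S (\<lambda>x. frechet_derivative g (at x) v)" for v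
    by (intro Suc.IH) simp
  moreover have "f differentiable_on S \<longleftrightarrow> g differentiable_on S"
    using tr assms(1) by (simp add: differentiable_on_eq_differentiable_at differentiable_def)
  ultimately show ?case by simp
qed

text \<open>The complex conjugates occur since \<open>ln \<bar>L\<bar>\<close> has the derivative \<open>(dL / L + cnj (dL / L)) / 2\<close>.\<close>

inductive_set log_algebra :: "nat \<Rightarrow> ('m::finite \<Rightarrow> nat) \<Rightarrow> (complex^'m \<Rightarrow> complex) set"
  for r :: nat and lab :: "'m \<Rightarrow> nat" where
  const: "(\<lambda>_. c) \<in> log_algebra r lab"
| log: "1 \<le> i \<Longrightarrow> i \<le> r - 2 \<Longrightarrow> (\<lambda>u. of_real (ln (cmod (L_fun r lab i u)))) \<in> log_algebra r lab"
| inv: "1 \<le> i \<Longrightarrow> i \<le> r - 2 \<Longrightarrow> (\<lambda>u. inverse (L_fun r lab i u)) \<in> log_algebra r lab"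
| cnj: "1 \<le> i \<Longrightarrow> i \<le> r - 2 \<Longrightarrow> (\<lambda>u. cnj (inverse (L_fun r lab i u))) \<in> log_algebra r lab"
| add: "f \<in> log_algebra r lab \<Longrightarrow> g \<in> log_algebra r lab \<Longrightarrow> (\<lambda>u. f u + g u) \<in> log_algebra r lab"
| mult: "f \<in> log_algebra r lab \<Longrightarrow> g \<in> log_algebra r lab \<Longrightarrow> (\<lambda>u. f u * g u) \<in> log_algebra r lab"

lemma log_algebra_sum:
  "(\<And>j. j \<in> S \<Longrightarrow> f j \<in> log_algebra r lab) \<Longrightarrow> (\<lambda>y. \<Sum>j\<in>S. f j y) \<in> log_algebra r lab"
proof (induction S rule: infinite_finite_induct)
  case (insert x S)
  then show ?case by (auto intro: log_algebra.add)
qed (auto intro: log_algebra.const)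

lemma log_algebra_prod:
  "(\<And>j. j \<in> S \<Longrightarrow> f j \<in> log_algebra r lab) \<Longrightarrow> (\<lambda>y. \<Prod>j\<in>S. f j y) \<in> log_algebra r lab"
proof (induction S rule: infinite_finite_induct)
  case (insert x S)
  then show ?case by (auto intro: log_algebra.mult)
qed (auto intro: log_algebra.const)

definition L_complement :: "nat \<Rightarrow> ('m::finite \<Rightarrow> nat) \<Rightarrow> (complex^'m) set" where
  "L_complement r lab = {u. \<forall>i\<in>{1..r - 2}. L_fun r lab i u \<noteq> 0}"

lemma open_L_complement: "open (L_complement r lab)"
proof -
  have "continuous_on UNIV (L_fun r lab i)" for i
    using has_derivative_continuous[OF L_fun_has_derivative[of r lab i]]
    by (simp add: continuous_at_imp_continuous_on)
  then have "open {u. L_fun r lab i u \<noteq> 0}" for i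
    by (intro open_Collect_neq) auto
  then have "open (\<Inter>i\<in>{1..r - 2}. {u. L_fun r lab i u \<noteq> 0})" by (intro open_INT) auto
  moreover have "(\<Inter>i\<in>{1..r - 2}. {u. L_fun r lab i u \<noteq> 0}) = L_complement r lab"
    by (auto simp: L_complement_def)
  ultimately show ?thesis by simp
qed

lemma ln_cmod_has_derivative:
  fixes f :: "'a::real_normed_vector \<Rightarrow> complex"
  assumes "(f has_derivative f') (at x)" "f x \<noteq> 0"
  shows "((\<lambda>x. of_real (ln (cmod (f x))) :: complex) has_derivative
    (\<lambda>v. (f' v * inverse (f x) + cnj (f' v) * cnj (inverse (f x))) / 2)) (at x)"
proof -
  have "((\<lambda>x. ln (cmod (f x))) has_derivative (\<lambda>v. inner (sgn (f x)) (f' v) * inverse (cmod (f x)))) (at x)"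
  proof -
    have "((\<lambda>x. cmod (f x)) has_derivative (\<lambda>v. inner (f' v) (sgn (f x)))) (at x)"
      by (rule has_derivative_compose[OF assms(1) has_derivative_norm[OF assms(2)]])
    then have "((\<lambda>x. cmod (f x)) has_derivative (\<lambda>v. inner (sgn (f x)) (f' v))) (at x)"
      by (simp only: inner_commute)
    then show ?thesis using assms(2) by (intro has_derivative_ln) simp_all
  qed
  then have "((\<lambda>x. of_real (ln (cmod (f x))) :: complex) has_derivative
      (\<lambda>v. of_real (inner (sgn (f x)) (f' v) * inverse (cmod (f x))))) (at x)"
    by (rule has_derivative_of_real)
  moreover have "complex_of_real (inner (sgn (f x)) (f' v) * inverse (cmod (f x))) =
      (f' v * inverse (f x) + cnj (f' v) * cnj (inverse (f x))) / 2" for v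
  proof -
    have e1: "f' v * inverse (f x) + cnj (f' v) * cnj (inverse (f x)) = of_real (2 * Re (f' v * inverse (f x)))"
      using complex_add_cnj[of "f' v * inverse (f x)"] by simp
    have e2: "Re (f' v * inverse (f x)) = inner (sgn (f x)) (f' v) * inverse (cmod (f x))"
    proof -
      have "sgn (f x) = of_real (inverse (cmod (f x))) * f x" by (simp add: sgn_eq divide_inverse mult.commute)
      moreover have "inverse (f x) = of_real (inverse (cmod (f x)) ^ 2) * cnj (f x)"
      proof -
        have "complex_of_real (inverse (cmod (f x)) ^ 2) = inverse (f x * cnj (f x))"
          by (simp only: power_inverse of_real_inverse complex_norm_square)
        then show ?thesis using assms(2) by simp
      qed
      moreover have "Re (y * (of_real (a ^ 2) * cnj z)) = inner (of_real a * z) y * a" for a y z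
        by (simp add: inner_complex_def algebra_simps power2_eq_square)
      ultimately show ?thesis by (simp only:)
    qed
    show ?thesis unfolding e1 e2 by simp
  qed
  ultimately show ?thesis by (simp only:)
qed

lemma log_algebra_derivative:
  assumes "f \<in> log_algebra r lab"
  shows "\<exists>f'. (\<forall>v. (\<lambda>u. f' u v) \<in> log_algebra r lab) \<and> (\<forall>u\<in>L_complement r lab. (f has_derivative f' u) (at u))"
  using assms
proof induction
  case (const c)
  show ?case by (rule exI[of _ "\<lambda>_ _. 0"]) (auto intro: log_algebra.const)
next
  case (log i)
  let ?f' = "\<lambda>u v. (L_linear r lab i v * inverse (L_fun r lab i u) + cnj (L_linear r lab i v) * cnj (inverse (L_fun r lab i u))) * (1 / 2)"
  have "(\<lambda>u. ?f' u v) \<in> log_algebra r lab" for v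
    using log by (intro log_algebra.add log_algebra.mult log_algebra.const log_algebra.inv log_algebra.cnj)
  moreover have "((\<lambda>u. of_real (ln (cmod (L_fun r lab i u))) :: complex) has_derivative ?f' u) (at u)"
    if "u \<in> L_complement r lab" for u
    using ln_cmod_has_derivative[OF L_fun_has_derivative[of r lab i u]] that log by (simp add: L_complement_def)
  ultimately show ?case by (intro exI[of _ ?f']) blast
next
  case (inv i)
  let ?f' = "\<lambda>u v. (- L_linear r lab i v) * (inverse (L_fun r lab i u) * inverse (L_fun r lab i u))"
  have "(\<lambda>u. ?f' u v) \<in> log_algebra r lab" for v
    using inv by (intro log_algebra.mult log_algebra.const log_algebra.inv)
  moreover have "((\<lambda>u. inverse (L_fun r lab i u)) has_derivative ?f' u) (at u)"
    if "u \<in> L_complement r lab" for u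
  proof -
    have nz: "L_fun r lab i u \<noteq> 0" using that inv by (simp add: L_complement_def)
    show ?thesis
      by (rule has_derivative_eq_rhs[OF Deriv.has_derivative_inverse[OF nz L_fun_has_derivative]])
        (simp add: fun_eq_iff mult_ac)
  qed
  ultimately show ?case by (intro exI[of _ ?f']) blast
next
  case (cnj i)
  let ?f' = "\<lambda>u v. cnj (- L_linear r lab i v) * (cnj (inverse (L_fun r lab i u)) * cnj (inverse (L_fun r lab i u)))"
  have "(\<lambda>u. ?f' u v) \<in> log_algebra r lab" for v
    using cnj by (intro log_algebra.mult log_algebra.const log_algebra.cnj)
  moreover have "((\<lambda>u. cnj (inverse (L_fun r lab i u))) has_derivative ?f' u) (at u)"
    if "u \<in> L_complement r lab" for u
  proof -
    have nz: "L_fun r lab i u \<noteq> 0" using that cnj by (simp add: L_complement_def)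
    show ?thesis
      by (rule has_derivative_eq_rhs[OF bounded_linear.has_derivative[OF bounded_linear_cnj
              Deriv.has_derivative_inverse[OF nz L_fun_has_derivative]]])
        (simp add: fun_eq_iff mult_ac)
  qed
  ultimately show ?case by (intro exI[of _ ?f']) blast
next
  case (add f g)
  then obtain f' g' where "\<And>v. (\<lambda>u. f' u v) \<in> log_algebra r lab" "\<And>v. (\<lambda>u. g' u v) \<in> log_algebra r lab"
    "\<And>u. u \<in> L_complement r lab \<Longrightarrow> (f has_derivative f' u) (at u)"
    "\<And>u. u \<in> L_complement r lab \<Longrightarrow> (g has_derivative g' u) (at u)" by blast
  then show ?case
    by (intro exI[of _ "\<lambda>u v. f' u v + g' u v"]) (auto intro: log_algebra.add has_derivative_add)
next
  case (mult f g)
  then obtain f' g' where *: "\<And>v. (\<lambda>u. f' u v) \<in> log_algebra r lab" "\<And>v. (\<lambda>u. g' u v) \<in> log_algebra r lab"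
    "\<And>u. u \<in> L_complement r lab \<Longrightarrow> (f has_derivative f' u) (at u)"
    "\<And>u. u \<in> L_complement r lab \<Longrightarrow> (g has_derivative g' u) (at u)" by blast
  then show ?case
    using mult.hyps by (intro exI[of _ "\<lambda>u v. f u * g' u v + f' u v * g u"])
      (auto intro!: log_algebra.add log_algebra.mult has_derivative_mult)
qed

lemma log_algebra_C_k_on:
  assumes "f \<in> log_algebra r lab"
  shows "C_k_on n (L_complement r lab) f"
  using assms
proof (induction n arbitrary: f)
  case 0
  obtain f' where "\<forall>u\<in>L_complement r lab. (f has_derivative f' u) (at u)"
    using log_algebra_derivative[OF 0] by blast
  then have "\<forall>u\<in>L_complement r lab. isCont f u"
    using has_derivative_continuous by blast
  then show ?case by (simp add: continuous_at_imp_continuous_on)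
next
  case (Suc n)
  obtain f' where f': "\<And>v. (\<lambda>u. f' u v) \<in> log_algebra r lab" "\<forall>u\<in>L_complement r lab. (f has_derivative f' u) (at u)"
    using log_algebra_derivative[OF Suc.prems] by blast
  have "f differentiable_on L_complement r lab"
    unfolding differentiable_on_def
  proof
    fix u assume "u \<in> L_complement r lab"
    then have "f differentiable (at u)" using f'(2) by (intro differentiableI) (rule bspec)
    then show "f differentiable (at u within L_complement r lab)" by (rule differentiable_at_withinI)
  qed
  moreover have "C_k_on n (L_complement r lab) (\<lambda>u. frechet_derivative f (at u) v)" for v
  proof -
    have *: "frechet_derivative f (at u) v = f' u v" if "u \<in> L_complement r lab" for u
      using frechet_derivative_at[OF bspec[OF f'(2) that]] by simp
    have "C_k_on n (L_complement r lab) (\<lambda>u. frechet_derivative f (at u) v) \<longleftrightarrow>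
        C_k_on n (L_complement r lab) (\<lambda>u. f' u v)"
      by (rule C_k_on_cong[OF open_L_complement *])
    then show ?thesis using Suc.IH[OF f'(1)] by simp
  qed
  ultimately show ?case by simp
qed

lemma Omega_differential_form:
  assumes r: "4 \<le> r"
  shows "differential_form (r - 3) (L_complement r lab) (\<lambda>u v. c * Omega r lab u v)"
proof -
  have set: "set (remove1 i [1..<r - 1]) \<subseteq> {1..r - 2}" for i
    using set_remove1_subset[of i "[1..<r - 1]"] by auto
  have len: "length (remove1 i [1..<r - 1]) = r - 3" if "i \<in> {1..r - 2}" for i
  proof -
    have "i \<in> set [1..<r - 1]" using that r by auto
    then have "length (remove1 i [1..<r - 1]) = length [1..<r - 1] - 1" by (simp only: length_remove1 if_True)
    then show ?thesis by simp
  qed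
  define W where "W i u v = mdet (r - 3) (\<lambda>k j. L_linear r lab (remove1 i [1..<r - 1] ! j) (v k) /
    L_fun r lab (remove1 i [1..<r - 1] ! j) u)" for i u and v :: "nat \<Rightarrow> complex^'a"
  have Omega: "Omega r lab u v = (\<Sum>i=1..r - 2. (- 1) ^ (i - 1) * of_real (ln (cmod (L_fun r lab i u))) * W i u v)" for u v
    unfolding Omega_def
  proof (rule sum.cong)
    fix i assume i: "i \<in> {1..r - 2}"
    have "wedge (map (\<lambda>j. dln (L_fun r lab j)) (remove1 i [1..<r - 1])) u v = W i u v"
      unfolding W_def using len[OF i]
      by (subst wedge_mdet[of _ "r - 3"]) (auto intro!: mdet_cong simp: dln_L_fun)
    then show "(- 1) ^ (i - 1) * of_real (ln (cmod (L_fun r lab i u))) * wedge (map (\<lambda>j. dln (L_fun r lab j)) (remove1 i [1..<r - 1])) u v =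
       (- 1) ^ (i - 1) * of_real (ln (cmod (L_fun r lab i u))) * W i u v" by simp
  qed simp
  have W_local: "W i u v = W i u w" if "\<forall>k<r - 3. v k = w k" for i u v w
    unfolding W_def using that by (intro mdet_cong) auto
  have L_lin: "L_linear r lab j (b *s x + y) = b * L_linear r lab j x + L_linear r lab j y" for j b x y
    by (simp add: L_linear_def sum.distrib sum_distrib_left)
  have W_linear: "W i u (v(k := b *s x + y)) = b * W i u (v(k := x)) + W i u (v(k := y))" if "k < r - 3" for i u v k b x y
  proof -
    let ?f = "\<lambda>z j. L_linear r lab (remove1 i [1..<r - 1] ! j) z / L_fun r lab (remove1 i [1..<r - 1] ! j) u"
    have up: "W i u (v(k := z)) = mdet (r - 3) (\<lambda>k' j. if k' = k then ?f z j else ?f (v k') j)" for z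
      unfolding W_def by (intro mdet_cong) auto
    have "W i u (v(k := b *s x + y)) = mdet (r - 3) (\<lambda>k' j. if k' = k then
        \<Sum>l\<in>{0, 1::nat}. (if l = 0 then b else 1) * ?f (if l = 0 then x else y) j else ?f (v k') j)"
      unfolding up by (intro mdet_cong) (simp add: L_lin add_divide_distrib)
    also have "\<dots> = (\<Sum>l\<in>{0, 1::nat}. (if l = 0 then b else 1) *
        mdet (r - 3) (\<lambda>k' j. if k' = k then ?f (if l = 0 then x else y) j else ?f (v k') j))"
      by (rule mdet_linear_row[OF that])
    finally show ?thesis by (simp add: up)
  qed
  have W_alt: "W i u v = 0" if "k < r - 3" "k' < r - 3" "k \<noteq> k'" "v k = v k'" for i u v k k'
    unfolding W_def using that by (intro mdet_equal_rows[of k _ k']) auto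
  have smooth: "(\<lambda>u. c * Omega r lab u v) \<in> log_algebra r lab" for v
    unfolding Omega W_def mdet_leibniz divide_inverse
  proof (intro log_algebra.mult log_algebra.const log_algebra_sum log_algebra_prod log_algebra.log log_algebra.inv)
    fix i p j assume i: "i \<in> {1..r - 2}" and p: "p \<in> {p. p permutes {0..<r - 3}}" and j: "j \<in> {0..<r - 3}"
    then have "p j < r - 3" using permutes_in_image[of p "{0..<r - 3}" j] by simp
    then have "remove1 i [1..<r - 1] ! p j \<in> set (remove1 i [1..<r - 1])" using len[OF i] by (intro nth_mem) simp
    then have "remove1 i [1..<r - 1] ! p j \<in> {1..r - 2}" using set by blast
    then show "1 \<le> remove1 i [1..<r - 1] ! p j" "remove1 i [1..<r - 1] ! p j \<le> r - 2" by auto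
  qed auto
  show ?thesis
    unfolding differential_form_def
  proof (intro conjI ballI allI impI open_L_complement)
    show "c * Omega r lab u v = c * Omega r lab u w" if "\<forall>k<r - 3. v k = w k" for u v w
      unfolding Omega using W_local[OF that] by simp
    show "c * Omega r lab u (v(k := b *s x + y)) = b * (c * Omega r lab u (v(k := x))) + c * Omega r lab u (v(k := y))"
      if "k < r - 3" for u v k b x y
      unfolding Omega W_linear[OF that] by (simp add: algebra_simps sum.distrib sum_distrib_left)
    show "c * Omega r lab u v = 0" if "k < r - 3 \<and> k' < r - 3 \<and> k \<noteq> k' \<and> v k = v k'" for u v k k'
      unfolding Omega using W_alt[of k k' v] that by simp
    show "C_k_on n (L_complement r lab) (\<lambda>u. c * Omega r lab u v)" for v n
      by (rule log_algebra_C_k_on[OF smooth])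
  qed
qed

section \<open>The Gelfand-MacPherson web\<close>

locale GM_chart = quadric_frames r A s
  for r :: nat and A :: "pic \<Rightarrow> nat \<Rightarrow> pic" and s :: "pic \<Rightarrow> nat \<Rightarrow> complex" +
  fixes \<phi> :: "complex^'n \<Rightarrow> weight_vec" and lab :: "'m::finite \<Rightarrow> nat"
  assumes chart: "birational_chart r \<phi>" and lab: "bij_betw lab UNIV {1..r - 3}"
begin

lemma \<phi>_polynomial: "l \<in> lines r \<Longrightarrow> (\<lambda>y. \<phi> y l) \<in> affine_polynomials"
  using chart by (simp add: birational_chart_def)

lemma \<phi>_support: "l \<notin> lines r \<Longrightarrow> \<phi> y l = 0"
  using chart by (simp add: birational_chart_def)

lemma \<phi>_orbit: "\<phi> y \<in> torus_orbit r (\<phi> y)"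
  by (rule torus_orbit_refl) (rule \<phi>_support)

text \<open>Where \<open>\<phi> y\<close> lies in the torus orbit of a point of the cone, the equation holds since a torus element multiplies it by a
  scalar.  Such \<open>y\<close> contain the complement of a hypersurface, so the equation holds as a polynomial identity.\<close>

lemma \<phi>_quadric:
  assumes c: "c \<in> conics r"
  shows "(\<Sum>j<r - 1. s c j * \<phi> y (A c j) * \<phi> y (partner c (A c j))) = 0"
proof -
  note fl = conic_frame_lines[OF frame[OF c]]
  have "generically affine_polynomials UNIV (\<lambda>y. torus_orbit r (\<phi> y) \<in> GM_quotient r)"
    using chart by (simp add: birational_chart_def)
  then obtain q y1 where q: "q \<in> affine_polynomials" "q y1 \<noteq> 0"
    "\<And>y. q y \<noteq> 0 \<Longrightarrow> torus_orbit r (\<phi> y) \<in> GM_quotient r"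
    unfolding generically_def by blast
  show ?thesis
  proof (rule affine_polynomial_zero[OF _ q(1,2)])
    show "(\<lambda>y. \<Sum>j<r - 1. s c j * \<phi> y (A c j) * \<phi> y (partner c (A c j))) \<in> affine_polynomials"
      using fl by (intro affine_polynomial_sum polynomial_algebra.mult polynomial_algebra.const \<phi>_polynomial) auto
  next
    fix y assume "q y \<noteq> 0"
    then obtain x where x: "x \<in> stable_cone r" "torus_orbit r (\<phi> y) = torus_orbit r x"
      using q(3) by (auto simp: GM_quotient_def)
    then have cone: "x \<in> minuscule_cone r" by (simp add: stable_cone_def)
    obtain \<kappa> where \<kappa>: "\<And>l. l \<in> lines r \<Longrightarrow> partner c l \<in> lines r \<Longrightarrow>
        \<phi> y l * \<phi> y (partner c l) = \<kappa> * (x l * x (partner c l))"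
      using torus_orbit_pairs[of "\<phi> y" r x c] \<phi>_orbit x(2) by metis
    have "(\<Sum>j<r - 1. s c j * \<phi> y (A c j) * \<phi> y (partner c (A c j))) =
        (\<Sum>j<r - 1. \<kappa> * (s c j * x (A c j) * x (partner c (A c j))))"
      using \<kappa>[OF fl] by (intro sum.cong) (auto simp: mult.assoc mult.left_commute)
    also have "\<dots> = 0"
      using quadric[OF c cone] by (simp add: sum_distrib_left[symmetric])
    finally show "(\<Sum>j<r - 1. s c j * \<phi> y (A c j) * \<phi> y (partner c (A c j))) = 0" .
  qed
qed

abbreviation face :: "pic \<Rightarrow> complex^'n \<Rightarrow> complex^'m" where
  "face c \<equiv> face_map lab \<phi> c (A c) (s c)"

abbreviation coord :: "pic \<Rightarrow> weight_vec \<Rightarrow> nat \<Rightarrow> complex" where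
  "coord c x j \<equiv> face_coord c (A c) (s c) j x"

lemma face_ratio: "face c y = ratio_point lab (coord c (\<phi> y))"
  by (simp add: face_map_def ratio_point_def)

lemma coord_nonzero:
  assumes "c \<in> conics r" "j < r - 1"
  shows "coord c x j \<noteq> 0 \<longleftrightarrow> x (A c j) \<noteq> 0 \<and> x (partner c (A c j)) \<noteq> 0"
  using sign[OF assms] by (auto simp: face_coord_def)

text \<open>The functions \<open>L\<^sub>i\<close> are the ratios \<open>u\<^sub>i / u\<^sub>0\<close> up to sign.\<close>

lemma web_domain_iff:
  "y \<in> web_domain r lab \<phi> A s \<longleftrightarrow> (\<forall>c\<in>conics r. \<forall>j<r - 1. coord c (\<phi> y) j \<noteq> 0)"
proof -
  have "coord c (\<phi> y) 0 \<noteq> 0 \<and> (\<forall>i\<in>{1..r - 2}. L_fun r lab i (face c y) \<noteq> 0) \<longleftrightarrow>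
      (\<forall>j<r - 1. coord c (\<phi> y) j \<noteq> 0)" if c: "c \<in> conics r" for c
  proof (cases "coord c (\<phi> y) 0 = 0")
    case True
    moreover have "0 < r - 1" using r by simp
    ultimately show ?thesis by blast
  next
    case False
    have sum: "(\<Sum>j<r - 1. coord c (\<phi> y) j) = 0" using \<phi>_quadric[OF c] by (simp add: face_coord_def)
    have L: "L_fun r lab i (face c y) \<noteq> 0 \<longleftrightarrow> coord c (\<phi> y) i \<noteq> 0" if "i \<in> {1..r - 2}" for i
      unfolding face_ratio using L_fun_ratio_point[OF lab r(1) False sum, of i] that False by auto
    have "(\<forall>j<r - 1. coord c (\<phi> y) j \<noteq> 0) \<longleftrightarrow> coord c (\<phi> y) 0 \<noteq> 0 \<and> (\<forall>i\<in>{1..r - 2}. coord c (\<phi> y) i \<noteq> 0)"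
    proof (intro iffI conjI ballI allI impI)
      fix j assume *: "coord c (\<phi> y) 0 \<noteq> 0 \<and> (\<forall>i\<in>{1..r - 2}. coord c (\<phi> y) i \<noteq> 0)" and j: "j < r - 1"
      show "coord c (\<phi> y) j \<noteq> 0"
      proof (cases "j = 0")
        case True
        then show ?thesis using * by simp
      next
        case False
        then have "j \<in> {1..r - 2}" using j by auto
        then show ?thesis using * by blast
      qed
    next
      assume *: "\<forall>j<r - 1. coord c (\<phi> y) j \<noteq> 0"
      show "coord c (\<phi> y) 0 \<noteq> 0" by (rule False)
      fix i assume "i \<in> {1..r - 2}"
      then have "i < r - 1" using r by auto
      then show "coord c (\<phi> y) i \<noteq> 0" using * by blast
    qed
    then show ?thesis using L by (simp del: One_nat_def)
  qed
  then show ?thesis unfolding web_domain_def by blast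
qed

definition \<phi>' :: "complex^'n \<Rightarrow> complex^'n \<Rightarrow> weight_vec" where
  "\<phi>' y v l = frechet_derivative (\<lambda>y. \<phi> y l) (at y) v"

lemma \<phi>_has_derivative:
  assumes "l \<in> lines r"
  shows "((\<lambda>y. \<phi> y l) has_derivative (\<lambda>v. \<phi>' y v l)) (at y)"
  unfolding \<phi>'_def using affine_polynomial_differentiable[OF \<phi>_polynomial[OF assms], of y]
  by (simp add: frechet_derivative_works)

lemma \<phi>_tangent:
  assumes c: "c \<in> conics r"
  shows "(\<Sum>j<r - 1. s c j * (\<phi> y (A c j) * \<phi>' y v (partner c (A c j)) + \<phi>' y v (A c j) * \<phi> y (partner c (A c j)))) = 0"
proof -
  note fl = conic_frame_lines[OF frame[OF c]]
  have "((\<lambda>y. \<Sum>j<r - 1. s c j * (\<phi> y (A c j) * \<phi> y (partner c (A c j)))) has_derivative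
      (\<lambda>v. \<Sum>j<r - 1. s c j * (\<phi> y (A c j) * \<phi>' y v (partner c (A c j)) + \<phi>' y v (A c j) * \<phi> y (partner c (A c j))))) (at y)"
    using fl by (intro has_derivative_sum has_derivative_mult_right has_derivative_mult \<phi>_has_derivative) auto
  moreover have "(\<lambda>y. \<Sum>j<r - 1. s c j * (\<phi> y (A c j) * \<phi> y (partner c (A c j)))) = (\<lambda>_. 0)"
    using \<phi>_quadric[OF c] by (simp add: mult.assoc)
  ultimately have "((\<lambda>_. 0) has_derivative
      (\<lambda>v. \<Sum>j<r - 1. s c j * (\<phi> y (A c j) * \<phi>' y v (partner c (A c j)) + \<phi>' y v (A c j) * \<phi> y (partner c (A c j))))) (at y)"
    by simp
  from fun_cong[OF has_derivative_unique[OF this has_derivative_const], of v] show ?thesis .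
qed

lemma face_has_derivative:
  assumes c: "c \<in> conics r" and nz: "\<And>j. j < r - 1 \<Longrightarrow> coord c (\<phi> y) j \<noteq> 0"
  shows "(face c has_derivative (\<lambda>v. ratio_tangent lab (coord c (\<phi> y))
      (\<lambda>j. \<phi>' y v (A c j) / \<phi> y (A c j) + \<phi>' y v (partner c (A c j)) / \<phi> y (partner c (A c j))))) (at y)"
proof -
  note fl = conic_frame_lines[OF frame[OF c]]
  have "((\<lambda>y. ratio_point lab (coord c (\<phi> y))) has_derivative (\<lambda>v. ratio_tangent lab (coord c (\<phi> y))
      (\<lambda>j. \<phi>' y v (A c j) / \<phi> y (A c j) + \<phi>' y v (partner c (A c j)) / \<phi> y (partner c (A c j))))) (at y)"
  proof (rule ratio_has_derivative[where x = \<phi> and \<xi> = "\<phi>' y" and a = "A c" and c = c and s = "s c", OF _ _ _ lab r(1)])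
    fix j assume j: "j < r - 1"
    have "s c j \<noteq> 0" using sign[OF c j] by auto
    then show "\<phi> y (A c j) \<noteq> 0 \<and> \<phi> y (partner c (A c j)) \<noteq> 0 \<and> s c j \<noteq> 0"
      using nz[OF j] unfolding coord_nonzero[OF c j] by blast
    show "((\<lambda>y. \<phi> y (A c j)) has_derivative (\<lambda>v. \<phi>' y v (A c j))) (at y)"
      by (rule \<phi>_has_derivative[OF fl(1)[OF j]])
    show "((\<lambda>y. \<phi> y (partner c (A c j))) has_derivative (\<lambda>v. \<phi>' y v (partner c (A c j)))) (at y)"
      by (rule \<phi>_has_derivative[OF fl(2)[OF j]])
  qed
  then show ?thesis by (simp only: face_ratio[abs_def])
qed

lemma pullback_Omega:
  assumes y: "y \<in> web_domain r lab \<phi> A s" and c: "c \<in> conics r"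
  shows "pullback (face c) (Omega r lab) y v = pairdet r c (A c) (log_data (\<phi> y) (\<lambda>i. \<phi>' y (v i)))"
proof -
  have nz: "coord c (\<phi> y) j \<noteq> 0" if "j < r - 1" for j
    using y c that by (simp add: web_domain_iff)
  have "frechet_derivative (face c) (at y) = (\<lambda>v. ratio_tangent lab (coord c (\<phi> y))
      (\<lambda>j. \<phi>' y v (A c j) / \<phi> y (A c j) + \<phi>' y v (partner c (A c j)) / \<phi> y (partner c (A c j))))"
    by (rule frechet_derivative_at[OF face_has_derivative[OF c nz], symmetric])
  then have "pullback (face c) (Omega r lab) y v = Omega r lab (ratio_point lab (coord c (\<phi> y)))
      (\<lambda>i. ratio_tangent lab (coord c (\<phi> y))
        (\<lambda>j. \<phi>' y (v i) (A c j) / \<phi> y (A c j) + \<phi>' y (v i) (partner c (A c j)) / \<phi> y (partner c (A c j))))"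
    by (simp add: pullback_def face_ratio)
  also have "\<dots> = pairdet r c (A c) (log_data (\<phi> y) (\<lambda>i. \<phi>' y (v i)))"
  proof (rule Omega_log_data[OF lab r(1) _ \<phi>_quadric[OF c] \<phi>_tangent[OF c]])
    fix j assume j: "j < r - 1"
    then show "\<phi> y (A c j) \<noteq> 0 \<and> \<phi> y (partner c (A c j)) \<noteq> 0 \<and> (s c j = 1 \<or> s c j = - 1)"
      using nz[OF j] coord_nonzero[OF c j] sign[OF c j] by blast
  qed
  finally show ?thesis .
qed

definition hlog_sign :: "pic \<Rightarrow> int" where
  "hlog_sign c = orientation r c (A c)"

lemma hlog_sign_unit: "c \<in> conics r \<Longrightarrow> hlog_sign c = 1 \<or> hlog_sign c = - 1"
  unfolding hlog_sign_def by (rule orientation_frame_unit[OF r _ frame])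

lemma hlog_relation_hlog_sign: "hlog_relation r lab \<phi> A s hlog_sign"
  unfolding hlog_relation_def
proof (intro ballI allI)
  fix y v assume y: "y \<in> web_domain r lab \<phi> A s"
  have "(\<Sum>c\<in>conics r. of_int (hlog_sign c) * pullback (face c) (Omega r lab) y v) =
      hlog_sum (log_data (\<phi> y) (\<lambda>i. \<phi>' y (v i)))"
    unfolding hlog_sum_def
    by (rule sum.cong) (simp_all only: oriented_det_def hlog_sign_def pullback_Omega[OF y])
  then show "(\<Sum>c\<in>conics r. of_int (hlog_sign c) * pullback (face c) (Omega r lab) y v) = 0"
    by (simp only: hlog_sum_eq_0)
qed

lemma abelian_relation_hlog:
  assumes "hlog_relation r lab \<phi> A s \<epsilon>"
  shows "abelian_relation (r - 3) (conics r) (web_domain r lab \<phi> A s) face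
    (\<lambda>c y v. of_int (\<epsilon> c) * pullback (face c) (Omega r lab) y v)"
proof -
  let ?\<omega> = "\<lambda>c u v. of_int (\<epsilon> c) * Omega r lab u v"
  have "\<forall>c\<in>conics r. differential_form (r - 3) (L_complement r lab) (?\<omega> c) \<and>
      face c ` web_domain r lab \<phi> A s \<subseteq> L_complement r lab \<and>
      (\<forall>y\<in>web_domain r lab \<phi> A s. \<forall>v. of_int (\<epsilon> c) * pullback (face c) (Omega r lab) y v = pullback (face c) (?\<omega> c) y v)"
  proof
    fix c assume c: "c \<in> conics r"
    have "differential_form (r - 3) (L_complement r lab) (?\<omega> c)"
      by (rule Omega_differential_form[OF r(1)])
    moreover have "face c ` web_domain r lab \<phi> A s \<subseteq> L_complement r lab"
      using c unfolding web_domain_def L_complement_def by blast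
    moreover have "of_int (\<epsilon> c) * pullback (face c) (Omega r lab) y v = pullback (face c) (?\<omega> c) y v" for y v
      by (simp only: pullback_def)
    ultimately show "differential_form (r - 3) (L_complement r lab) (?\<omega> c) \<and>
        face c ` web_domain r lab \<phi> A s \<subseteq> L_complement r lab \<and>
        (\<forall>y\<in>web_domain r lab \<phi> A s. \<forall>v. of_int (\<epsilon> c) * pullback (face c) (Omega r lab) y v = pullback (face c) (?\<omega> c) y v)"
      by blast
  qed
  then have "\<exists>S \<omega>. \<forall>c\<in>conics r. differential_form (r - 3) (S c) (\<omega> c) \<and>
      face c ` web_domain r lab \<phi> A s \<subseteq> S c \<and>
      (\<forall>y\<in>web_domain r lab \<phi> A s. \<forall>v. of_int (\<epsilon> c) * pullback (face c) (Omega r lab) y v = pullback (face c) (\<omega> c) y v)"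
    by (intro exI[of _ "\<lambda>_. L_complement r lab"] exI[of _ ?\<omega>])
  then show ?thesis
    unfolding abelian_relation_def using assms unfolding hlog_relation_def by (rule conjI)
qed

lemma coord_torus_orbit:
  assumes "c \<in> conics r" "x' \<in> torus_orbit r x"
  obtains \<kappa> where "\<kappa> \<noteq> 0" "\<And>j. j < r - 1 \<Longrightarrow> coord c x' j = \<kappa> * coord c x j"
proof -
  obtain \<kappa> where "\<kappa> \<noteq> 0" "\<And>l. l \<in> lines r \<Longrightarrow> partner c l \<in> lines r \<Longrightarrow>
      x' l * x' (partner c l) = \<kappa> * (x l * x (partner c l))"
    using torus_orbit_pairs[OF assms(2)] by metis
  then show ?thesis
    using conic_frame_lines[OF frame[OF assms(1)]]
    by (intro that[of \<kappa>]) (auto simp: face_coord_def mult.assoc mult.left_commute)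
qed

lemma ratio_point_torus_orbit:
  assumes "c \<in> conics r" "x' \<in> torus_orbit r x"
  shows "ratio_point lab (coord c x') = ratio_point lab (coord c x)"
proof -
  obtain \<kappa> where \<kappa>: "\<kappa> \<noteq> 0" "\<And>j. j < r - 1 \<Longrightarrow> coord c x' j = \<kappa> * coord c x j"
    using coord_torus_orbit[OF assms] by blast
  have "lab k < r - 1" for k
  proof -
    have "lab k \<in> {1..r - 3}" using lab by (auto simp: bij_betw_def)
    then show ?thesis using r by auto
  qed
  then show ?thesis
    using \<kappa> r by (simp add: ratio_point_def Finite_Cartesian_Product.vec_eq_iff)
qed

text \<open>The curves \<open>t \<mapsto> \<phi> (Y i t)\<close> and the straight lines through \<open>g p\<close> in the cone run through the same torus orbits,
  so the face maps agree on them.  Comparing derivatives at \<open>t = 0\<close> carries the pullback over to the cone.\<close>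

lemma pullback_at_cone_point:
  assumes c: "c \<in> conics r" and g: "g \<in> G_group r" and p: "p \<in> exceptional_span r" "\<And>i. \<zeta> i \<in> exceptional_span r"
    and nz: "\<And>l. l \<in> lines r \<Longrightarrow> g p l \<noteq> 0"
    and Y0: "\<And>i. Y i 0 = y"
    and orbit: "\<And>i. \<forall>\<^sub>F t in nhds 0. torus_orbit r (\<phi> (Y i t)) = torus_orbit r (\<lambda>l. g p l + of_real t * g (\<zeta> i) l)"
    and deriv: "\<And>i. (Y i has_derivative (\<lambda>t. t *\<^sub>R v i)) (at (0::real))"
  shows "coord c (\<phi> y) j \<noteq> 0 \<or> \<not> j < r - 1"
    and "pullback (face c) (Omega r lab) y v = pairdet r c (A c) (log_data (g p) (\<lambda>i. g (\<zeta> i)))"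
proof -
  note fl = conic_frame_lines[OF frame[OF c]]
  have r3: "3 \<le> r" using r(1) by simp
  let ?x = "\<lambda>i t l. g p l + of_real t * g (\<zeta> i) l"
  have x0: "?x i 0 = g p" for i by auto
  have orbit': "\<phi> (Y i t) \<in> torus_orbit r (?x i t)" if "torus_orbit r (\<phi> (Y i t)) = torus_orbit r (?x i t)" for i t
    using \<phi>_orbit[of "Y i t"] that by simp
  have "torus_orbit r (\<phi> y) = torus_orbit r (g p)"
    using eventually_nhds_x_imp_x[OF orbit[of 0]] by (simp add: Y0)
  then have orb0: "\<phi> y \<in> torus_orbit r (g p)" using \<phi>_orbit[of y] by simp
  have x_nz: "coord c (g p) j \<noteq> 0" if "j < r - 1" for j
    using coord_nonzero[OF c that] nz fl[OF that] by simp
  obtain \<kappa> where \<kappa>: "\<kappa> \<noteq> 0" "\<And>j. j < r - 1 \<Longrightarrow> coord c (\<phi> y) j = \<kappa> * coord c (g p) j"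
    using coord_torus_orbit[OF c orb0] by blast
  have y_nz: "coord c (\<phi> y) j \<noteq> 0" if "j < r - 1" for j
    using \<kappa> x_nz that by simp
  then show "coord c (\<phi> y) j \<noteq> 0 \<or> \<not> j < r - 1" by blast
  let ?D = "frechet_derivative (face c) (at y)"
  have face_D: "(face c has_derivative ?D) (at y)"
    using differentiableI[OF face_has_derivative[OF c y_nz]] by (simp only: frechet_derivative_works)
  have D: "?D (v i) = ratio_tangent lab (coord c (g p))
      (\<lambda>j. g (\<zeta> i) (A c j) / g p (A c j) + g (\<zeta> i) (partner c (A c j)) / g p (partner c (A c j)))" for i
  proof -
    have Y_D: "((\<lambda>t. face c (Y i t)) has_derivative (\<lambda>t. ?D (t *\<^sub>R v i))) (at 0)"
      using has_derivative_compose[OF deriv[of i], of "face c" ?D] face_D by (simp add: Y0)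
    have x_D: "((\<lambda>t. ratio_point lab (coord c (?x i t))) has_derivative
        (\<lambda>h. ratio_tangent lab (coord c (?x i 0))
          (\<lambda>j. of_real h * g (\<zeta> i) (A c j) / ?x i 0 (A c j) + of_real h * g (\<zeta> i) (partner c (A c j)) / ?x i 0 (partner c (A c j))))) (at 0)"
    proof (rule ratio_has_derivative[where x = "?x i" and \<xi> = "\<lambda>h l. of_real h * g (\<zeta> i) l" and a = "A c" and c = c and s = "s c", OF _ _ _ lab r(1)])
      have "((\<lambda>t. ?x i t l) has_derivative (\<lambda>h. of_real h * g (\<zeta> i) l)) (at 0)" for l
        by (auto intro!: derivative_eq_intros)
      then show "((\<lambda>t. ?x i t (A c j)) has_derivative (\<lambda>h. of_real h * g (\<zeta> i) (A c j))) (at 0)"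
        "((\<lambda>t. ?x i t (partner c (A c j))) has_derivative (\<lambda>h. of_real h * g (\<zeta> i) (partner c (A c j)))) (at 0)" for j
        by blast+
      show "?x i 0 (A c j) \<noteq> 0 \<and> ?x i 0 (partner c (A c j)) \<noteq> 0 \<and> s c j \<noteq> 0" if "j < r - 1" for j
        using nz fl[OF that] sign[OF c that] by auto
    qed
    have near: "\<forall>\<^sub>F t in nhds 0. ratio_point lab (coord c (?x i t)) = face c (Y i t)"
      using orbit[of i] by eventually_elim
        (simp add: face_ratio ratio_point_torus_orbit[OF c orbit'])
    have "((\<lambda>t. face c (Y i t)) has_derivative
        (\<lambda>h. ratio_tangent lab (coord c (?x i 0))
          (\<lambda>j. of_real h * g (\<zeta> i) (A c j) / ?x i 0 (A c j) + of_real h * g (\<zeta> i) (partner c (A c j)) / ?x i 0 (partner c (A c j))))) (at 0)"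
    proof (rule has_derivative_transform_eventually[where g = "\<lambda>t. face c (Y i t)", OF x_D])
      show "\<forall>\<^sub>F t in at 0. ratio_point lab (coord c (?x i t)) = face c (Y i t)"
        using near unfolding eventually_nhds_conv_at by (rule conjunct1)
      show "ratio_point lab (coord c (?x i 0)) = face c (Y i 0)"
        by (rule eventually_nhds_x_imp_x[OF near])
    qed simp
    then have "(\<lambda>t. ?D (t *\<^sub>R v i)) = (\<lambda>h. ratio_tangent lab (coord c (?x i 0))
          (\<lambda>j. of_real h * g (\<zeta> i) (A c j) / ?x i 0 (A c j) + of_real h * g (\<zeta> i) (partner c (A c j)) / ?x i 0 (partner c (A c j))))"
      by (rule has_derivative_unique[OF Y_D])
    from fun_cong[OF this, of 1] show ?thesis by simp
  qed
  have "face c y = ratio_point lab (coord c (g p))"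
    unfolding face_ratio by (rule ratio_point_torus_orbit[OF c orb0])
  then have "pullback (face c) (Omega r lab) y v = Omega r lab (ratio_point lab (coord c (g p)))
      (\<lambda>i. ratio_tangent lab (coord c (g p))
        (\<lambda>j. g (\<zeta> i) (A c j) / g p (A c j) + g (\<zeta> i) (partner c (A c j)) / g p (partner c (A c j))))"
    by (simp add: pullback_def D)
  also have "\<dots> = pairdet r c (A c) (log_data (g p) (\<lambda>i. g (\<zeta> i)))"
  proof (rule Omega_log_data[OF lab r(1)])
    have "g p (exceptional_class 1) \<noteq> 0" using nz r by (intro nz exceptional_class_line) auto
    then have "p \<noteq> (\<lambda>_. 0)" using G_group_zero[OF g] by auto
    then have cone: "g p \<in> minuscule_cone r"
      using r p(1) by (intro minuscule_cone_G_group[OF g] exceptional_span_cone) auto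
    show "(\<Sum>j<r - 1. s c j * g p (A c j) * g p (partner c (A c j))) = 0" by (rule quadric[OF c cone])
    show "(\<Sum>j<r - 1. s c j * (g p (A c j) * g (\<zeta> i) (partner c (A c j)) + g (\<zeta> i) (A c j) * g p (partner c (A c j)))) = 0" for i
      by (rule quadric_polarization[OF quadric[OF c] r3 g p(1) p(2)])
    fix j assume j: "j < r - 1"
    show "g p (A c j) \<noteq> 0 \<and> g p (partner c (A c j)) \<noteq> 0 \<and> (s c j = 1 \<or> s c j = - 1)"
      using nz fl[OF j] sign[OF c j] by blast
  qed
  finally show "pullback (face c) (Omega r lab) y v = pairdet r c (A c) (log_data (g p) (\<lambda>i. g (\<zeta> i)))" .
qed

text \<open>The inverse of the chart is only defined off a hypersurface \<open>Q = 0\<close> of the cone, which may contain the given point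
  \<open>g p\<close>.  Since \<open>p\<close> and the group can be moved along polynomials to a point with \<open>Q \<noteq> 0\<close>, the relation extends by
  continuity.\<close>

lemma chart_relation:
  assumes rel: "hlog_relation r lab \<phi> A s \<epsilon>"
  shows "lin_rel (\<lambda>c. of_int (\<epsilon> c * hlog_sign c))"
  unfolding lin_rel_def
proof (intro ballI allI impI)
  fix g p and \<zeta> :: "nat \<Rightarrow> weight_vec"
  assume g: "g \<in> G_group r" and p: "p \<in> exceptional_span r" and \<zeta>: "\<forall>k. \<zeta> k \<in> exceptional_span r"
    and nz: "\<forall>l\<in>lines r. g p l \<noteq> 0"
  have line1: "exceptional_class 1 \<in> lines r" using r by (intro exceptional_class_line) auto
  obtain P q where P: "\<forall>k. P k \<in> weight_polynomials r" and q: "q \<in> weight_polynomials r"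
    and gen: "generically (weight_polynomials r) (minuscule_cone r)
      (\<lambda>x. q x \<noteq> 0 \<and> torus_orbit r (\<phi> (\<chi> k. P k x / q x)) = torus_orbit r x)"
    using chart unfolding birational_chart_def by (elim conjE exE) (rule that; assumption)
  note P = P[rule_format]
  obtain Q x1 where Q: "Q \<in> weight_polynomials r" and x1: "x1 \<in> minuscule_cone r" "Q x1 \<noteq> 0"
    and inverse: "\<forall>x\<in>minuscule_cone r. Q x \<noteq> 0 \<longrightarrow>
      q x \<noteq> 0 \<and> torus_orbit r (\<phi> (\<chi> k. P k x / q x)) = torus_orbit r x"
    using gen unfolding generically_def by (elim bexE conjE) (rule that; assumption)
  note inverse = inverse[rule_format]
  \<comment> \<open>At points of the cone where the inverse of the chart is defined, the relation pulls back.\<close>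
  have generic: "(\<Sum>c\<in>conics r. of_int (\<epsilon> c) * pairdet r c (A c) (log_data (h p') (\<lambda>i. h (\<zeta> i)))) = 0"
    if h: "h \<in> G_group r" and p': "p' \<in> exceptional_span r" and nz': "\<And>l. l \<in> lines r \<Longrightarrow> h p' l \<noteq> 0"
      and Qnz: "Q (h p') \<noteq> 0" for h p'
  proof -
    define x where "x i t = (\<lambda>l. h p' l + of_real t * h (\<zeta> i) l)" for i and t :: real
    define Y where "Y i t = (\<chi> k. P k (x i t) / q (x i t))" for i t
    define y where "y = (\<chi> k. P k (h p') / q (h p'))"
    have x0: "x i 0 = h p'" for i by (auto simp: x_def)
    have Y0: "Y i 0 = y" for i by (simp add: Y_def y_def x0)
    have image: "x i t = h (\<lambda>l. p' l + of_real t * \<zeta> i l)" for i t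
      unfolding x_def by (rule G_group_linear[OF h, symmetric])
    define xc where "xc i t = (\<lambda>l. h p' l + t * h (\<zeta> i) l)" for i and t :: complex
    have xc: "x i t = xc i (of_real t)" for i t by (simp add: x_def xc_def)
    have curve: "poly_curve (\<lambda>t. xc i t l)" for i l
      unfolding xc_def by (intro poly_curve_add poly_curve_mult poly_curve_const poly_curve_id)
    have weight_curve: "\<exists>R. \<forall>t. f (x i t) = poly R (of_real t)" if "f \<in> weight_polynomials r" for f i
      using weight_polynomial_curve[where x = "xc i", OF that curve] unfolding poly_curve_def xc by metis
    have cont: "isCont (\<lambda>t. f (x i t)) 0" if f: "f \<in> weight_polynomials r" for f i
    proof -
      obtain R where "\<And>t. f (x i t) = poly R (of_real t)" using weight_curve[OF f] by blast
      then show ?thesis by (auto intro!: continuous_intros)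
    qed
    have near: "\<forall>\<^sub>F t in nhds 0. Q (x i t) \<noteq> 0 \<and> x i t (exceptional_class 1) \<noteq> 0" for i
    proof -
      have nonzero: "\<forall>\<^sub>F t in nhds 0. f (x i t) \<noteq> 0" if "isCont (\<lambda>t. f (x i t)) 0" "f (h p') \<noteq> 0" for f :: "weight_vec \<Rightarrow> complex"
      proof -
        have "((\<lambda>t. f (x i t)) \<longlongrightarrow> f (x i 0)) (nhds 0)"
          using that(1) tendsto_at_iff_tendsto_nhds[of "\<lambda>t. f (x i t)" 0] by (simp add: isCont_def)
        then show ?thesis using that(2) unfolding x0 by (rule tendsto_imp_eventually_ne)
      qed
      have "(\<lambda>x. x (exceptional_class 1)) \<in> weight_polynomials r"
        using line1 by (intro polynomial_algebra.generator) (rule imageI)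
      from nonzero[OF cont[OF this]] have "\<forall>\<^sub>F t in nhds 0. x i t (exceptional_class 1) \<noteq> 0"
        using nz'[OF line1] by simp
      then show ?thesis by (intro eventually_conj nonzero[OF cont[OF Q] Qnz])
    qed
    have orbit: "\<forall>\<^sub>F t in nhds 0. torus_orbit r (\<phi> (Y i t)) = torus_orbit r (\<lambda>l. h p' l + of_real t * h (\<zeta> i) l)" for i
      using near[of i]
    proof eventually_elim
      case (elim t)
      have span: "(\<lambda>l. p' l + of_real t * \<zeta> i l) \<in> exceptional_span r"
        using \<zeta> by (intro exceptional_span_closed p') blast
      have "(\<lambda>l. p' l + of_real t * \<zeta> i l) \<noteq> (\<lambda>_. 0)"
      proof
        assume "(\<lambda>l. p' l + of_real t * \<zeta> i l) = (\<lambda>_. 0)"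
        then have "x i t (exceptional_class 1) = 0" unfolding image by (simp add: G_group_zero[OF h])
        then show False using elim by simp
      qed
      then have "x i t \<in> minuscule_cone r"
        unfolding image using r by (intro minuscule_cone_G_group[OF h] exceptional_span_cone span) auto
      then show ?case using inverse elim unfolding Y_def by (simp add: x_def)
    qed
    have q0: "q (h p') \<noteq> 0"
    proof -
      have "p' \<noteq> (\<lambda>_. 0)" using nz'[OF line1] G_group_zero[OF h] by auto
      then have "h p' \<in> minuscule_cone r"
        using r by (intro minuscule_cone_G_group[OF h] exceptional_span_cone p') auto
      then show ?thesis using inverse Qnz by blast
    qed
    \<comment> \<open>The inverse of the chart is differentiable along the lines, being a quotient of polynomials in \<open>t\<close>.\<close>
    have d_ex: "\<exists>d. ((\<lambda>t. P k (x i t) / q (x i t)) has_derivative (\<lambda>t. of_real t * d)) (at 0)" for i k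
    proof -
      obtain R R' where R: "\<And>t. P k (x i t) = poly R (of_real t)" "\<And>t. q (x i t) = poly R' (of_real t)"
        using weight_curve[OF P] weight_curve[OF q] by metis
      have R'0: "poly R' 0 \<noteq> 0" using q0 R(2)[of 0] by (simp add: x0)
      have "((\<lambda>z. poly R z / poly R' z) has_field_derivative
          (poly (pderiv R) 0 * poly R' 0 - poly R 0 * poly (pderiv R') 0) / (poly R' 0 * poly R' 0)) (at (of_real 0))"
        using R'0 by (auto intro!: DERIV_divide poly_DERIV)
      then have "((\<lambda>t. poly R (of_real t) / poly R' (of_real t)) has_vector_derivative
          (poly (pderiv R) 0 * poly R' 0 - poly R 0 * poly (pderiv R') 0) / (poly R' 0 * poly R' 0)) (at (0::real))"
        by (rule has_vector_derivative_real_field)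
      then show ?thesis
        unfolding R has_vector_derivative_def scaleR_conv_of_real by blast
    qed
    define d where "d i k = (SOME d. ((\<lambda>t. P k (x i t) / q (x i t)) has_derivative (\<lambda>t. of_real t * d)) (at 0))" for i k
    have d: "((\<lambda>t. P k (x i t) / q (x i t)) has_derivative (\<lambda>t. of_real t * d i k)) (at 0)" for i k
      unfolding d_def by (rule someI_ex[OF d_ex])
    define v where "v i = (\<chi> k. d i k)" for i
    have deriv: "(Y i has_derivative (\<lambda>t. t *\<^sub>R v i)) (at 0)" for i
    proof -
      have "((\<lambda>t. \<chi> k. P k (x i t) / q (x i t)) has_derivative (\<lambda>t. \<chi> k. of_real t * d i k)) (at 0)"
        by (rule has_derivative_vec_lambda[OF d])
      moreover have "(\<lambda>t. \<chi> k. of_real t * d i k) = (\<lambda>t. t *\<^sub>R v i)"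
      proof (rule ext)
        fix t
        have "t *\<^sub>R d i k = of_real t * d i k" for k by (rule scaleR_conv_of_real)
        then show "(\<chi> k. of_real t * d i k) = t *\<^sub>R v i"
          by (simp add: v_def Finite_Cartesian_Product.vec_eq_iff)
      qed
      moreover have "(\<lambda>t. \<chi> k. P k (x i t) / q (x i t)) = Y i" by (auto simp: Y_def)
      ultimately show ?thesis by simp
    qed
    note point = pullback_at_cone_point[OF _ h p' \<zeta>[rule_format] nz' Y0 orbit deriv]
    have "y \<in> web_domain r lab \<phi> A s"
      unfolding web_domain_iff using point(1) by blast
    then have "(\<Sum>c\<in>conics r. of_int (\<epsilon> c) * pullback (face c) (Omega r lab) y v) = 0"
      using rel by (simp add: hlog_relation_def)
    moreover have "(\<Sum>c\<in>conics r. of_int (\<epsilon> c) * pullback (face c) (Omega r lab) y v) =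
        (\<Sum>c\<in>conics r. of_int (\<epsilon> c) * pairdet r c (A c) (log_data (h p') (\<lambda>i. h (\<zeta> i))))"
      by (rule sum.cong) (simp_all only: point(2))
    ultimately show ?thesis by simp
  qed
  \<comment> \<open>Every point is a limit of such points along a polynomial path.\<close>
  obtain a h where x1_eq: "x1 = scale a (h (weight_vector (exceptional_class r)))" and h: "h \<in> G_group r"
    using x1(1) by (auto simp: minuscule_cone_def)
  obtain k where k: "G_path r k" "k 0 = g" "k 1 = h" using G_path_exists[OF g h] by blast
  \<comment> \<open>The path from \<open>p\<close> to the vector whose translate by \<open>h\<close> is \<open>x1\<close>.\<close>
  define z where "z t = (\<lambda>l. (1 - t) * p l + t * (a * weight_vector (exceptional_class r) l))" for t :: complex
  have z_span: "z t \<in> exceptional_span r" for t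
  proof -
    have "weight_vector (exceptional_class r) \<in> exceptional_span r"
      using r by (intro weight_vector_span) auto
    then have "p l = 0 \<and> weight_vector (exceptional_class r) l = 0" if "l \<notin> exceptional_class ` {1..r}" for l
      using that p unfolding exceptional_span_def by blast
    then have "z t l = 0" if "l \<notin> exceptional_class ` {1..r}" for l
      using that by (simp add: z_def)
    then show ?thesis unfolding exceptional_span_def by blast
  qed
  have kG: "k t \<in> G_group r" for t using k(1) by (simp add: G_path_def)
  have k_curve: "poly_curve (\<lambda>t. k t (w t) l)" if "\<And>l. poly_curve (\<lambda>t. w t l)" for w l
    using k(1) that by (simp add: G_path_def)
  have z_curve: "poly_curve (\<lambda>t. z t l)" for l
  proof -
    have "(\<lambda>t. z t l) = poly [:p l, a * weight_vector (exceptional_class r) l - p l:]"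
      by (auto simp: z_def algebra_simps)
    then show ?thesis unfolding poly_curve_def by blast
  qed
  have X_curve: "poly_curve (\<lambda>t. k t (z t) l)" for l by (rule k_curve[OF z_curve])
  have \<Xi>_curve: "poly_curve (\<lambda>t. k t (\<zeta> i) l)" for i l by (rule k_curve) (rule poly_curve_const)
  have z0: "z 0 = p" by (simp add: z_def)
  have "z 1 = scale a (weight_vector (exceptional_class r))" by (simp add: z_def scale_def)
  then have X1: "k 1 (z 1) = x1" unfolding x1_eq k(3) by (simp add: G_group_scale[OF h])
  have lim: "((\<lambda>t. f t) \<longlongrightarrow> f 0) (at 0)" if "poly_curve f" for f
    using poly_curve_isCont[OF that, of 0] by (simp add: isCont_def)
  have "\<forall>\<^sub>F t in at 0. Q (k t (z t)) \<noteq> 0"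
    by (rule poly_curve_eventually_nonzero[OF weight_polynomial_curve[OF Q X_curve], of 1]) (simp add: X1 x1(2))
  moreover have "\<forall>\<^sub>F t in at 0. \<forall>l\<in>lines r. k t (z t) l \<noteq> 0"
  proof (intro eventually_ball_finite finite_lines r ballI)
    fix l assume l: "l \<in> lines r"
    then have "k 0 (z 0) l \<noteq> 0" using nz by (simp add: z0 k(2))
    then show "\<forall>\<^sub>F t in at 0. k t (z t) l \<noteq> 0"
      by (rule poly_curve_eventually_nonzero[OF X_curve])
  qed
  ultimately have "\<forall>\<^sub>F t in at 0. (\<Sum>c\<in>conics r. of_int (\<epsilon> c) * pairdet r c (A c) (log_data (k t (z t)) (\<lambda>i. k t (\<zeta> i)))) = 0"
    by eventually_elim (rule generic[OF kG z_span], auto)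
  then have lim0: "((\<lambda>t. \<Sum>c\<in>conics r. of_int (\<epsilon> c) * pairdet r c (A c) (log_data (k t (z t)) (\<lambda>i. k t (\<zeta> i)))) \<longlongrightarrow> 0) (at 0)"
    by (rule tendsto_eventually)
  have data: "((\<lambda>t. log_data (k t (z t)) (\<lambda>i. k t (\<zeta> i)) n l) \<longlongrightarrow> log_data (g p) (\<lambda>i. g (\<zeta> i)) n l) (at 0)"
    if l: "l \<in> lines r" for n l
  proof -
    have X: "((\<lambda>t. k t (z t) l) \<longlongrightarrow> g p l) (at 0)" using lim[OF X_curve[of l]] by (simp add: k(2) z0)
    have \<Xi>: "((\<lambda>t. k t (\<zeta> i) l) \<longlongrightarrow> g (\<zeta> i) l) (at 0)" for i using lim[OF \<Xi>_curve[of i l]] by (simp add: k(2))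
    have "g p l \<noteq> 0" using nz l by blast
    then show ?thesis
      unfolding log_data_def by (cases "n = 0") (auto intro!: tendsto_intros X \<Xi>)
  qed
  have "((\<lambda>t. \<Sum>c\<in>conics r. of_int (\<epsilon> c) * pairdet r c (A c) (log_data (k t (z t)) (\<lambda>i. k t (\<zeta> i)))) \<longlongrightarrow>
      (\<Sum>c\<in>conics r. of_int (\<epsilon> c) * pairdet r c (A c) (log_data (g p) (\<lambda>i. g (\<zeta> i))))) (at 0)"
  proof (intro tendsto_sum tendsto_mult tendsto_const)
    fix c assume c: "c \<in> conics r"
    note fl = conic_frame_lines[OF frame[OF c]]
    show "((\<lambda>t. pairdet r c (A c) (log_data (k t (z t)) (\<lambda>i. k t (\<zeta> i)))) \<longlongrightarrow>
        pairdet r c (A c) (log_data (g p) (\<lambda>i. g (\<zeta> i)))) (at 0)"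
      unfolding pairdet_def
    proof (rule tendsto_mdet)
      fix i j assume "j < r - 1"
      then show "((\<lambda>t. if i = 0 then 1 else log_data (k t (z t)) (\<lambda>i. k t (\<zeta> i)) (i - 1) (A c j) +
            log_data (k t (z t)) (\<lambda>i. k t (\<zeta> i)) (i - 1) (partner c (A c j))) \<longlongrightarrow>
          (if i = 0 then 1 else log_data (g p) (\<lambda>i. g (\<zeta> i)) (i - 1) (A c j) +
            log_data (g p) (\<lambda>i. g (\<zeta> i)) (i - 1) (partner c (A c j)))) (at 0)"
        by (cases "i = 0") (simp_all add: tendsto_add data fl)
    qed
  qed
  from tendsto_unique[OF _ this lim0]
  have "(\<Sum>c\<in>conics r. of_int (\<epsilon> c) * pairdet r c (A c) (log_data (g p) (\<lambda>i. g (\<zeta> i)))) = 0" by simp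
  moreover have unit: "of_int (\<epsilon> c * hlog_sign c) * oriented_det r c (A c) G = of_int (\<epsilon> c) * pairdet r c (A c) G"
    if "c \<in> conics r" for c G
    using hlog_sign_unit[OF that] by (auto simp: oriented_det_def hlog_sign_def)
  ultimately show "(\<Sum>c\<in>conics r. of_int (\<epsilon> c * hlog_sign c) * oriented_det r c (A c) (log_data (g p) (\<lambda>k. g (\<zeta> k)))) = 0"
    by (simp only: unit cong: sum.cong)
qed

lemma hlog_sign_unique:
  assumes "sign_vector r \<epsilon>" "hlog_relation r lab \<phi> A s \<epsilon>"
  shows "(\<forall>c\<in>conics r. \<epsilon> c = hlog_sign c) \<or> (\<forall>c\<in>conics r. \<epsilon> c = - hlog_sign c)"
proof -
  have "of_int (\<epsilon> c * hlog_sign c) = (of_int (\<epsilon> ruling * hlog_sign ruling) :: complex)" if "c \<in> conics r" for c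
    by (rule lin_rel_constant[OF chart_relation[OF assms(2)] that])
  then have const: "\<epsilon> c * hlog_sign c = \<epsilon> ruling * hlog_sign ruling" if "c \<in> conics r" for c
    using that of_int_eq_iff by blast
  have unit: "(\<epsilon> c = 1 \<or> \<epsilon> c = - 1) \<and> (hlog_sign c = 1 \<or> hlog_sign c = - 1)" if "c \<in> conics r" for c
    using assms(1) that hlog_sign_unit by (simp add: sign_vector_def)
  have "\<epsilon> ruling * hlog_sign ruling = 1 \<or> \<epsilon> ruling * hlog_sign ruling = - 1"
    using unit[OF ruling_conic'] by auto
  then show ?thesis
  proof
    assume 1: "\<epsilon> ruling * hlog_sign ruling = 1"
    have "\<epsilon> c = hlog_sign c" if "c \<in> conics r" for c
      using const[OF that] unit[OF that] 1 by auto
    then show ?thesis by blast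
  next
    assume 1: "\<epsilon> ruling * hlog_sign ruling = - 1"
    have "\<epsilon> c = - hlog_sign c" if "c \<in> conics r" for c
      using const[OF that] unit[OF that] 1 by auto
    then show ?thesis by blast
  qed
qed

end

theorem proposition7p5:
  fixes r :: nat
    and \<phi> :: "complex^'n \<Rightarrow> weight_vec"
    and lab :: "'m::finite \<Rightarrow> nat"
    and a :: "pic \<Rightarrow> nat \<Rightarrow> pic"
    and s :: "pic \<Rightarrow> nat \<Rightarrow> complex"
  assumes "r \<in> {4, 5, 6, 7}"
    and "CARD('n) = GM_dim r"
    and "bij_betw lab UNIV {1..r - 3}"
    and "birational_chart r \<phi>"
    and "\<And>F. F \<in> conics r \<Longrightarrow> face_frame r F (a F) (s F)"
  shows "\<exists>\<epsilon>. sign_vector r \<epsilon> \<and> hlog_relation r lab \<phi> a s \<epsilon> \<and>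
    (\<forall>\<epsilon>'. sign_vector r \<epsilon>' \<and> hlog_relation r lab \<phi> a s \<epsilon>' \<longrightarrow>
       (\<forall>F\<in>conics r. \<epsilon>' F = \<epsilon> F) \<or> (\<forall>F\<in>conics r. \<epsilon>' F = - \<epsilon> F)) \<and>
    abelian_relation (r - 3) (conics r) (web_domain r lab \<phi> a s)
      (\<lambda>F. face_map lab \<phi> F (a F) (s F))
      (\<lambda>F y v. of_int (\<epsilon> F) * pullback (face_map lab \<phi> F (a F) (s F)) (Omega r lab) y v)"
proof -
  have r: "4 \<le> r" "r \<le> 7" using assms(1) by auto
  have range: "{0..r - 2} = {0..<r - 1}" using r by auto
  interpret GM_chart r a s \<phi> lab
  proof
    fix c assume "c \<in> conics r"
    then have ff: "face_frame r c (a c) (s c)" by (rule assms(5))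
    show "conic_frame r c (a c)"
      using ff unfolding face_frame_def conic_frame_def range by blast
    show "s c j = 1 \<or> s c j = - 1" if "j < r - 1" for j
      using ff that unfolding face_frame_def range by simp
    show "(\<Sum>j<r - 1. s c j * x (a c j) * x (partner c (a c j))) = 0" if "x \<in> minuscule_cone r" for x
      using ff that unfolding face_frame_def range by (simp add: atLeast0LessThan)
  qed (use r assms in auto)
  have "sign_vector r hlog_sign"
    using hlog_sign_unit by (simp add: sign_vector_def)
  then show ?thesis
    using hlog_relation_hlog_sign hlog_sign_unique abelian_relation_hlog[OF hlog_relation_hlog_sign] by blast
qed

end
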